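(* Let $X$ be a locally compact Polish space and $\sigma$ a non-atomic Radon measure on $X$. Let $m$ be the measure on $X\times\mathbb R_+$ given by $dm(x,s)=\frac{l(x,s)}{s}\,d\sigma(x)\,ds$, where for each $x\in X$ either $l(x,s)>0$ for all $s\in\mathbb R_+$ or $l(x,s)=0$ for all $s\in\mathbb R_+$. Let $Y:=\{x\in X\mid l(x,\cdot)>0\}$ and assume that $$\int_{A\times\mathbb R_+}l(x,s)\min\{s^{-1},1\}\,d\sigma(x)\,ds<\infty\quad\text{for all }A\in\mathcal B_0(Y).$$ Assume that, for each $n\in\mathbb N$, there exists $\epsilon>0$ such that, for each $A\in\mathcal B_0(Y)$, $$\int_A\left[\sup_{r\in[\frac1n,n]}\int_{(0,\epsilon)}\frac{|l(x,rs)-l(x,s)|}{s}\,ds\right]d\sigma(x)<\infty.$$ Then the measure $\mu_m$ is quasi-invariant with respect to all transformations from the group $C_0(X\to\mathbb R_+)$, i.e., each $\theta\in C_0(X\to\mathbb R_+)$ maps $\mathbb K(X)$ into itself, and $\mu_m^\theta$ is equivalent to $\mu_m$. Furthermore, the corresponding density is given by $$\frac{d\mu_m^\theta}{d\mu_m}(\eta)=\exp\bigg[\int_Y\log\left(\frac{l(x,\theta^{-1}(x)s_x)}{l(x,s_x)}\right)s_x^{-1}\,d\eta(x)+\int_Y\int_{\mathbb R_+}\frac{l(x,s)-l(x,\theta^{-1}(x)s)}{s}\,ds\,d\sigma(x)\bigg],$$ where the function appearing under the sign of the integral with respect to the measure $\eta$ belongs to $L^1(Y,\eta)$ for $\mu_m$-a.a.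 $\eta\in\mathbb K(X)$.
   Context: $\mathbb R_+=(0,\infty)$. $l:X\times\mathbb R_+\to[0,\infty)$ is measurable. $\mathcal B(X)$ is the Borel $\sigma$-algebra of $X$, $\mathcal B_0(X)$ is the collection of sets in $\mathcal B(X)$ with compact closure, and for $Y\in\mathcal B(X)$, $\mathcal B_0(Y)$ is the collection of all $A\in\mathcal B_0(X)$ with $A\subset Y$. $\mathbb M(X)$ is the set of Radon measures on $X$ (finite on compact sets) with the vague topology and its Borel $\sigma$-algebra. $\mathbb K(X)\subset\mathbb M(X)$ is the set of discrete Radon measures $\eta=\sum_i s_i\delta_{x_i}$ with $s_i>0$, the $x_i\in X$ distinct and at most countably many (the zero measure included), with the trace $\sigma$-algebra. For $\eta\in\mathbb K(X)$, $\tau(\eta)=\{x_i\}$ is its set of atoms and $s_x:=\eta(\{x\})$ for $x\in\tau(\eta)$. For a measure $m$ on $X\times\mathbb R_+$ with $m(\{x\}\times\mathbb R_+)=0$ for all $x\in X$ and $\int_{A\times\mathbb R_+}\min\{s,1\}\,dm(x,s)<\infty$ for all $A\in\mathcal B_0(X)$, $\mu_m$ denotes the unique probability measure on $\mathbb K(X)$ (the completely random measure with Lévy measure $m$) with Fourier transform $\int_{\mathbb K(X)}e^{i\int f\,d\eta}\,d\mu_m(\eta)=\exp\left[\int_X\int_{\mathbb R_+}(e^{isf(x)}-1)\,dm(x,s)\right]$ for all continuous compactly supported $f:X\to\mathbb R$. Under the assumptions of the claim $m$ satisfies these two conditions. $C_0(X\to\mathbb R_+)$ is the group (under pointwise multiplication)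 of continuous functions $\theta:X\to\mathbb R_+$ equal to $1$ outside a compact set; $\theta^{-1}(x)=1/\theta(x)$. It acts on $\mathbb M(X)$ by $\eta\mapsto\theta\eta$, where $\theta\eta$ has density $\theta$ with respect to $\eta$. $\mu_m^\theta$ is the pushforward of $\mu_m$ under $\eta\mapsto\theta\eta$. *)

theory Defs
  imports "HOL-Probability.Probability"
begin

definition cont_compact_support :: "('a::topological_space \<Rightarrow> real) set" where
  "cont_compact_support =
     {f. continuous_on UNIV f \<and> compact (closure {x. f x \<noteq> 0})}"

text \<open>
  Borel measures that are finite on compact sets. On a locally compact Polish space,
  regularity is automatic, so it is not demanded separately.
\<close>

definition radon_measures :: "'a::topological_space measure set" where
  "radon_measures =
     {\<eta>. sets \<eta> = sets borel \<and> (\<forall>K. compact K \<longrightarrow> emeasure \<eta> K < \<infinity>)}"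

text \<open>The coarsest topology making all \<open>\<eta> \<mapsto> \<integral> f d\<eta>\<close> continuous.\<close>

definition vague_topology :: "'a::topological_space measure topology" where
  "vague_topology = topology_generated_by
     {{\<eta> \<in> radon_measures. (LINT x|\<eta>. f x) \<in> U} | f U.
        f \<in> cont_compact_support \<and> open (U :: real set)}"

definition vague_borel :: "'a::topological_space measure measure" where
  "vague_borel = sigma radon_measures {U. openin vague_topology U}"

text \<open>
  Sums \<open>\<Sum>\<^sub>i s\<^sub>i \<delta>\<^bsub>x\<^sub>i\<^esub>\<close> with distinct \<open>x\<^sub>i\<close> are indexed by the (countable) set \<open>T\<close> of the
  \<open>x\<^sub>i\<close> themselves; \<open>T = {}\<close> gives the zero measure.
\<close>

definition discrete_radon_measures :: "'a::topological_space measure set" where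
  "discrete_radon_measures =
     {\<eta> \<in> radon_measures. \<exists>T (s :: 'a \<Rightarrow> real). countable T \<and> (\<forall>x\<in>T. 0 < s x) \<and>
        (\<forall>A\<in>sets borel. emeasure \<eta> A = (\<integral>\<^sup>+x. ennreal (s x) * indicator A x \<partial>count_space T))}"

definition discrete_radon_space :: "'a::topological_space measure measure" where
  "discrete_radon_space = restrict_space vague_borel discrete_radon_measures"

lemma topspace_vague_topology: "topspace vague_topology = radon_measures"
proof -
  have "(\<lambda>x. 0) \<in> cont_compact_support"
    by (simp add: cont_compact_support_def)
  then have "radon_measures \<in> {{\<eta> \<in> radon_measures. (LINT x|\<eta>. f x) \<in> U} | f U.
      f \<in> cont_compact_support \<and> open (U :: real set)}"
    by (intro CollectI exI[of _ "\<lambda>x. 0"] exI[of _ UNIV]) auto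
  then show ?thesis
    unfolding vague_topology_def topology_generated_by_topspace by blast
qed

lemma space_discrete_radon_space: "space discrete_radon_space = discrete_radon_measures"
  by (auto simp: discrete_radon_space_def vague_borel_def space_restrict_space
      space_measure_of_conv discrete_radon_measures_def)

definition bounded_borel :: "'a::topological_space set \<Rightarrow> 'a set set" where
  "bounded_borel Y = {A \<in> sets borel. A \<subseteq> Y \<and> compact (closure A)}"

definition lborel_pos :: "real measure" where
  "lborel_pos = restrict_space lborel {0<..}"

definition levy_measure ::
    "'a::topological_space measure \<Rightarrow> ('a \<Rightarrow> real \<Rightarrow> real) \<Rightarrow> ('a \<times> real) measure" where
  "levy_measure \<sigma> l = density (\<sigma> \<Otimes>\<^sub>M lborel_pos) (\<lambda>(x, s). ennreal (l x s / s))"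

text \<open>
  \<open>completely_random_measure m \<mu>\<close> says that \<open>\<mu>\<close> is the (unique) law on the discrete Radon measures
  with Levy measure \<open>m\<close>. It is meant for \<open>m\<close> that do not charge the sets \<open>{x} \<times> (0,\<infinity>)\<close> and integrate
  \<open>min s 1\<close> over \<open>A \<times> (0,\<infinity>)\<close> for relatively compact Borel sets \<open>A\<close>; then the exponent on the right
  is an absolutely convergent integral.
\<close>

definition completely_random_measure ::
    "('a::topological_space \<times> real) measure \<Rightarrow> 'a measure measure \<Rightarrow> bool" where
  "completely_random_measure m \<mu> \<longleftrightarrow>
     prob_space \<mu> \<and> sets \<mu> = sets discrete_radon_space \<and>
     (\<forall>f\<in>cont_compact_support.
        (CLINT \<eta>|\<mu>. iexp (LINT x|\<eta>. f x)) = exp (CLINT z|m. iexp (snd z * f (fst z)) - 1))"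

definition pos_multipliers :: "('a::topological_space \<Rightarrow> real) set" where
  "pos_multipliers = {\<theta>. continuous_on UNIV \<theta> \<and> (\<forall>x. 0 < \<theta> x) \<and>
     (\<exists>K. compact K \<and> (\<forall>x. x \<notin> K \<longrightarrow> \<theta> x = 1))}"

definition rescale :: "('a \<Rightarrow> real) \<Rightarrow> 'a measure \<Rightarrow> 'a measure" where
  "rescale \<theta> \<eta> = density \<eta> (\<lambda>x. ennreal (\<theta> x))"

end

theory Submission
  imports Defs
begin

text \<open>
  The measure \<open>\<mu>\<close> is given through its Fourier transform on the linear functionals \<open>\<integral> f d\<eta>\<close>, while the
  claimed density is a product over the atoms of \<open>\<eta>\<close>. The proof makes the atoms visible: it
  realises \<open>\<mu>\<close> as the law of \<open>\<Sum> s \<delta>\<^sub>x\<close>, summed over the points \<open>(x, s)\<close> of a Poisson process whose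
  intensity is the Levy measure \<open>m\<close>. For such a process the formula
  \<open>E exp (\<Sum> h(x, s)) = exp \<integral> (exp h - 1) dm\<close> (\<open>exponential_formula\<close>) holds for complex \<open>h\<close> with
  \<open>exp h - 1\<close> integrable and \<open>\<Sum> h\<close> almost surely absolutely convergent, and it is used for two choices
  of \<open>h\<close>.

  With \<open>h = i s f(x)\<close> it shows that the constructed law has the transform of \<open>\<mu>\<close>. With
  \<open>h = log \<rho>(x, s) + i s f(x)\<close>, where \<open>\<rho>(x, s) = l(x, s / \<theta>(x)) / l(x, s)\<close>, it shows that the measure with
  density \<open>\<Prod> \<rho> exp (- \<integral> (\<rho> - 1) dm)\<close> with respect to \<open>\<mu>\<close> has the transform
  \<open>exp \<integral> (exp (i s f(x)) - 1) \<rho> dm\<close>. Since \<open>ds / s\<close> is invariant under dilations, \<open>\<rho> m\<close> is the image of \<open>m\<close>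
  under \<open>(x, s) \<mapsto> (x, \<theta>(x) s)\<close> (\<open>distr_rescaled\<close>), so this is the transform of the image of \<open>\<mu>\<close>
  under \<open>\<eta> \<mapsto> \<theta>\<eta>\<close>. In both cases equality of transforms gives equality of laws
  (\<open>prob_measure_eq_if_char_agree\<close>).

  The analytic input is the integrability of \<open>\<rho> - 1\<close> with respect to \<open>m\<close> (\<open>\<rho>_integrable\<close>). The
  regularity of \<open>l\<close> near \<open>s = 0\<close> controls small marks, and \<open>m\<close> is finite on large marks over a compact set.
  It follows that \<open>\<Sum> \<bar>\<rho> - 1\<bar>\<close> is almost surely finite. Hence so is \<open>\<Sum> \<bar>log \<rho>\<bar>\<close>, because only finitely
  many terms are far from \<open>\<rho> = 1\<close>; this is the integrability of the logarithm with respect to \<open>\<eta>\<close>.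

  Passing from points to measures uses three facts. Distinct points have distinct positions almost
  surely, because \<open>\<sigma>\<close> has no atoms, so the mark \<open>s\<close> can be read off as the mass of \<open>\<eta>\<close> at \<open>x\<close>. The
  Borel sets of the vague topology are generated by the functionals \<open>\<integral> f d\<eta>\<close>
  (\<open>sets_discrete_radon_space\<close>), which rests on a countable subbase. Integrals of jointly measurable
  functions against \<open>\<eta>\<close> depend measurably on \<open>\<eta>\<close> (\<open>measurable_nn_integral_discrete_radon\<close>), which
  makes the density a measurable function.
\<close>

section \<open>Laws determined by the characteristic functions of a linear family\<close>

lemma finite_measure_eq_if_char_eq:
  fixes M N :: "real measure"
  assumes M: "finite_measure M" "sets M = sets borel"
    and N: "finite_measure N" "sets N = sets borel"
    and eq: "char M = char N"
  shows "M = N"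
proof -
  interpret M: finite_measure M by fact
  interpret N: finite_measure N by fact
  note [measurable_cong] = M(2) N(2)
  have spM: "space M = UNIV" and spN: "space N = UNIV"
    using sets_eq_imp_space_eq[OF M(2)] sets_eq_imp_space_eq[OF N(2)] by simp_all
  define c where "c = measure M UNIV"
  \<comment> \<open>The total mass is the value of the characteristic function at 0; both measures are normalised by it.\<close>
  have "char M 0 = char N 0" using eq by simp
  then have c: "measure N UNIV = c"
    unfolding char_def c_def by (simp add: spM spN)
  show ?thesis
  proof (cases "c = 0")
    case True
    have "emeasure M UNIV = 0" "emeasure N UNIV = 0"
      using True c by (simp_all add: c_def M.emeasure_eq_measure N.emeasure_eq_measure)
    then have "emeasure M A = 0" "emeasure N A = 0" for A
      using emeasure_space[of M A] emeasure_space[of N A] by (simp_all add: spM spN)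
    then show ?thesis
      using M(2) N(2) by (intro measure_eqI) simp_all
  next
    case False
    then have cpos: "c > 0" by (simp add: c_def zero_less_measure_iff)
    define D where "D = (\<lambda>L :: real measure. density L (\<lambda>_. ennreal (1 / c)))"
    have D: "real_distribution (D L) \<and> char (D L) = (\<lambda>t. (1/c) *\<^sub>R char L t)"
      if "finite_measure L" "sets L = sets borel" "measure L UNIV = c" for L
    proof -
      interpret L: finite_measure L by fact
      note [measurable_cong] = that(2)
      have "space L = UNIV" using sets_eq_imp_space_eq[OF that(2)] by simp
      then have "emeasure (D L) (space (D L)) = 1"
        using cpos that(3)
        by (simp add: D_def emeasure_density nn_integral_cmult L.emeasure_eq_measure
            ennreal_mult[symmetric])
      then have "real_distribution (D L)"
        using that(2) by (auto simp: real_distribution_def real_distribution_axioms_def D_def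
            intro!: prob_spaceI)
      moreover have "char (D L) t = (1/c) *\<^sub>R char L t" for t
        unfolding char_def D_def using cpos by (subst integral_density) auto
      ultimately show ?thesis by auto
    qed
    have "D M = D N"
      using D[OF M] D[OF N c] eq by (intro Levy_uniqueness) (auto simp: c_def)
    then have *: "emeasure (D M) A = emeasure (D N) A" for A by simp
    show ?thesis
    proof (rule measure_eqI)
      fix A assume A: "A \<in> sets M"
      then have [measurable]: "A \<in> sets borel" using M(2) by simp
      have "ennreal (1/c) * emeasure M A = ennreal (1/c) * emeasure N A"
        using *[of A] unfolding D_def
        by (simp add: emeasure_density nn_integral_cmult)
      then show "emeasure M A = emeasure N A"
        using cpos by (simp add: ennreal_mult_cancel_left)
    qed (simp add: M(2) N(2))
  qed
qed

lemma cos_times_iexp: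
  "complex_of_real (cos (a + c)) * iexp b =
     (iexp c * iexp (b + a) + iexp (- c) * iexp (b + (- 1) * a)) / 2"
  by (simp add: cos_exp_eq cos_of_real[symmetric] algebra_simps exp_add[symmetric] add_divide_distrib
      diff_divide_distrib exp_minus_inverse)

text \<open>
  A complex weight \<open>exp (i \<psi>)\<close> does not define a measure, so its real and imaginary parts enter through
  the nonnegative weights \<open>2 + cos (\<psi> + c)\<close>. The law of \<open>\<phi>\<close> under such a weight is a finite measure on
  the line, to which the one-dimensional uniqueness theorem applies.
\<close>

definition tilted_law ::
    "'b measure \<Rightarrow> 'b set \<Rightarrow> ('b \<Rightarrow> real) \<Rightarrow> ('b \<Rightarrow> real) \<Rightarrow> real \<Rightarrow> real measure" where
  "tilted_law M E \<phi> \<psi> c =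
     distr (density M (\<lambda>x. ennreal (indicator E x * (2 + cos (\<psi> x + c))))) borel \<phi>"

lemma tilt_bounds: "0 \<le> 2 + cos (a::real)" "2 + cos a \<le> 3"
  using cos_ge_minus_one[of a] cos_le_one[of a] by linarith+

lemma sets_tilted_law: "sets (tilted_law M E \<phi> \<psi> c) = sets borel"
  by (simp add: tilted_law_def)

context prob_space
begin

context
  fixes E :: "'a set" and \<phi> \<psi> :: "'a \<Rightarrow> real"
  assumes [measurable]: "E \<in> events" "\<phi> \<in> borel_measurable M" "\<psi> \<in> borel_measurable M"
begin

lemma finite_measure_tilted_law: "finite_measure (tilted_law M E \<phi> \<psi> c)"
proof -
  let ?W = "\<lambda>x. indicator E x * (2 + cos (\<psi> x + c)) :: real"
  have "emeasure (density M (\<lambda>x. ennreal (?W x))) (space M) = (\<integral>\<^sup>+x. ennreal (?W x) \<partial>M)"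
    by (simp add: emeasure_density cong: nn_integral_cong)
  also have "\<dots> \<le> (\<integral>\<^sup>+x. ennreal 3 \<partial>M)"
    using tilt_bounds by (intro nn_integral_mono ennreal_leI) (auto simp: indicator_def)
  also have "\<dots> < \<infinity>" by (simp add: emeasure_space_1)
  finally have "finite_measure (density M (\<lambda>x. ennreal (?W x)))"
    by (auto intro!: finite_measureI simp: top_unique)
  then show ?thesis unfolding tilted_law_def by (intro finite_measure.finite_measure_distr) auto
qed

lemma char_tilted_law:
  "char (tilted_law M E \<phi> \<psi> c) t = 2 * (CLINT x:E|M. iexp (t * \<phi> x)) +
     (iexp c * (CLINT x:E|M. iexp (t * \<phi> x + \<psi> x)) +
      iexp (- c) * (CLINT x:E|M. iexp (t * \<phi> x + (- 1) * \<psi> x))) / 2"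
proof -
  have nn: "0 \<le> indicator E x * (2 + cos (\<psi> x + c))" for x
    by (intro mult_nonneg_nonneg tilt_bounds) simp
  have int: "set_integrable M E (\<lambda>x. iexp (f x))" if [measurable]: "f \<in> borel_measurable M" for f :: "'a \<Rightarrow> real"
    unfolding set_integrable_def
    by (rule integrable_const_bound[where B=1]) (auto simp: indicator_def norm_exp_i_times)
  have 1: "set_integrable M E (\<lambda>x. iexp (t * \<phi> x))"
    "set_integrable M E (\<lambda>x. iexp (t * \<phi> x + \<psi> x))"
    "set_integrable M E (\<lambda>x. iexp (t * \<phi> x + (- 1) * \<psi> x))"
    by (rule int; measurable)+
  have "char (tilted_law M E \<phi> \<psi> c) t = (CLINT x|M. (indicator E x * (2 + cos (\<psi> x + c))) *\<^sub>R iexp (t * \<phi> x))"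
    unfolding char_def tilted_law_def using nn by (simp add: integral_distr integral_density)
  also have "\<dots> = (CLINT x:E|M. (2 * iexp (t * \<phi> x) +
      complex_of_real (cos (\<psi> x + c)) * iexp (t * \<phi> x)))"
    unfolding set_lebesgue_integral_def
    by (intro Bochner_Integration.integral_cong refl)
       (simp add: indicator_def algebra_simps scaleR_conv_of_real)
  finally show ?thesis
    unfolding cos_times_iexp using 1
    by (simp add: set_integral_add set_integral_mult_right set_integrable_mult_right)
qed

text \<open>
  The weights for \<open>c\<close> and \<open>c + pi\<close> differ by twice the cosine, so the constant \<open>2\<close> cancels.
\<close>

lemma integral_cos_tilted_law:
  assumes [measurable]: "B \<in> sets borel"
  shows "(LINT x:E \<inter> (\<phi> -` B \<inter> space M)|M. cos (\<psi> x + c)) =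
     (measure (tilted_law M E \<phi> \<psi> c) B - measure (tilted_law M E \<phi> \<psi> (c + pi)) B) / 2"
proof -
  define F where "F = E \<inter> (\<phi> -` B \<inter> space M)"
  have F[measurable]: "F \<in> events" unfolding F_def by measurable
  have int: "integrable M (\<lambda>x. indicator F x * (2 + cos (\<psi> x + d)))" for d
    by (rule integrable_const_bound[where B=3])
       (auto simp: indicator_def intro!: AE_I2 order.trans[OF abs_triangle_ineq])
  have WF: "measure (tilted_law M E \<phi> \<psi> d) B = (LINT x:F|M. 2 + cos (\<psi> x + d))" for d
  proof -
    have "emeasure (tilted_law M E \<phi> \<psi> d) B = (\<integral>\<^sup>+x. ennreal (indicator F x * (2 + cos (\<psi> x + d))) \<partial>M)"
      unfolding tilted_law_def
      by (simp add: emeasure_distr emeasure_density) (auto simp: F_def indicator_def intro!: nn_integral_cong)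
    also have "\<dots> = ennreal (LINT x|M. indicator F x * (2 + cos (\<psi> x + d)))"
      by (intro nn_integral_eq_integral int AE_I2 mult_nonneg_nonneg tilt_bounds) simp
    finally show ?thesis
      by (simp add: measure_def set_lebesgue_integral_def)
         (intro enn2real_ennreal Bochner_Integration.integral_nonneg mult_nonneg_nonneg tilt_bounds, simp)
  qed
  have sint: "set_integrable M F (\<lambda>x. 2 + cos (\<psi> x + d))" for d
    using int[of d] by (simp add: set_integrable_def)
  have "measure (tilted_law M E \<phi> \<psi> c) B - measure (tilted_law M E \<phi> \<psi> (c + pi)) B =
     (LINT x:F|M. (2 + cos (\<psi> x + c)) - (2 + cos (\<psi> x + (c + pi))))"
    unfolding WF by (rule set_integral_diff(2)[symmetric, OF sint sint])
  also have "\<dots> = (LINT x:F|M. 2 * cos (\<psi> x + c))"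
    by (simp add: add.assoc[symmetric])
  finally show ?thesis by (simp add: F_def)
qed

lemma set_integral_iexp_eq_cos:
  "(CLINT x:E|M. iexp (\<psi> x)) = Complex (LINT x:E|M. cos (\<psi> x + 0)) (LINT x:E|M. cos (\<psi> x + (- pi/2)))"
proof -
  have "integrable M (\<lambda>x. indicator E x *\<^sub>R iexp (\<psi> x))"
    by (rule integrable_const_bound[where B=1]) (auto simp: indicator_def norm_exp_i_times)
  then show ?thesis
    unfolding set_lebesgue_integral_def
    by (auto simp: complex_eq_iff integral_Re[symmetric] integral_Im[symmetric] Re_exp Im_exp cos_diff
        simp del: integral_Re integral_Im
        intro!: Bochner_Integration.integral_cong)
qed

end

end

text \<open>
  The induction step of the uniqueness theorem: agreement of all transforms restricted to an event \<open>E\<close>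
  survives intersecting \<open>E\<close> with one more event \<open>e i \<in> B\<close>. The characteristic function of a tilted law of
  \<open>e i\<close> is a combination of transforms of \<open>t * e i + a * e j\<close>, which belong to the family by linearity.
  Hence the tilted laws agree, and evaluating them on \<open>B\<close> gives the claim.
\<close>

lemma char_agree_restrict:
  fixes P Q :: "'b measure" and e :: "'i \<Rightarrow> 'b \<Rightarrow> real"
  assumes P: "prob_space P" and Q: "prob_space Q" and sets: "sets Q = sets P"
    and meas: "\<And>i. i \<in> I \<Longrightarrow> e i \<in> borel_measurable P"
    and lin: "\<And>i j a. i \<in> I \<Longrightarrow> j \<in> I \<Longrightarrow> \<exists>k\<in>I. \<forall>x\<in>space P. e k x = e i x + a * e j x"
    and E: "E \<in> sets P"
    and eqE: "\<And>i. i \<in> I \<Longrightarrow> (CLINT x:E|P. iexp (e i x)) = (CLINT x:E|Q. iexp (e i x))"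
    and i: "i \<in> I" and j: "j \<in> I" and B: "B \<in> sets borel"
  shows "(CLINT x:E \<inter> (e i -` B \<inter> space P)|P. iexp (e j x)) =
         (CLINT x:E \<inter> (e i -` B \<inter> space P)|Q. iexp (e j x))"
proof -
  interpret P: prob_space P by fact
  interpret Q: prob_space Q by fact
  have sp: "space Q = space P" using sets by (rule sets_eq_imp_space_eq)
  have mP: "e i \<in> borel_measurable P" "e j \<in> borel_measurable P" using meas i j by auto
  have mQ: "e i \<in> borel_measurable Q" "e j \<in> borel_measurable Q"
    using mP sets by (simp_all cong: measurable_cong_sets)
  have EQ: "E \<in> sets Q" using E sets by simp
  have eqlin: "(CLINT x:E|P. iexp (t * e i x + a * e j x)) = (CLINT x:E|Q. iexp (t * e i x + a * e j x))"
    for t a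
  proof -
    obtain k' where k': "k' \<in> I" "\<And>x. x\<in>space P \<Longrightarrow> e k' x = e i x + (t - 1) * e i x"
      using lin[OF i i] by blast
    obtain k where k: "k \<in> I" "\<And>x. x\<in>space P \<Longrightarrow> e k x = e k' x + a * e j x"
      using lin[OF k'(1) j] by blast
    have cong: "(CLINT x:E|L. iexp (t * e i x + a * e j x)) = (CLINT x:E|L. iexp (e k x))"
      if "space L = space P" for L
      unfolding set_lebesgue_integral_def using k(2) k'(2) that
      by (intro Bochner_Integration.integral_cong refl) (simp add: algebra_simps)
    show ?thesis using eqE[OF k(1)] cong[OF refl] cong[OF sp] by simp
  qed
  have "tilted_law P E (e i) (e j) c = tilted_law Q E (e i) (e j) c" for c
  proof (rule finite_measure_eq_if_char_eq)
    show "char (tilted_law P E (e i) (e j) c) = char (tilted_law Q E (e i) (e j) c)"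
      unfolding P.char_tilted_law[OF E mP] Q.char_tilted_law[OF EQ mQ] fun_eq_iff
      using eqlin[of _ 0] eqlin[of _ 1] eqlin[of _ "-1"] by simp
  qed (simp_all add: sets_tilted_law P.finite_measure_tilted_law[OF E mP] Q.finite_measure_tilted_law[OF EQ mQ])
  then have cosF: "(LINT x:E \<inter> (e i -` B \<inter> space P)|P. cos (e j x + c)) =
      (LINT x:E \<inter> (e i -` B \<inter> space P)|Q. cos (e j x + c))" for c
    by (simp only: P.integral_cos_tilted_law[OF E mP B] Q.integral_cos_tilted_law[OF EQ mQ B, unfolded sp])
  have F: "E \<inter> (e i -` B \<inter> space P) \<in> sets P" using E mP(1) B by (intro sets.Int measurable_sets)
  then have F': "E \<inter> (e i -` B \<inter> space P) \<in> sets Q" by (simp add: sets)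
  show ?thesis
    unfolding P.set_integral_iexp_eq_cos[OF F mP] Q.set_integral_iexp_eq_cos[OF F' mQ] cosF ..
qed

text \<open>
  A Cramer-Wold theorem for a possibly infinite family of random variables that is closed under
  linear combinations and generates the \<open>\<sigma>\<close>-algebra. Starting from the whole space, the restriction
  lemma reaches every finite intersection of events \<open>e i \<in> B\<close>, and these form a generating
  \<open>\<pi>\<close>-system.
\<close>

theorem prob_measure_eq_if_char_agree:
  fixes P Q :: "'b measure" and e :: "'i \<Rightarrow> 'b \<Rightarrow> real"
  assumes P: "prob_space P" and Q: "prob_space Q" and sets: "sets Q = sets P"
    and gen: "sets P = sigma_sets (space P) {e i -` B \<inter> space P | i B. i \<in> I \<and> B \<in> sets borel}"
    and lin: "\<And>i j a. i \<in> I \<Longrightarrow> j \<in> I \<Longrightarrow> \<exists>k\<in>I. \<forall>x\<in>space P. e k x = e i x + a * e j x"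
    and zero: "\<exists>k\<in>I. \<forall>x\<in>space P. e k x = 0"
    and eq: "\<And>i. i \<in> I \<Longrightarrow> (CLINT x|P. iexp (e i x)) = (CLINT x|Q. iexp (e i x))"
  shows "P = Q"
proof -
  interpret P: prob_space P by fact
  interpret Q: prob_space Q by fact
  have sp: "space Q = space P" using sets by (rule sets_eq_imp_space_eq)
  let ?G = "{e i -` B \<inter> space P | i B. i \<in> I \<and> B \<in> sets borel}"
  have meas: "e i \<in> borel_measurable P" if "i \<in> I" for i
  proof (rule measurableI)
    show "e i -` B \<inter> space P \<in> sets P" if "B \<in> sets borel" for B
      unfolding gen using that \<open>i \<in> I\<close> by (intro sigma_sets.Basic) blast
  qed simp
  \<comment> \<open>The events on which all restricted transforms agree; the zero function then compares their probabilities.\<close>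
  define H where "H = {E \<in> sets P. \<forall>i\<in>I. (CLINT x:E|P. iexp (e i x)) = (CLINT x:E|Q. iexp (e i x))}"
  have H0: "space P \<in> H"
  proof -
    have "(CLINT x:space P|L. f x) = (CLINT x|L. f x)" if "space L = space P" for L and f :: "'b \<Rightarrow> complex"
      unfolding set_lebesgue_integral_def that[symmetric]
      by (intro Bochner_Integration.integral_cong) auto
    then show ?thesis using eq sp unfolding H_def by simp
  qed
  have Hstep: "E \<inter> G \<in> H" if "E \<in> H" and Gin: "G \<in> ?G" for E G
  proof -
    obtain i B where G: "G = e i -` B \<inter> space P" "i \<in> I" "B \<in> sets borel" using Gin by blast
    show ?thesis
      using that(1) G meas[OF G(2)] char_agree_restrict[OF P Q sets meas lin, of E i _ B]
      unfolding H_def by (auto simp: G(1))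
  qed
  have Hem: "emeasure P E = emeasure Q E" if "E \<in> H" for E
  proof -
    obtain k where k: "k \<in> I" "\<And>x. x\<in>space P \<Longrightarrow> e k x = 0" using zero by blast
    have E: "E \<in> sets P" using that by (simp add: H_def)
    have 1: "(CLINT x:E|L. iexp (e k x)) = of_real (measure L E)" if "space L = space P" "E \<in> sets L" for L
    proof -
      have "(CLINT x:E|L. iexp (e k x)) = (CLINT x|L. of_real (indicator E x))"
        unfolding set_lebesgue_integral_def using k that
        by (intro Bochner_Integration.integral_cong) (auto simp: indicator_def)
      then show ?thesis using that sets.sets_into_space[OF that(2)] by (simp add: Int_absorb2)
    qed
    have "measure P E = measure Q E"
      using that k(1) 1[of P] 1[of Q] E sets sp unfolding H_def by simp
    then show ?thesis by (simp add: P.emeasure_eq_measure Q.emeasure_eq_measure)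
  qed
  define G' where "G' = {\<Inter>\<F> \<inter> space P | \<F>. finite \<F> \<and> \<F> \<subseteq> ?G}"
  have inH: "\<Inter>\<F> \<inter> space P \<in> H" if "finite \<F>" "\<F> \<subseteq> ?G" for \<F>
    using that
  proof (induction rule: finite_induct)
    case empty then show ?case using H0 by simp
  next
    case (insert G \<F>)
    have "\<F> \<subseteq> ?G" "G \<in> ?G" using insert.prems by simp_all
    then have "(\<Inter>\<F> \<inter> space P) \<inter> G \<in> H"
      by (rule Hstep[OF insert.IH])
    then show ?case by (simp add: Int_ac)
  qed
  show ?thesis
  proof (rule measure_eqI_generator_eq[where E=G' and \<Omega>="space P" and A="\<lambda>_. space P"])
    show "Int_stable G'"
    proof (rule Int_stableI)
      fix a b assume "a \<in> G'" "b \<in> G'"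
      then obtain F1 F2 where "a = \<Inter>F1 \<inter> space P" "finite F1" "F1 \<subseteq> ?G"
         "b = \<Inter>F2 \<inter> space P" "finite F2" "F2 \<subseteq> ?G" unfolding G'_def by blast
      then show "a \<inter> b \<in> G'" unfolding G'_def
        by (intro CollectI exI[of _ "F1 \<union> F2"]) auto
    qed
    show "G' \<subseteq> Pow (space P)" by (auto simp: G'_def)
    show "\<And>X. X \<in> G' \<Longrightarrow> emeasure P X = emeasure Q X"
      using inH Hem unfolding G'_def by blast
    have sub: "?G \<subseteq> G'"
    proof
      fix g assume g: "g \<in> ?G"
      then have "g \<subseteq> space P" by auto
      then show "g \<in> G'" using g unfolding G'_def by (intro CollectI exI[of _ "{g}"]) auto
    qed
    have "sigma_sets (space P) G' = sets P"
    proof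
      have "G' \<subseteq> sets P" using inH unfolding G'_def H_def by blast
      then show "sigma_sets (space P) G' \<subseteq> sets P" by (rule sets.sigma_sets_subset)
      show "sets P \<subseteq> sigma_sets (space P) G'"
        unfolding gen using sub by (rule sigma_sets_subseteq)
    qed
    then show "sets P = sigma_sets (space P) G'" "sets Q = sigma_sets (space P) G'"
      using sets by auto
    have "space P \<in> G'" unfolding G'_def by (intro CollectI exI[of _ "{}"]) auto
    then show "range (\<lambda>_::nat. space P) \<subseteq> G'" by auto
  qed auto
qed

section \<open>Poisson counts and products of independent coordinates\<close>

text \<open>
  The Poisson distribution including rate \<open>0\<close>, which occurs for the null sets of a partition.
\<close>

definition poisson_count :: "real \<Rightarrow> nat pmf" where
  "poisson_count r = (if r = 0 then return_pmf 0 else poisson_pmf r)"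

lemma pmf_poisson_count:
  "0 \<le> r \<Longrightarrow> pmf (poisson_count r) k = r ^ k / fact k * exp (- r)"
  by (cases k) (auto simp: poisson_count_def pmf_return)

text \<open>
  The probability generating function of the Poisson distribution, term by term.
\<close>

lemma poisson_generating_sums:
  fixes c :: "'c :: {real_normed_field, banach}"
  shows "(\<lambda>k. (r ^ k / fact k * exp (- r)) *\<^sub>R c ^ k) sums exp (of_real r * (c - 1))"
proof -
  have "(\<lambda>k. exp (- r) *\<^sub>R ((of_real r * c) ^ k /\<^sub>R fact k)) sums (exp (- r) *\<^sub>R exp (of_real r * c))"
    by (intro sums_scaleR_right exp_converges)
  also have "exp (- r) *\<^sub>R exp (of_real r * c) = exp (of_real r * (c - 1))"
    by (simp add: scaleR_conv_of_real exp_of_real[symmetric] exp_add[symmetric] algebra_simps)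
  finally show ?thesis
    by (simp add: power_mult_distrib scaleR_conv_of_real field_simps)
qed

lemma nn_integral_poisson_count:
  assumes "0 \<le> r" "0 \<le> c"
  shows "(\<integral>\<^sup>+k. ennreal c ^ k \<partial>poisson_count r) = ennreal (exp (r * (c - 1)))"
proof -
  have "(\<integral>\<^sup>+k. ennreal c ^ k \<partial>poisson_count r) = (\<Sum>k. ennreal ((r ^ k / fact k * exp (- r)) *\<^sub>R c ^ k))"
    unfolding nn_integral_measure_pmf nn_integral_count_space_nat
  proof (intro suminf_cong)
    fix k
    have "ennreal ((r ^ k / fact k * exp (- r)) * c ^ k) = ennreal (r ^ k / fact k * exp (- r)) * ennreal (c ^ k)"
      using assms by (intro ennreal_mult) auto
    then show "ennreal (pmf (poisson_count r) k) * ennreal c ^ k =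
        ennreal ((r ^ k / fact k * exp (- r)) *\<^sub>R c ^ k)"
      using assms by (simp add: pmf_poisson_count ennreal_power)
  qed
  also have "\<dots> = ennreal (exp (r * (c - 1)))"
    using poisson_generating_sums[of r c] assms by (intro suminf_ennreal_eq) auto
  finally show ?thesis .
qed

lemma integral_poisson_count:
  fixes c :: complex
  assumes r: "0 \<le> r"
  shows "integrable (poisson_count r) (\<lambda>k. c ^ k)"
    and "(\<integral>k. c ^ k \<partial>poisson_count r) = exp (of_real r * (c - 1))"
proof -
  show int: "integrable (poisson_count r) (\<lambda>k. c ^ k)"
  proof (rule integrableI_bounded)
    have "(\<integral>\<^sup>+k. ennreal (norm (c ^ k)) \<partial>poisson_count r) = ennreal (exp (r * (norm c - 1)))"
      using nn_integral_poisson_count[OF r, of "norm c"] by (simp add: norm_power ennreal_power)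
    then show "(\<integral>\<^sup>+k. ennreal (norm (c ^ k)) \<partial>poisson_count r) < \<infinity>" by simp
  qed simp
  have "integrable (count_space UNIV) (\<lambda>k. pmf (poisson_count r) k *\<^sub>R c ^ k)"
    using int unfolding measure_pmf_eq_density
    by (subst (asm) integrable_density) auto
  from sums_integral_count_space_nat[OF this]
  have "(\<lambda>k. pmf (poisson_count r) k *\<^sub>R c ^ k) sums (\<integral>k. c ^ k \<partial>poisson_count r)"
    unfolding measure_pmf_eq_density by (subst integral_density) auto
  then show "(\<integral>k. c ^ k \<partial>poisson_count r) = exp (of_real r * (c - 1))"
    using poisson_generating_sums[of r c] r by (simp add: pmf_poisson_count sums_unique2)
qed

lemma nn_integral_PiM_prod:
  assumes M: "\<And>i. prob_space (M i)" and J: "finite J"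
    and f: "\<And>i. i \<in> J \<Longrightarrow> f i \<in> borel_measurable (M i)"
  shows "(\<integral>\<^sup>+\<omega>. (\<Prod>i\<in>J. f i (\<omega> i)) \<partial>PiM UNIV M) = (\<Prod>i\<in>J. \<integral>\<^sup>+x. f i x \<partial>M i)"
proof -
  interpret product_prob_space M UNIV
    using M by (simp add: product_prob_space_def product_sigma_finite_def
        product_prob_space_axioms_def prob_space_imp_sigma_finite)
  have "(\<Prod>i\<in>J. \<integral>\<^sup>+x. f i x \<partial>M i) = (\<integral>\<^sup>+\<omega>. (\<Prod>i\<in>J. f i (\<omega> i)) \<partial>PiM J M)"
    using J f by (rule product_nn_integral_prod[symmetric])
  also have "PiM J M = distr (PiM UNIV M) (PiM J M) (\<lambda>x. restrict x J)"
    using distr_PiM_restrict_finite[OF J] by simp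
  also have "(\<integral>\<^sup>+\<omega>. (\<Prod>i\<in>J. f i (\<omega> i)) \<partial>\<dots>) = (\<integral>\<^sup>+\<omega>. (\<Prod>i\<in>J. f i (\<omega> i)) \<partial>PiM UNIV M)"
    using f by (subst nn_integral_distr) (auto intro!: borel_measurable_prod_ennreal
        measurable_restrict_subset measurable_compose[OF measurable_component_singleton]
        nn_integral_cong)
  finally show ?thesis by simp
qed

lemma integral_PiM_prod:
  fixes f :: "'i \<Rightarrow> 'b \<Rightarrow> complex"
  assumes M: "\<And>i. prob_space (M i)" and J: "finite J"
    and f: "\<And>i. i \<in> J \<Longrightarrow> integrable (M i) (f i)"
  shows "(\<integral>\<omega>. (\<Prod>i\<in>J. f i (\<omega> i)) \<partial>PiM UNIV M) = (\<Prod>i\<in>J. \<integral>x. f i x \<partial>M i)"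
proof -
  interpret product_prob_space M UNIV
    using M by (simp add: product_prob_space_def product_sigma_finite_def
        product_prob_space_axioms_def prob_space_imp_sigma_finite)
  have [measurable]: "f i \<in> borel_measurable (M i)" if "i \<in> J" for i
    using f[OF that] by auto
  have "(\<Prod>i\<in>J. \<integral>x. f i x \<partial>M i) = (\<integral>\<omega>. (\<Prod>i\<in>J. f i (\<omega> i)) \<partial>PiM J M)"
    using J f by (rule product_integral_prod[symmetric])
  also have "PiM J M = distr (PiM UNIV M) (PiM J M) (\<lambda>x. restrict x J)"
    using distr_PiM_restrict_finite[OF J] by simp
  also have "(\<integral>\<omega>. (\<Prod>i\<in>J. f i (\<omega> i)) \<partial>\<dots>) = (\<integral>\<omega>. (\<Prod>i\<in>J. f i (\<omega> i)) \<partial>PiM UNIV M)"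
    by (subst integral_distr) (auto intro!: borel_measurable_prod
        measurable_restrict_subset measurable_compose[OF measurable_component_singleton]
        Bochner_Integration.integral_cong)
  finally show ?thesis by simp
qed

lemma sum_le_prod_one_plus:
  fixes a :: "'i \<Rightarrow> ennreal"
  assumes "finite A"
  shows "1 + (\<Sum>i\<in>A. a i) \<le> (\<Prod>i\<in>A. 1 + a i)"
  using assms
proof (induction rule: finite_induct)
  case (insert x F)
  have "1 + (\<Sum>i\<in>insert x F. a i) = 1 * (1 + (\<Sum>i\<in>F. a i)) + a x * 1"
    using insert by (simp add: ac_simps)
  also have "\<dots> \<le> 1 * (\<Prod>i\<in>F. 1 + a i) + a x * (\<Prod>i\<in>F. 1 + a i)"
    using insert.IH by (intro add_mono mult_left_mono) (auto intro: order_trans[OF _ insert.IH])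
  also have "\<dots> = (\<Prod>i\<in>insert x F. 1 + a i)"
    using insert by (simp add: algebra_simps)
  finally show ?case .
qed simp

section \<open>Poisson processes and the exponential formula\<close>

text \<open>
  A Poisson process with \<open>\<sigma>\<close>-finite intensity \<open>m\<close> is the superposition of independent processes over the
  blocks \<open>S n\<close> of a partition. Block \<open>n\<close> carries a Poisson number of independent points, each
  distributed according to \<open>m\<close> conditioned on \<open>S n\<close>.
\<close>

locale poisson_construction =
  fixes m :: "'b measure" and S :: "nat \<Rightarrow> 'b set"
  assumes space_m: "space m = UNIV"
    and S_sets: "\<And>n. S n \<in> sets m"
    and S_finite: "\<And>n. emeasure m (S n) \<noteq> \<infinity>"
    and S_disjoint: "disjoint_family S"
    and S_cover: "(\<Union>n. S n) = UNIV"
begin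

lemmas [measurable] = S_sets
lemmas [simp] = space_m

definition rate :: "nat \<Rightarrow> real" where "rate n = measure m (S n)"

text \<open>
  On a block of intensity zero no point is ever active, so any probability measure will do.
\<close>

definition block :: "nat \<Rightarrow> 'b measure" where
  "block n = (if rate n = 0 then return m undefined else uniform_measure m (S n))"

lemma sets_block[simp, measurable_cong]: "sets (block n) = sets m"
  by (simp add: block_def)

lemma rate_nonneg[simp]: "0 \<le> rate n"
  by (simp add: rate_def)

lemma emeasure_S: "emeasure m (S n) = ennreal (rate n)"
  using S_finite[of n] by (simp add: rate_def emeasure_eq_ennreal_measure)

lemma prob_space_block: "prob_space (block n)"
proof (cases "rate n = 0")
  case False
  then show ?thesis
    using S_finite[of n] unfolding block_def
    by (auto intro!: prob_space_uniform_measure simp: emeasure_S)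
qed (simp add: block_def prob_space_return space_m)

lemma nn_integral_block:
  assumes [measurable]: "f \<in> borel_measurable m"
  shows "ennreal (rate n) * (\<integral>\<^sup>+x. f x \<partial>block n) = (\<integral>\<^sup>+x\<in>S n. f x \<partial>m)"
proof (cases "rate n = 0")
  case True
  then have "S n \<in> null_sets m" using emeasure_S[of n] by (intro null_setsI) auto
  then show ?thesis using True by (simp add: nn_integral_null_set)
next
  case False
  then show ?thesis
    unfolding block_def
    by (simp add: nn_integral_uniform_measure emeasure_S ennreal_times_divide)
       (subst mult.commute, simp add: ennreal_mult_divide_eq)
qed

text \<open>
  On a block of intensity zero the integral is a single value of \<open>a\<close>, finite because \<open>a\<close> is real.
\<close>

lemma nn_integral_block_finite:
  fixes a :: "'b \<Rightarrow> real"
  assumes [measurable]: "a \<in> borel_measurable m" and fin: "(\<integral>\<^sup>+x. ennreal (a x) \<partial>m) < \<infinity>"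
  shows "(\<integral>\<^sup>+x. ennreal (a x) \<partial>block n) < \<infinity>"
proof (cases "rate n = 0")
  case True
  then show ?thesis by (simp add: block_def nn_integral_return space_m)
next
  case False
  have "ennreal (rate n) * (\<integral>\<^sup>+x. ennreal (a x) \<partial>block n) \<le> (\<integral>\<^sup>+x. ennreal (a x) \<partial>m)"
    by (subst nn_integral_block) (auto intro!: nn_integral_mono simp: indicator_def)
  also note fin
  finally show ?thesis
    using False by (auto simp: ennreal_mult_less_top)
qed

lemma nn_integral_suminf_blocks:
  assumes [measurable]: "f \<in> borel_measurable m"
  shows "(\<Sum>n. \<integral>\<^sup>+x\<in>S n. f x \<partial>m) = (\<integral>\<^sup>+x. f x \<partial>m)"
proof -
  have "(\<Sum>n. f x * indicator (S n) x) = f x" for x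
    using suminf_cmult_indicator[OF S_disjoint, of x _ "\<lambda>_. f x"] S_cover by blast
  then show ?thesis
    by (subst nn_integral_suminf[symmetric]) auto
qed

lemma integral_block:
  fixes g :: "'b \<Rightarrow> complex"
  assumes [measurable]: "g \<in> borel_measurable m" and int: "integrable m (\<lambda>x. g x - 1)"
  shows "integrable (block n) g"
    and "of_real (rate n) * ((\<integral>x. g x \<partial>block n) - 1) = (LINT x:S n|m. g x - 1)"
proof -
  interpret block: prob_space "block n" by (rule prob_space_block)
  have "(\<integral>\<^sup>+x. ennreal (norm (g x - 1)) \<partial>block n) < \<infinity>"
    using int by (intro nn_integral_block_finite) (auto simp: integrable_iff_bounded)
  then have 1: "integrable (block n) (\<lambda>x. g x - 1)"
    by (intro integrableI_bounded) auto
  then have "integrable (block n) (\<lambda>x. (g x - 1) + 1)"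
    by (intro Bochner_Integration.integrable_add) auto
  then show 2: "integrable (block n) g" by simp
  have 3: "(\<integral>x. g x \<partial>block n) - 1 = (\<integral>x. g x - 1 \<partial>block n)"
    using 2 by (simp add: block.prob_space)
  show "of_real (rate n) * ((\<integral>x. g x \<partial>block n) - 1) = (LINT x:S n|m. g x - 1)"
  proof (cases "rate n = 0")
    case True
    then have "S n \<in> null_sets m" using emeasure_S[of n] by (intro null_setsI) auto
    from AE_not_in[OF this] have "(LINT x:S n|m. g x - 1) = 0"
      unfolding set_lebesgue_integral_def by (intro integral_eq_zero_AE) auto
    then show ?thesis using True by simp
  next
    case False
    then have pos: "rate n > 0" using rate_nonneg[of n] by linarith
    have eq: "block n = density m (\<lambda>x. ennreal (indicator (S n) x / rate n))"
      using False pos unfolding block_def uniform_measure_def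
      by (auto simp: emeasure_S divide_ennreal[symmetric] ennreal_indicator intro!: density_cong)
    show ?thesis
      using pos unfolding 3 unfolding eq set_lebesgue_integral_def integral_mult_right_zero[symmetric]
      by (subst integral_density)
         (auto simp: scaleR_conv_of_real simp flip: integral_mult_right_zero
           intro!: Bochner_Integration.integral_cong)
  qed
qed

abbreviation counts :: "(nat \<Rightarrow> nat) measure" where
  "counts \<equiv> PiM UNIV (\<lambda>n. measure_pmf (poisson_count (rate n)))"

abbreviation points :: "(nat \<times> nat \<Rightarrow> 'b) measure" where
  "points \<equiv> PiM UNIV (\<lambda>p. block (fst p))"

text \<open>
  A sample consists of the counts of all blocks and of infinitely many candidate points for every
  block. Candidate \<open>i\<close> of block \<open>n\<close> is active if \<open>i\<close> is below the count of \<open>n\<close>, and the configuration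
  is the counting measure of the active candidates.
\<close>

definition \<Omega> :: "((nat \<Rightarrow> nat) \<times> (nat \<times> nat \<Rightarrow> 'b)) measure" where
  "\<Omega> = counts \<Otimes>\<^sub>M points"

definition active :: "(nat \<Rightarrow> nat) \<times> (nat \<times> nat \<Rightarrow> 'b) \<Rightarrow> (nat \<times> nat) set" where
  "active \<omega> = {p. snd p < fst \<omega> (fst p)}"

definition config :: "(nat \<Rightarrow> nat) \<times> (nat \<times> nat \<Rightarrow> 'b) \<Rightarrow> 'b measure" where
  "config \<omega> = distr (count_space (active \<omega>)) m (snd \<omega>)"

lemma sets_config[simp, measurable_cong]: "sets (config \<omega>) = sets m"
  by (simp add: config_def)

lemma prob_space_counts: "prob_space counts"
  by (intro prob_space_PiM) (auto simp: prob_space_measure_pmf)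

lemma prob_space_points: "prob_space points"
  by (intro prob_space_PiM prob_space_block)

lemma prob_space_\<Omega>: "prob_space \<Omega>"
  unfolding \<Omega>_def using prob_space_counts prob_space_points by (rule prob_space_pair)

lemma measurable_count[measurable]: "(\<lambda>\<omega>. fst \<omega> n) \<in> measurable \<Omega> (count_space UNIV)"
proof -
  have "(\<lambda>k. k n) \<in> measurable counts (measure_pmf (poisson_count (rate n)))"
    by (rule measurable_component_singleton) simp
  then have "(\<lambda>k. k n) \<in> measurable counts (count_space UNIV)"
    by simp
  then show ?thesis unfolding \<Omega>_def by (rule measurable_compose[OF measurable_fst])
qed

lemma measurable_point[measurable]: "(\<lambda>\<omega>. snd \<omega> p) \<in> measurable \<Omega> m"
proof -
  have "(\<lambda>x. x p) \<in> measurable points (block (fst p))"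
    by (rule measurable_component_singleton) simp
  then have "(\<lambda>x. x p) \<in> measurable points m"
    by (simp cong: measurable_cong_sets)
  then show ?thesis unfolding \<Omega>_def by (rule measurable_compose[OF measurable_snd])
qed

lemma measurable_partial_prod[measurable]:
  fixes G :: "'b \<Rightarrow> 'c :: {second_countable_topology, real_normed_field}"
  assumes [measurable]: "G \<in> borel_measurable m"
  shows "(\<lambda>\<omega>. \<Prod>i<fst \<omega> n. G (snd \<omega> (n, i))) \<in> borel_measurable \<Omega>"
  by (rule measurable_compose_countable[where f="\<lambda>k \<omega>. \<Prod>i<k. G (snd \<omega> (n, i))" and g="\<lambda>\<omega>. fst \<omega> n"])
     measurable

lemma measurable_partial_prod_ennreal[measurable]:
  fixes G :: "'b \<Rightarrow> ennreal"
  assumes [measurable]: "G \<in> borel_measurable m"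
  shows "(\<lambda>\<omega>. \<Prod>i<fst \<omega> n. G (snd \<omega> (n, i))) \<in> borel_measurable \<Omega>"
  by (rule measurable_compose_countable[where f="\<lambda>k \<omega>. \<Prod>i<k. G (snd \<omega> (n, i))" and g="\<lambda>\<omega>. fst \<omega> n"])
     measurable

lemma measurable_partial_sum[measurable]:
  fixes G :: "'b \<Rightarrow> 'c :: {second_countable_topology, topological_comm_monoid_add}"
  assumes [measurable]: "G \<in> borel_measurable m"
  shows "(\<lambda>\<omega>. \<Sum>i<fst \<omega> n. G (snd \<omega> (n, i))) \<in> borel_measurable \<Omega>"
  by (rule measurable_compose_countable[where f="\<lambda>k \<omega>. \<Sum>i<k. G (snd \<omega> (n, i))" and g="\<lambda>\<omega>. fst \<omega> n"])
     measurable

lemma nn_integral_config: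
  assumes [measurable]: "f \<in> borel_measurable m"
  shows "(\<integral>\<^sup>+x. f x \<partial>config \<omega>) = (\<Sum>n. \<Sum>i<fst \<omega> n. f (snd \<omega> (n, i)))"
proof -
  have "(\<integral>\<^sup>+x. f x \<partial>config \<omega>) = (\<integral>\<^sup>+p. f (snd \<omega> p) * indicator (active \<omega>) p \<partial>count_space UNIV)"
    unfolding config_def by (simp add: nn_integral_distr nn_integral_count_space_indicator)
  also have "\<dots> = (\<Sum>n. \<Sum>i. f (snd \<omega> (n, i)) * indicator (active \<omega>) (n, i))"
    by (simp add: nn_integral_fst_count_space[symmetric] nn_integral_count_space_nat)
  also have "\<dots> = (\<Sum>n. \<Sum>i<fst \<omega> n. f (snd \<omega> (n, i)))"
  proof (intro suminf_cong)
    fix n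
    show "(\<Sum>i. f (snd \<omega> (n, i)) * indicator (active \<omega>) (n, i)) = (\<Sum>i<fst \<omega> n. f (snd \<omega> (n, i)))"
      by (subst suminf_finite[of "{..<fst \<omega> n}"]) (auto simp: active_def)
  qed
  finally show ?thesis .
qed

lemma measurable_nn_integral_config[measurable]:
  assumes [measurable]: "f \<in> borel_measurable m"
  shows "(\<lambda>\<omega>. \<integral>\<^sup>+x. f x \<partial>config \<omega>) \<in> borel_measurable \<Omega>"
  by (simp add: nn_integral_config)

text \<open>
  Absolutely convergent sums over the configuration are limits of the sums over the first \<open>N\<close> blocks,
  which is how they inherit measurability and become accessible to dominated convergence.
\<close>

lemma partial_sum_tendsto:
  fixes h :: "'b \<Rightarrow> complex"
  assumes int: "integrable (config \<omega>) h"
  shows "(\<lambda>N. \<Sum>n<N. \<Sum>i<fst \<omega> n. h (snd \<omega> (n, i))) \<longlonglongrightarrow> (\<integral>x. h x \<partial>config \<omega>)"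
proof -
  have [measurable]: "h \<in> borel_measurable m" using int by (auto cong: measurable_cong_sets)
  have intA: "integrable (count_space (active \<omega>)) (\<lambda>p. h (snd \<omega> p))"
    using int unfolding config_def by (subst (asm) integrable_distr_eq) auto
  have eq: "(\<integral>x. h x \<partial>config \<omega>) = (\<integral>p. h (snd \<omega> p) \<partial>count_space (active \<omega>))"
    unfolding config_def by (simp add: integral_distr)
  have part: "(\<Sum>n<N. \<Sum>i<fst \<omega> n. h (snd \<omega> (n, i))) =
      (\<integral>p. indicator {p. fst p < N} p *\<^sub>R h (snd \<omega> p) \<partial>count_space (active \<omega>))" for N
  proof -
    let ?J = "SIGMA n:{..<N}. {..<fst \<omega> n}"
    have "(\<integral>p. indicator {p. fst p < N} p *\<^sub>R h (snd \<omega> p) \<partial>count_space (active \<omega>)) =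
       (\<Sum>p | p \<in> active \<omega> \<and> indicator {p. fst p < N} p *\<^sub>R h (snd \<omega> p) \<noteq> 0. indicator {p. fst p < N} p *\<^sub>R h (snd \<omega> p))"
      by (rule lebesgue_integral_count_space_finite_support)
         (rule finite_subset[of _ ?J], auto simp: active_def indicator_def split: if_splits)
    also have "\<dots> = (\<Sum>p\<in>?J. indicator {p. fst p < N} p *\<^sub>R h (snd \<omega> p))"
      by (rule sum.mono_neutral_left) (auto simp: active_def indicator_def split: if_splits)
    also have "\<dots> = (\<Sum>(n, i)\<in>?J. h (snd \<omega> (n, i)))"
      by (rule sum.cong) auto
    also have "\<dots> = (\<Sum>n<N. \<Sum>i<fst \<omega> n. h (snd \<omega> (n, i)))"
      by (rule sum.Sigma[symmetric]) auto
    finally show ?thesis by simp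
  qed
  show ?thesis
    unfolding part eq
  proof (rule integral_dominated_convergence[where w="\<lambda>p. norm (h (snd \<omega> p))"])
    show "AE p in count_space (active \<omega>). (\<lambda>N. indicator {p. fst p < N} p *\<^sub>R h (snd \<omega> p)) \<longlonglongrightarrow> h (snd \<omega> p)"
    proof (rule AE_I2)
      fix p :: "nat \<times> nat"
      have "eventually (\<lambda>N. indicator {p. fst p < N} p *\<^sub>R h (snd \<omega> p) = h (snd \<omega> p)) sequentially"
        using eventually_gt_at_top[of "fst p"] by eventually_elim simp
      then show "(\<lambda>N. indicator {p. fst p < N} p *\<^sub>R h (snd \<omega> p)) \<longlonglongrightarrow> h (snd \<omega> p)"
        by (rule tendsto_eventually)
    qed
  qed (use intA in \<open>auto simp: indicator_def\<close>)
qed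

text \<open>
  Given the counts, the product runs over finitely many independent points; averaging over the counts
  then factorises over the blocks.
\<close>

lemma nn_integral_partial_prod:
  assumes [measurable]: "G \<in> borel_measurable m"
  shows "(\<integral>\<^sup>+\<omega>. (\<Prod>n<N. \<Prod>i<fst \<omega> n. G (snd \<omega> (n, i))) \<partial>\<Omega>) =
     (\<Prod>n<N. \<integral>\<^sup>+j. (\<integral>\<^sup>+x. G x \<partial>block n) ^ j \<partial>poisson_count (rate n))"
proof -
  interpret P2: prob_space points by (rule prob_space_points)
  have meas: "(\<lambda>\<omega>. \<Prod>n<N. \<Prod>i<fst \<omega> n. G (snd \<omega> (n, i))) \<in> borel_measurable (counts \<Otimes>\<^sub>M points)"
    unfolding \<Omega>_def[symmetric] by measurable
  have inner: "(\<integral>\<^sup>+x. (\<Prod>n<N. \<Prod>i<k n. G (x (n, i))) \<partial>points) = (\<Prod>n<N. (\<integral>\<^sup>+x. G x \<partial>block n) ^ k n)" for k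
  proof -
    let ?J = "SIGMA n:{..<N}. {..<k n}"
    have "(\<Prod>n<N. \<Prod>i<k n. G (x (n, i))) = (\<Prod>p\<in>?J. G (x p))" for x
      by (subst prod.Sigma) (auto intro!: prod.cong)
    then have "(\<integral>\<^sup>+x. (\<Prod>n<N. \<Prod>i<k n. G (x (n, i))) \<partial>points) = (\<integral>\<^sup>+x. (\<Prod>p\<in>?J. G (x p)) \<partial>points)"
      by simp
    also have "\<dots> = (\<Prod>p\<in>?J. \<integral>\<^sup>+x. G x \<partial>block (fst p))"
      by (rule nn_integral_PiM_prod) (auto simp: prob_space_block)
    also have "\<dots> = (\<Prod>n<N. \<Prod>i<k n. \<integral>\<^sup>+x. G x \<partial>block n)"
      by (subst prod.Sigma) (auto intro!: prod.cong)
    finally show ?thesis by simp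
  qed
  show ?thesis
    unfolding \<Omega>_def P2.nn_integral_fst[OF meas, symmetric]
    by (simp add: inner, subst nn_integral_PiM_prod) (auto simp: prob_space_measure_pmf)
qed

text \<open>
  The product of \<open>1 + a\<close> over all points. It has finite expectation when \<open>a\<close> is integrable, and it
  dominates both \<open>\<Sum> a\<close> and, for \<open>a = norm (g - 1)\<close>, every partial product of \<open>g\<close>.
\<close>

definition dominator :: "('b \<Rightarrow> real) \<Rightarrow> (nat \<Rightarrow> nat) \<times> (nat \<times> nat \<Rightarrow> 'b) \<Rightarrow> ennreal" where
  "dominator a \<omega> = (SUP N. \<Prod>n<N. \<Prod>i<fst \<omega> n. 1 + ennreal (a (snd \<omega> (n, i))))"

lemma measurable_dominator[measurable]:
  assumes [measurable]: "a \<in> borel_measurable m"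
  shows "dominator a \<in> borel_measurable \<Omega>"
  unfolding dominator_def by measurable

lemma nn_integral_dominator:
  assumes [measurable]: "a \<in> borel_measurable m" and fin: "(\<integral>\<^sup>+x. ennreal (a x) \<partial>m) < \<infinity>"
  shows "(\<integral>\<^sup>+\<omega>. dominator a \<omega> \<partial>\<Omega>) < \<infinity>"
proof -
  define I where "I = enn2real (\<integral>\<^sup>+x. ennreal (a x) \<partial>m)"
  have I: "(\<integral>\<^sup>+x. ennreal (a x) \<partial>m) = ennreal I" using fin by (simp add: I_def)
  define b where "b n = enn2real (\<integral>\<^sup>+x. ennreal (a x) \<partial>block n)" for n
  have b: "(\<integral>\<^sup>+x. ennreal (a x) \<partial>block n) = ennreal (b n)" for n
    using nn_integral_block_finite[OF assms, of n] by (simp add: b_def)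
  have b0: "0 \<le> b n" for n by (simp add: b_def)
  have I0: "0 \<le> I" by (simp add: I_def)
  have b1: "(\<integral>\<^sup>+x. 1 + ennreal (a x) \<partial>block n) = ennreal (1 + b n)" for n
    using prob_space.emeasure_space_1[OF prob_space_block, of n] b0
    by (simp add: nn_integral_add b ennreal_plus)
  have sumb: "(\<Sum>n<N. rate n * b n) \<le> I" for N
  proof -
    have "ennreal (\<Sum>n<N. rate n * b n) = (\<Sum>n<N. \<integral>\<^sup>+x\<in>S n. ennreal (a x) \<partial>m)"
      using b0 by (simp add: sum_ennreal[symmetric] ennreal_mult b[symmetric] nn_integral_block del: sum_ennreal)
    also have "\<dots> \<le> (\<Sum>n. \<integral>\<^sup>+x\<in>S n. ennreal (a x) \<partial>m)"
      by (rule sum_le_suminf) auto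
    also have "\<dots> = ennreal I" by (simp add: nn_integral_suminf_blocks I)
    finally show ?thesis using I0 by (simp add: ennreal_le_iff)
  qed
  have "(\<integral>\<^sup>+\<omega>. (\<Prod>n<N. \<Prod>i<fst \<omega> n. 1 + ennreal (a (snd \<omega> (n, i)))) \<partial>\<Omega>) \<le> ennreal (exp I)" for N
  proof -
    have "(\<integral>\<^sup>+\<omega>. (\<Prod>n<N. \<Prod>i<fst \<omega> n. 1 + ennreal (a (snd \<omega> (n, i)))) \<partial>\<Omega>) =
       (\<Prod>n<N. \<integral>\<^sup>+j. ennreal (1 + b n) ^ j \<partial>poisson_count (rate n))"
      by (subst nn_integral_partial_prod) (auto simp: b1)
    also have "\<dots> = (\<Prod>n<N. ennreal (exp (rate n * b n)))"
      using b0 by (subst nn_integral_poisson_count) (auto simp: add_nonneg_nonneg)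
    also have "\<dots> = ennreal (exp (\<Sum>n<N. rate n * b n))"
      by (simp add: prod_ennreal exp_sum)
    also have "\<dots> \<le> ennreal (exp I)" using sumb[of N] by (intro ennreal_leI) simp
    finally show ?thesis .
  qed
  moreover have "(\<integral>\<^sup>+\<omega>. dominator a \<omega> \<partial>\<Omega>) =
      (SUP N. \<integral>\<^sup>+\<omega>. (\<Prod>n<N. \<Prod>i<fst \<omega> n. 1 + ennreal (a (snd \<omega> (n, i)))) \<partial>\<Omega>)"
    unfolding dominator_def
  proof (rule nn_integral_monotone_convergence_SUP)
    have "(\<Prod>n<N. \<Prod>i<fst \<omega> n. 1 + ennreal (a (snd \<omega> (n, i)))) * 1 \<le>
       (\<Prod>n<N. \<Prod>i<fst \<omega> n. 1 + ennreal (a (snd \<omega> (n, i)))) * (\<Prod>i<fst \<omega> N. 1 + ennreal (a (snd \<omega> (N, i))))" for N \<omega>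
      by (intro mult_left_mono prod_ge_1) auto
    then show "incseq (\<lambda>N \<omega>. \<Prod>n<N. \<Prod>i<fst \<omega> n. 1 + ennreal (a (snd \<omega> (n, i))))"
      by (intro incseq_SucI le_funI) simp
  qed simp
  ultimately have "(\<integral>\<^sup>+\<omega>. dominator a \<omega> \<partial>\<Omega>) \<le> ennreal (exp I)"
    by (simp add: SUP_le_iff)
  then show ?thesis by (simp add: order.strict_trans1)
qed

lemma AE_dominator_finite:
  assumes "a \<in> borel_measurable m" and "(\<integral>\<^sup>+x. ennreal (a x) \<partial>m) < \<infinity>"
  shows "AE \<omega> in \<Omega>. dominator a \<omega> < \<infinity>"
  using nn_integral_PInf_AE[of "dominator a" \<Omega>] nn_integral_dominator[OF assms] assms(1)
  by (auto simp: top.not_eq_extremum)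

text \<open>
  Because \<open>\<Sum> a \<le> \<Prod> (1 + a)\<close>, and the right-hand side has finite expectation.
\<close>

lemma AE_nn_integral_config_finite:
  assumes [measurable]: "a \<in> borel_measurable m" and fin: "(\<integral>\<^sup>+x. ennreal (a x) \<partial>m) < \<infinity>"
  shows "AE \<omega> in \<Omega>. (\<integral>\<^sup>+x. ennreal (a x) \<partial>config \<omega>) < \<infinity>"
  using AE_dominator_finite[OF assms]
proof eventually_elim
  case (elim \<omega>)
  have "(\<Sum>n<N. \<Sum>i<fst \<omega> n. ennreal (a (snd \<omega> (n, i)))) \<le> dominator a \<omega>" for N
  proof -
    let ?J = "SIGMA n:{..<N}. {..<fst \<omega> n}"
    have "(\<Sum>n<N. \<Sum>i<fst \<omega> n. ennreal (a (snd \<omega> (n, i)))) = (\<Sum>p\<in>?J. ennreal (a (snd \<omega> p)))"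
      by (subst sum.Sigma) (auto intro!: sum.cong)
    also have "\<dots> \<le> 1 + (\<Sum>p\<in>?J. ennreal (a (snd \<omega> p)))" by simp
    also have "\<dots> \<le> (\<Prod>p\<in>?J. 1 + ennreal (a (snd \<omega> p)))" by (rule sum_le_prod_one_plus) auto
    also have "\<dots> = (\<Prod>n<N. \<Prod>i<fst \<omega> n. 1 + ennreal (a (snd \<omega> (n, i))))"
      by (subst prod.Sigma) (auto intro!: prod.cong)
    also have "\<dots> \<le> dominator a \<omega>" unfolding dominator_def by (rule SUP_upper) simp
    finally show ?thesis .
  qed
  then have "(\<integral>\<^sup>+x. ennreal (a x) \<partial>config \<omega>) \<le> dominator a \<omega>"
    by (simp add: nn_integral_config suminf_eq_SUP SUP_le_iff)
  from le_less_trans[OF this elim] show ?case .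
qed

lemma partial_prod_le_dominator:
  "(\<Prod>n<N. \<Prod>i<fst \<omega> n. 1 + ennreal (a (snd \<omega> (n, i)))) \<le> dominator a \<omega>"
  unfolding dominator_def by (rule SUP_upper) simp

lemma norm_partial_prod_le_dominator:
  fixes g :: "'b \<Rightarrow> complex"
  shows "ennreal (norm (\<Prod>n<N. \<Prod>i<fst \<omega> n. g (snd \<omega> (n, i)))) \<le> dominator (\<lambda>x. norm (g x - 1)) \<omega>"
proof -
  \<comment> \<open>Compare the products factor by factor.\<close>
  have "norm z \<le> 1 + norm (z - 1)" for z :: complex
    using norm_triangle_sub[of z 1] by simp
  then have "ennreal (norm (\<Prod>n<N. \<Prod>i<fst \<omega> n. g (snd \<omega> (n, i)))) \<le>
      ennreal (\<Prod>n<N. \<Prod>i<fst \<omega> n. 1 + norm (g (snd \<omega> (n, i)) - 1))"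
    unfolding prod_norm[symmetric] by (intro ennreal_leI prod_mono conjI prod_nonneg) auto
  also have "\<dots> = (\<Prod>n<N. \<Prod>i<fst \<omega> n. 1 + ennreal (norm (g (snd \<omega> (n, i)) - 1)))"
    by (simp add: prod_ennreal[symmetric] prod_nonneg ennreal_plus del: prod_ennreal)
  also note partial_prod_le_dominator
  finally show ?thesis .
qed

lemma integral_partial_prod:
  fixes g :: "'b \<Rightarrow> complex"
  assumes [measurable]: "g \<in> borel_measurable m" and int: "integrable m (\<lambda>x. g x - 1)"
  shows "(\<integral>\<omega>. (\<Prod>n<N. \<Prod>i<fst \<omega> n. g (snd \<omega> (n, i))) \<partial>\<Omega>) =
     exp (LINT x:(\<Union>n<N. S n)|m. g x - 1)"
proof -
  interpret P1: prob_space counts by (rule prob_space_counts)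
  interpret P2: prob_space points by (rule prob_space_points)
  interpret pair_sigma_finite counts points ..
  have fin: "(\<integral>\<^sup>+x. ennreal (norm (g x - 1)) \<partial>m) < \<infinity>"
    using int by (simp add: integrable_iff_bounded)
  have "integrable \<Omega> (\<lambda>\<omega>. \<Prod>n<N. \<Prod>i<fst \<omega> n. g (snd \<omega> (n, i)))"
  proof (rule integrableI_bounded)
    have "(\<integral>\<^sup>+\<omega>. ennreal (norm (\<Prod>n<N. \<Prod>i<fst \<omega> n. g (snd \<omega> (n, i)))) \<partial>\<Omega>)
      \<le> (\<integral>\<^sup>+\<omega>. dominator (\<lambda>x. norm (g x - 1)) \<omega> \<partial>\<Omega>)"
      by (intro nn_integral_mono norm_partial_prod_le_dominator)
    also have "\<dots> < \<infinity>" using fin by (intro nn_integral_dominator) auto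
    finally show "(\<integral>\<^sup>+\<omega>. ennreal (norm (\<Prod>n<N. \<Prod>i<fst \<omega> n. g (snd \<omega> (n, i)))) \<partial>\<Omega>) < \<infinity>" .
  qed measurable
  from integral_fst'[OF this[unfolded \<Omega>_def]]
  have "(\<integral>\<omega>. (\<Prod>n<N. \<Prod>i<fst \<omega> n. g (snd \<omega> (n, i))) \<partial>\<Omega>) =
     (\<integral>k. \<integral>x. (\<Prod>n<N. \<Prod>i<k n. g (x (n, i))) \<partial>points \<partial>counts)"
    unfolding \<Omega>_def by simp
  also have "\<dots> = (\<integral>k. (\<Prod>n<N. (\<integral>x. g x \<partial>block n) ^ k n) \<partial>counts)"
  proof (intro Bochner_Integration.integral_cong refl)
    fix k :: "nat \<Rightarrow> nat"
    let ?J = "SIGMA n:{..<N}. {..<k n}"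
    have "(\<Prod>n<N. \<Prod>i<k n. g (x (n, i))) = (\<Prod>p\<in>?J. g (x p))" for x
      by (subst prod.Sigma) (auto intro!: prod.cong)
    then have "(\<integral>x. (\<Prod>n<N. \<Prod>i<k n. g (x (n, i))) \<partial>points) = (\<integral>x. (\<Prod>p\<in>?J. g (x p)) \<partial>points)"
      by simp
    also have "\<dots> = (\<Prod>p\<in>?J. \<integral>x. g x \<partial>block (fst p))"
      by (rule integral_PiM_prod) (auto simp: prob_space_block integral_block[OF assms])
    also have "\<dots> = (\<Prod>n<N. \<Prod>i<k n. \<integral>x. g x \<partial>block n)"
      by (subst prod.Sigma) (auto intro!: prod.cong)
    finally show "(\<integral>x. (\<Prod>n<N. \<Prod>i<k n. g (x (n, i))) \<partial>points) = (\<Prod>n<N. (\<integral>x. g x \<partial>block n) ^ k n)"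
      by simp
  qed
  also have "(\<integral>k. (\<Prod>n<N. (\<integral>x. g x \<partial>block n) ^ k n) \<partial>counts) =
      (\<Prod>n<N. \<integral>j. (\<integral>x. g x \<partial>block n) ^ j \<partial>poisson_count (rate n))"
    by (rule integral_PiM_prod) (auto simp: prob_space_measure_pmf integral_poisson_count)
  also have "\<dots> = (\<Prod>n<N. exp (LINT x:S n|m. g x - 1))"
    by (simp add: integral_poisson_count integral_block[OF assms])
  also have "\<dots> = exp (\<Sum>n<N. LINT x:S n|m. g x - 1)"
    by (simp add: exp_sum)
  also have "(\<Sum>n<N. LINT x:S n|m. g x - 1) = (LINT x:(\<Union>n<N. S n)|m. g x - 1)"
    using S_disjoint int
    by (intro set_integral_finite_Union[symmetric])
       (auto simp: disjoint_family_on_def set_integrable_def intro!: integrable_mult_indicator)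
  finally show ?thesis .
qed

lemma partial_integral_tendsto:
  fixes g :: "'b \<Rightarrow> complex"
  assumes int: "integrable m (\<lambda>x. g x - 1)"
  shows "(\<lambda>N. LINT x:(\<Union>n<N. S n)|m. g x - 1) \<longlonglongrightarrow> (\<integral>x. g x - 1 \<partial>m)"
proof -
  have "x \<in> (\<Union>N. \<Union>n<N. S n)" for x
  proof -
    obtain k where "x \<in> S k" using S_cover by blast
    then show ?thesis by (intro UN_I[of "Suc k"] UN_I[of k]) auto
  qed
  then have "(\<Union>N. \<Union>n<N. S n) = UNIV" by blast
  moreover have "(\<lambda>N. LINT x:(\<Union>n<N. S n)|m. g x - 1) \<longlonglongrightarrow> (LINT x:(\<Union>N. \<Union>n<N. S n)|m. g x - 1)"
    using int
    by (intro set_integral_cont_up)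
       (auto simp: incseq_def set_integrable_def intro!: integrable_mult_indicator, force)
  ultimately show ?thesis by (simp add: set_lebesgue_integral_def)
qed

lemma measurable_integral_config[measurable]:
  fixes h :: "'b \<Rightarrow> complex"
  assumes [measurable]: "h \<in> borel_measurable m"
  shows "(\<lambda>\<omega>. \<integral>x. h x \<partial>config \<omega>) \<in> borel_measurable \<Omega>"
proof -
  have "(\<integral>x. h x \<partial>config \<omega>) =
     (if (\<integral>\<^sup>+x. ennreal (norm (h x)) \<partial>config \<omega>) < \<infinity>
      then lim (\<lambda>N. \<Sum>n<N. \<Sum>i<fst \<omega> n. h (snd \<omega> (n, i))) else 0)" for \<omega>
  proof (cases "(\<integral>\<^sup>+x. ennreal (norm (h x)) \<partial>config \<omega>) < \<infinity>")
    case True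
    then have "integrable (config \<omega>) h"
      by (intro integrableI_bounded) (auto cong: measurable_cong_sets)
    then show ?thesis using partial_sum_tendsto[of \<omega> h] True by (simp add: limI)
  next
    case False
    then have "\<not> integrable (config \<omega>) h" by (auto simp: integrable_iff_bounded)
    then show ?thesis using False by (simp add: not_integrable_integral_eq)
  qed
  then show ?thesis by simp
qed

text \<open>
  For the first \<open>N\<close> blocks the formula is the generating function of the Poisson distribution combined
  with independence. The dominating product allows \<open>N \<rightarrow> \<infinity>\<close> even though \<open>exp h\<close> need not be bounded.
\<close>

theorem exponential_formula:
  fixes h :: "'b \<Rightarrow> complex"
  assumes [measurable]: "h \<in> borel_measurable m"
    and int: "integrable m (\<lambda>x. exp (h x) - 1)"
    and intc: "AE \<omega> in \<Omega>. integrable (config \<omega>) h"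
  shows "integrable \<Omega> (\<lambda>\<omega>. exp (\<integral>x. h x \<partial>config \<omega>))"
    and "(\<integral>\<omega>. exp (\<integral>x. h x \<partial>config \<omega>) \<partial>\<Omega>) = exp (\<integral>x. exp (h x) - 1 \<partial>m)"
proof -
  let ?D = "dominator (\<lambda>x. norm (exp (h x) - 1))"
  let ?p = "\<lambda>N \<omega>. \<Prod>n<N. \<Prod>i<fst \<omega> n. exp (h (snd \<omega> (n, i)))"
  have fin: "(\<integral>\<^sup>+x. ennreal (norm (exp (h x) - 1)) \<partial>m) < \<infinity>"
    using int by (simp add: integrable_iff_bounded)
  have AEfin: "AE \<omega> in \<Omega>. ?D \<omega> < \<infinity>"
    by (intro AE_dominator_finite fin) simp
  have w: "integrable \<Omega> (\<lambda>\<omega>. enn2real (?D \<omega>))"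
  proof (rule integrableI_bounded)
    have "(\<integral>\<^sup>+\<omega>. ennreal (norm (enn2real (?D \<omega>))) \<partial>\<Omega>) = (\<integral>\<^sup>+\<omega>. ?D \<omega> \<partial>\<Omega>)"
      using AEfin by (intro nn_integral_cong_AE) (auto elim!: eventually_mono)
    also have "\<dots> < \<infinity>" using fin by (intro nn_integral_dominator) auto
    finally show "(\<integral>\<^sup>+\<omega>. ennreal (norm (enn2real (?D \<omega>))) \<partial>\<Omega>) < \<infinity>" .
  qed measurable
  have lim: "AE \<omega> in \<Omega>. (\<lambda>N. ?p N \<omega>) \<longlonglongrightarrow> exp (\<integral>x. h x \<partial>config \<omega>)"
    using intc
  proof eventually_elim
    case (elim \<omega>)
    have "?p N \<omega> = exp (\<Sum>n<N. \<Sum>i<fst \<omega> n. h (snd \<omega> (n, i)))" for N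
      by (simp add: exp_sum)
    then show ?case using partial_sum_tendsto[OF elim] by (simp add: tendsto_exp)
  qed
  have bound: "AE \<omega> in \<Omega>. norm (?p N \<omega>) \<le> enn2real (?D \<omega>)" for N
    using AEfin
  proof eventually_elim
    case (elim \<omega>)
    then have "ennreal (norm (?p N \<omega>)) \<le> ennreal (enn2real (?D \<omega>))"
      using norm_partial_prod_le_dominator[where N=N and \<omega>=\<omega> and g="\<lambda>x. exp (h x)"] by simp
    then show ?case by (rule ennreal_le_iff[THEN iffD1, rotated]) simp
  qed
  show "integrable \<Omega> (\<lambda>\<omega>. exp (\<integral>x. h x \<partial>config \<omega>))"
    by (rule integrable_dominated_convergence[OF _ _ w lim bound]) measurable
  have "(\<lambda>N. \<integral>\<omega>. ?p N \<omega> \<partial>\<Omega>) \<longlonglongrightarrow> (\<integral>\<omega>. exp (\<integral>x. h x \<partial>config \<omega>) \<partial>\<Omega>)"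
    by (rule integral_dominated_convergence[OF _ _ w lim bound]) measurable
  moreover have "(\<lambda>N. \<integral>\<omega>. ?p N \<omega> \<partial>\<Omega>) \<longlonglongrightarrow> exp (\<integral>x. exp (h x) - 1 \<partial>m)"
    using partial_integral_tendsto[OF int] int
    by (subst integral_partial_prod) (auto intro!: tendsto_exp)
  ultimately show "(\<integral>\<omega>. exp (\<integral>x. h x \<partial>config \<omega>) \<partial>\<Omega>) = exp (\<integral>x. exp (h x) - 1 \<partial>m)"
    by (rule LIMSEQ_unique)
qed

lemma AE_count_zero: "rate n = 0 \<Longrightarrow> AE \<omega> in \<Omega>. fst \<omega> n = 0"
proof -
  assume "rate n = 0"
  then have "AE k in measure_pmf (poisson_count (rate n)). k = 0"
    by (simp add: poisson_count_def AE_measure_pmf_iff)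
  then have "AE k in counts. k n = 0"
    by (intro AE_PiM_component[where P="\<lambda>k. k = 0"]) (auto simp: prob_space_measure_pmf)
  then show ?thesis
    unfolding \<Omega>_def
    by (subst (asm) prob_space.distr_pair_fst[OF prob_space_points, symmetric])
       (auto dest!: AE_distrD[rotated])
qed

lemma AE_points: "AE x in points. Q x \<Longrightarrow> AE \<omega> in \<Omega>. Q (snd \<omega>)"
proof -
  interpret P1: prob_space "counts" by (rule prob_space_counts)
  interpret P2: prob_space "points" by (rule prob_space_points)
  assume "AE x in points. Q x"
  then obtain N where N: "{x \<in> space points. \<not> Q x} \<subseteq> N"
    "N \<in> null_sets points" by (elim AE_E) (auto intro: null_setsI)
  have "space counts \<times> N \<in> null_sets \<Omega>"
    unfolding \<Omega>_def
    by (rule null_setsI, subst P2.emeasure_pair_measure_Times) (use N(2) in \<open>auto simp: null_setsD1\<close>)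
  then show ?thesis
    by (rule AE_I') (use N(1) in \<open>auto simp: \<Omega>_def space_pair_measure\<close>)
qed

lemma AE_active_points:
  assumes "AE x in m. Q x"
  shows "AE \<omega> in \<Omega>. \<forall>p\<in>active \<omega>. Q (snd \<omega> p)"
proof -
  have "AE \<omega> in \<Omega>. p \<in> active \<omega> \<longrightarrow> Q (snd \<omega> p)" for p
  proof (cases "rate (fst p) = 0")
    case True
    from AE_count_zero[OF this] show ?thesis by eventually_elim (simp add: active_def)
  next
    case False
    have "AE x in m. x \<in> S (fst p) \<longrightarrow> Q x" using assms by auto
    then have "AE x in block (fst p). Q x"
      using False S_finite[of "fst p"] unfolding block_def
      by (simp add: AE_uniform_measure emeasure_S)
    then have "AE x in points. Q (x p)"
      by (intro AE_PiM_component prob_space_block) auto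
    from AE_points[OF this] show ?thesis by eventually_elim simp
  qed
  then have "AE \<omega> in \<Omega>. \<forall>p. p \<in> active \<omega> \<longrightarrow> Q (snd \<omega> p)"
    by (simp add: AE_all_countable)
  then show ?thesis by eventually_elim auto
qed

text \<open>
  Two different candidate points are independent, so if \<open>m\<close> does not charge the fibres of \<open>\<pi>\<close> then their
  images under \<open>\<pi>\<close> differ almost surely; there are only countably many pairs.
\<close>

lemma AE_inj_on_active:
  assumes diag: "{z \<in> space (m \<Otimes>\<^sub>M m). \<pi> (fst z) = \<pi> (snd z)} \<in> sets (m \<Otimes>\<^sub>M m)"
    and fibre: "\<And>y. AE z in m. \<pi> z \<noteq> \<pi> y"
  shows "AE \<omega> in \<Omega>. inj_on (\<lambda>p. \<pi> (snd \<omega> p)) (active \<omega>)"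
proof -
  interpret product_prob_space "\<lambda>p::nat\<times>nat. block (fst p)" UNIV
    using prob_space_block by (simp add: product_prob_space_def product_sigma_finite_def
        product_prob_space_axioms_def prob_space_imp_sigma_finite)
  let ?B = "\<lambda>p::nat\<times>nat. block (fst p)"
  have "AE \<omega> in \<Omega>. p \<in> active \<omega> \<longrightarrow> q \<in> active \<omega> \<longrightarrow> p \<noteq> q \<longrightarrow> \<pi> (snd \<omega> p) \<noteq> \<pi> (snd \<omega> q)" for p q
  proof (cases "p = q \<or> rate (fst p) = 0")
    case True
    then show ?thesis
    proof
      assume "rate (fst p) = 0"
      from AE_count_zero[OF this] show ?thesis by eventually_elim (simp add: active_def)
    qed simp
  next
    case False
    then have pq: "p \<notin> {q}" and r: "rate (fst p) \<noteq> 0" by auto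
    have fibre': "AE z in block (fst p). \<pi> z \<noteq> \<pi> y" for y
    proof -
      have "AE x in m. x \<in> S (fst p) \<longrightarrow> \<pi> x \<noteq> \<pi> y" using fibre[of y] by auto
      then show ?thesis
        using r S_finite[of "fst p"] unfolding block_def
        by (simp add: AE_uniform_measure emeasure_S)
    qed
    have pr: "Measurable.pred (m \<Otimes>\<^sub>M m) (\<lambda>z. \<pi> (fst z) = \<pi> (snd z))"
      using diag by (simp add: pred_def)
    have mp: "Measurable.pred (PiM {p, q} ?B) (\<lambda>x. \<pi> (x p) = \<pi> (x q))"
    proof -
      have "(\<lambda>x. x i) \<in> measurable (PiM {p, q} ?B) m" if "i \<in> {p, q}" for i
        using measurable_component_singleton[OF that, of ?B] by (simp cong: measurable_cong_sets)
      then have "(\<lambda>x. (x p, x q)) \<in> measurable (PiM {p, q} ?B) (m \<Otimes>\<^sub>M m)"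
        by (intro measurable_Pair) auto
      from measurable_compose[OF this pr] show ?thesis by simp
    qed
    \<comment> \<open>Integrate over candidate \<open>p\<close> first, with \<open>q\<close> held fixed.\<close>
    have "(\<integral>\<^sup>+x. indicator {x. \<pi> (x p) = \<pi> (x q)} x \<partial>PiM {p, q} ?B) =
      (\<integral>\<^sup>+x. (\<integral>\<^sup>+z. indicator {x. \<pi> (x p) = \<pi> (x q)} (x(p := z)) \<partial>?B p) \<partial>PiM {q} ?B)"
      using mp by (intro product_nn_integral_insert pq) (auto simp: borel_measurable_indicator_iff pred_def Int_def conj_commute)
    also have "\<dots> = (\<integral>\<^sup>+x. 0 \<partial>PiM {q} ?B)"
    proof (intro nn_integral_cong)
      fix x
      have "(\<integral>\<^sup>+z. indicator {x. \<pi> (x p) = \<pi> (x q)} (x(p := z)) \<partial>?B p) = (\<integral>\<^sup>+z. 0 \<partial>?B p)"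
        using fibre'[of "x q"] pq by (intro nn_integral_cong_AE) (auto elim!: eventually_mono simp: indicator_def)
      then show "(\<integral>\<^sup>+z. indicator {x. \<pi> (x p) = \<pi> (x q)} (x(p := z)) \<partial>?B p) = 0" by simp
    qed
    finally have "(\<integral>\<^sup>+x. indicator {x. \<pi> (x p) = \<pi> (x q)} x \<partial>PiM {p, q} ?B) = 0" by simp
    then have "AE x in PiM {p, q} ?B. indicator {x. \<pi> (x p) = \<pi> (x q)} x = (0::ennreal)"
      using mp by (subst (asm) nn_integral_0_iff_AE) (auto simp: borel_measurable_indicator_iff pred_def Int_def conj_commute)
    then have "AE x in PiM {p, q} ?B. \<pi> (x p) \<noteq> \<pi> (x q)"
      by eventually_elim (auto simp: indicator_def split: if_splits)
    then have "AE x in distr (PiM UNIV ?B) (PiM {p, q} ?B) (\<lambda>x. restrict x {p, q}). \<pi> (x p) \<noteq> \<pi> (x q)"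
      by (subst distr_PiM_restrict_finite) simp_all
    from AE_distrD[OF _ this] have "AE x in PiM UNIV ?B. \<pi> (x p) \<noteq> \<pi> (x q)"
      by (simp add: measurable_restrict_subset)
    from AE_points[OF this] show ?thesis by eventually_elim simp
  qed
  then have "AE \<omega> in \<Omega>. \<forall>p q. p \<in> active \<omega> \<longrightarrow> q \<in> active \<omega> \<longrightarrow> p \<noteq> q \<longrightarrow> \<pi> (snd \<omega> p) \<noteq> \<pi> (snd \<omega> q)"
    by (intro AE_all_countable[THEN iffD2] allI)
  then show ?thesis by eventually_elim (auto simp: inj_on_def)
qed

end

section \<open>Compactly supported functions and Radon measures\<close>

lemma cont_compact_supportI:
  fixes f :: "'a::t2_space \<Rightarrow> real"
  assumes "continuous_on UNIV f" "compact K" "\<And>x. x \<notin> K \<Longrightarrow> f x = 0"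
  shows "f \<in> cont_compact_support"
proof -
  have "closure {x. f x \<noteq> 0} \<subseteq> K"
    using assms by (intro closure_minimal compact_imp_closed) auto
  then have "compact (closure {x. f x \<noteq> 0})"
    using assms(2) by (metis closed_Int_compact closed_closure inf.absorb1)
  then show ?thesis using assms(1) by (simp add: cont_compact_support_def)
qed

lemma cont_compact_supportD:
  assumes "f \<in> cont_compact_support"
  obtains K where "compact K" "continuous_on UNIV f" "\<And>x. x \<notin> K \<Longrightarrow> f x = 0"
  using assms closure_subset[of "{x. f x \<noteq> 0}"]
  unfolding cont_compact_support_def by blast

lemma cont_compact_support_measurable:
  "f \<in> cont_compact_support \<Longrightarrow> f \<in> borel_measurable borel"
  by (auto simp: cont_compact_support_def intro: borel_measurable_continuous_onI)

lemma cont_compact_support_bounded: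
  fixes f :: "'a::t2_space \<Rightarrow> real"
  assumes "f \<in> cont_compact_support"
  obtains B where "0 < B" "\<And>x. \<bar>f x\<bar> \<le> B"
proof -
  obtain K where K: "compact K" "continuous_on UNIV f" "\<And>x. x \<notin> K \<Longrightarrow> f x = 0"
    using cont_compact_supportD[OF assms] by blast
  have "compact (f ` K)" using K by (auto intro: compact_continuous_image continuous_on_subset)
  then obtain B where B: "0 < B" "\<And>y. y \<in> f ` K \<Longrightarrow> norm y \<le> B"
    using compact_imp_bounded bounded_pos by metis
  have "\<bar>f x\<bar> \<le> B" for x
    using B K(3)[of x] by (cases "x \<in> K") auto
  with B(1) show thesis by (rule that)
qed

lemma cont_compact_support_linear:
  fixes f g :: "'a::t2_space \<Rightarrow> real"
  assumes "f \<in> cont_compact_support" "g \<in> cont_compact_support"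
  shows "(\<lambda>x. f x + a * g x) \<in> cont_compact_support"
proof -
  obtain K where K: "compact K" "continuous_on UNIV f" "\<And>x. x \<notin> K \<Longrightarrow> f x = 0"
    using cont_compact_supportD[OF assms(1)] by blast
  obtain L where L: "compact L" "continuous_on UNIV g" "\<And>x. x \<notin> L \<Longrightarrow> g x = 0"
    using cont_compact_supportD[OF assms(2)] by blast
  show ?thesis
    by (rule cont_compact_supportI[where K="K \<union> L"]) (use K L in \<open>auto intro!: continuous_intros\<close>)
qed

lemma cont_compact_support_mult:
  fixes f g :: "'a::t2_space \<Rightarrow> real"
  assumes "f \<in> cont_compact_support" "continuous_on UNIV g"
  shows "(\<lambda>x. f x * g x) \<in> cont_compact_support"
proof -
  obtain K where K: "compact K" "continuous_on UNIV f" "\<And>x. x \<notin> K \<Longrightarrow> f x = 0"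
    using cont_compact_supportD[OF assms(1)] by blast
  show ?thesis
    by (rule cont_compact_supportI[where K=K]) (use K assms in \<open>auto intro!: continuous_intros\<close>)
qed

lemma sets_radon: "\<eta> \<in> radon_measures \<Longrightarrow> sets \<eta> = sets borel"
  by (simp add: radon_measures_def)

lemma space_radon: "\<eta> \<in> radon_measures \<Longrightarrow> space \<eta> = UNIV"
  using sets_eq_imp_space_eq[of \<eta> borel] by (simp add: radon_measures_def)

lemma integrable_radon:
  fixes f :: "'a::t2_space \<Rightarrow> real"
  assumes "\<eta> \<in> radon_measures" "f \<in> cont_compact_support"
  shows "integrable \<eta> f"
proof -
  obtain K where K: "compact K" "continuous_on UNIV f" "\<And>x. x \<notin> K \<Longrightarrow> f x = 0"
    using cont_compact_supportD[OF assms(2)] by blast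
  obtain B where B: "0 < B" "\<And>x. \<bar>f x\<bar> \<le> B"
    using cont_compact_support_bounded[OF assms(2)] by blast
  note [measurable_cong] = sets_radon[OF assms(1)]
  have [measurable]: "f \<in> borel_measurable borel" "K \<in> sets borel"
    using cont_compact_support_measurable[OF assms(2)] borel_closed[OF compact_imp_closed[OF K(1)]] by auto
  show ?thesis
  proof (rule integrableI_bounded_set[where A=K and B=B])
    show "emeasure \<eta> K < \<infinity>" using assms(1) K(1) by (simp add: radon_measures_def)
    show "AE x in \<eta>. x \<in> K \<longrightarrow> norm (f x) \<le> B" using B(2) by simp
    show "AE x in \<eta>. x \<notin> K \<longrightarrow> f x = 0" using K(3) by simp
  qed measurable
qed

text \<open>
  Continuous approximations of the indicator of an open set \<open>U\<close> from below. The case \<open>U = UNIV\<close> is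
  separate because the distance to the empty set is \<open>0\<close> by convention.
\<close>

definition cutoff :: "nat \<Rightarrow> 'a::metric_space set \<Rightarrow> 'a \<Rightarrow> real" where
  "cutoff k U x = (if U = UNIV then 1 else min 1 (real k * infdist x (- U)))"

lemma continuous_cutoff: "continuous_on UNIV (cutoff k U)"
  unfolding cutoff_def by (cases "U = UNIV") (auto intro!: continuous_intros)

lemma cutoff_bounds: "0 \<le> cutoff k U x" "cutoff k U x \<le> 1"
  by (auto simp: cutoff_def infdist_nonneg)

lemma cutoff_outside: "x \<notin> U \<Longrightarrow> cutoff k U x = 0"
  by (auto simp: cutoff_def)

lemma cutoff_mono: "k \<le> k' \<Longrightarrow> cutoff k U x \<le> cutoff k' U x"
  using mult_right_mono[of "real k" "real k'" "infdist x (- U)"]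
  by (auto simp: cutoff_def infdist_nonneg)

lemma cutoff_eventually_1:
  assumes "open U" "x \<in> U"
  shows "\<forall>\<^sub>F k in sequentially. cutoff k U x = 1"
proof (cases "U = UNIV")
  case False
  have "infdist x (- U) > 0"
    using False assms by (intro infdist_pos_not_in_closed) auto
  then have "\<forall>\<^sub>F k in sequentially. 1 / infdist x (- U) \<le> real k"
    by (intro eventually_ge_at_top filterlim_compose[OF _ filterlim_real_sequentially, THEN filterlim_at_top[THEN iffD1], rule_format] filterlim_ident)
  then show ?thesis
    by eventually_elim (use \<open>infdist x (- U) > 0\<close> False in \<open>auto simp: cutoff_def field_simps\<close>)
qed (simp add: cutoff_def)

lemma cutoff_compact:
  assumes "open U" "compact C" "C \<subseteq> U"
  shows "\<exists>k. \<forall>x\<in>C. cutoff k U x = 1"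
proof (cases "U = UNIV \<or> C = {}")
  case False
  then obtain c where c: "c \<in> C" "\<And>x. x \<in> C \<Longrightarrow> infdist c (- U) \<le> infdist x (- U)"
    using continuous_attains_inf[OF assms(2), of "\<lambda>x. infdist x (- U)"]
      continuous_on_infdist[OF continuous_on_id, of C "- U"] by metis
  have pos: "infdist c (- U) > 0"
    using False assms c(1) by (intro infdist_pos_not_in_closed) auto
  obtain k :: nat where k: "1 / infdist c (- U) \<le> real k" using real_arch_simple by blast
  have "cutoff k U x = 1" if "x \<in> C" for x
  proof -
    have "1 \<le> real k * infdist c (- U)" using k pos by (simp add: field_simps)
    also have "\<dots> \<le> real k * infdist x (- U)" using c(2)[OF that] by (intro mult_left_mono) auto
    finally show ?thesis using False by (simp add: cutoff_def)
  qed
  then show ?thesis by blast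
qed (auto simp: cutoff_def)

text \<open>
  The sets are the finite unions along an enumeration of the relatively compact basic open sets. They
  increase, so a compact set, being covered by finitely many of them, lies in a single one.
\<close>

lemma compact_exhaustion:
  assumes "locally_compact_space (euclidean :: 'a::polish_space topology)"
  obtains U :: "nat \<Rightarrow> 'a::polish_space set" and \<psi> :: "nat \<Rightarrow> 'a::polish_space \<Rightarrow> real"
  where "\<And>k. open (U k)" "incseq U" "(\<Union>k. U k) = UNIV"
    "\<And>k. compact (closure (U k))"
    "\<And>K. compact K \<Longrightarrow> \<exists>k. K \<subseteq> U k"
    "\<And>k. \<psi> k \<in> cont_compact_support" "\<And>k x. 0 \<le> \<psi> k x" "\<And>k x. \<psi> k x \<le> 1"
    "\<And>k x. x \<in> U k \<Longrightarrow> \<psi> k x = 1"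
proof -
  obtain B :: "'a set set" where B: "countable B" "topological_basis B"
    using ex_countable_basis by blast
  define B' where "B' = {b\<in>B. compact (closure b)}"
  have cover: "\<exists>b\<in>B'. x \<in> b" for x
  proof -
    obtain V K where VK: "open V" "compact K" "x \<in> V" "V \<subseteq> K"
      using assms[unfolded locally_compact_space_def, rule_format, of x] by auto
    obtain b where b: "b \<in> B" "x \<in> b" "b \<subseteq> V"
      using topological_basisE[OF B(2) VK(1,3)] by blast
    have "closure b \<subseteq> K" using b(3) VK by (intro closure_minimal compact_imp_closed) auto
    then have "compact (closure b)" using VK(2) by (metis closed_Int_compact closed_closure inf.absorb1)
    then show ?thesis using b by (auto simp: B'_def)
  qed
  have B': "countable B'" "B' \<noteq> {}" using B(1) cover by (auto simp: B'_def)
  define V where "V = from_nat_into B'"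
  have V: "open (V i)" "compact (closure (V i))" for i
    using from_nat_into[OF B'(2), of i] topological_basis_open[OF B(2)]
    by (auto simp: V_def B'_def)
  have coverV: "(\<Union>i. V i) = UNIV"
    using cover range_from_nat_into[OF B'(2,1)] by (force simp: V_def)
  define U where "U k = (\<Union>i<k. V i)" for k
  have oU: "open (U k)" for k using V by (auto simp: U_def)
  have incU: "incseq U" by (auto simp: incseq_def U_def intro: less_le_trans)
  have cU: "(\<Union>k. U k) = UNIV"
  proof -
    have "x \<in> (\<Union>k. U k)" for x
    proof -
      obtain i where "x \<in> V i" using coverV by blast
      then show ?thesis unfolding U_def by (intro UN_I[of "Suc i"] UN_I[of i]) auto
    qed
    then show ?thesis by blast
  qed
  have clU: "compact (closure (U k))" for k
    unfolding U_def by (induction k) (simp_all add: lessThan_Suc V(2) compact_Un)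
  have cpt: "\<exists>k. K \<subseteq> U k" if cK: "compact K" for K
  proof -
    have sub: "K \<subseteq> (\<Union>k\<in>UNIV. U k)" using cU by simp
    obtain F where F: "F \<subseteq> UNIV" "finite F" "K \<subseteq> (\<Union>k\<in>F. U k)"
      by (rule compactE_image[OF cK oU sub])
    obtain n where n: "\<And>k. k \<in> F \<Longrightarrow> k \<le> n" using finite_nat_set_iff_bounded_le[THEN iffD1, OF F(2)] by blast
    have "(\<Union>k\<in>F. U k) \<subseteq> U n"
      by (intro UN_least incseqD[OF incU] n)
    with F(3) have "K \<subseteq> U n" by (rule order_trans)
    then show ?thesis by blast
  qed
  \<comment> \<open>The compact closure of one set of the exhaustion lies in a later one, where a cutoff separates it from the complement.\<close>
  have "\<exists>k' n. \<forall>x\<in>closure (U k). cutoff n (U k') x = 1" for k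
    using cpt[OF clU[of k]] cutoff_compact[OF oU clU] by blast
  then obtain k' n where kn: "\<And>k x. x \<in> closure (U k) \<Longrightarrow> cutoff (n k) (U (k' k)) x = 1"
    by metis
  define \<psi> where "\<psi> k = cutoff (n k) (U (k' k))" for k
  have \<psi>C: "\<psi> k \<in> cont_compact_support" for k
    unfolding \<psi>_def
    by (rule cont_compact_supportI[OF continuous_cutoff clU[of "k' k"]])
       (use closure_subset in \<open>auto intro: cutoff_outside\<close>)
  have \<psi>1: "\<psi> k x = 1" if "x \<in> U k" for k x
    using kn[of x k] that closure_subset by (auto simp: \<psi>_def)
  show thesis
    by (rule that[OF oU incU cU clU cpt \<psi>C _ _ \<psi>1]) (simp_all add: \<psi>_def cutoff_bounds)
qed

section \<open>The Borel sets of the vague topology\<close>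

text \<open>
  A nonnegative continuous \<open>h\<close> is the supremum of the functions \<open>q * cutoff k V\<close> below it, with rational
  \<open>q\<close> and basic open \<open>V\<close>. Finite maxima of these increase to \<open>h\<close>, and dominated convergence carries
  this over to integrals. A general \<open>f\<close> becomes nonnegative after adding a multiple of a fixed bump
  function from a countable family.
\<close>

lemma countable_lower_approximation:
  assumes lc: "locally_compact_space (euclidean :: 'a::polish_space topology)"
  obtains D :: "('a::polish_space \<Rightarrow> real) set"
  where "countable D" "D \<subseteq> cont_compact_support"
    "\<And>f \<eta> a. f \<in> cont_compact_support \<Longrightarrow> \<eta> \<in> radon_measures \<Longrightarrow> a < (LINT x|\<eta>. f x) \<Longrightarrow>
       \<exists>d\<in>D. (\<forall>x. d x \<le> f x) \<and> a < (LINT x|\<eta>. d x)"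
proof -
  obtain U :: "nat \<Rightarrow> 'a set" and \<psi> where ex: 
    "\<And>K. compact K \<Longrightarrow> \<exists>k. K \<subseteq> U k"
    "\<And>k. \<psi> k \<in> cont_compact_support" "\<And>k x. 0 \<le> \<psi> k x"
    "\<And>k x. x \<in> U k \<Longrightarrow> \<psi> k x = 1"
    using compact_exhaustion[OF lc] by metis
  obtain B :: "'a set set" where B: "countable B" "topological_basis B"
    using ex_countable_basis by blast
  define E where "E = {q :: rat. 0 \<le> q} \<times> (UNIV :: nat set) \<times> insert UNIV B"
  define bump where "bump = (\<lambda>(q, k, V) x. real_of_rat q * cutoff k V (x :: 'a))"
  define mx where "mx F x = Max ((\<lambda>e. bump e x) ` F)" for F x
  define D where "D = (\<lambda>(F, N, k) x. mx F x - real N * \<psi> k x) ` ({F. finite F \<and> F \<subseteq> E} \<times> (UNIV :: nat set) \<times> (UNIV :: nat set)) \<inter> cont_compact_support"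
  have cE: "countable E" unfolding E_def using B(1) by (intro countable_SIGMA) auto
  have cD: "countable D"
    unfolding D_def
    by (intro countable_Int1 countable_image countable_SIGMA countable_Collect_finite_subset cE) auto
  have cont_mx: "continuous_on UNIV (mx F)" if "finite F" "F \<noteq> {}" for F
    using that
  proof (induction F rule: finite_ne_induct)
    case (singleton e)
    have "mx {e} = bump e" by (auto simp: mx_def)
    then show ?case unfolding bump_def by (cases e) (auto intro!: continuous_intros continuous_cutoff)
  next
    case (insert e F)
    have "mx (insert e F) = (\<lambda>x. max (bump e x) (mx F x))"
      using insert.hyps by (intro ext) (simp add: mx_def)
    moreover have "continuous_on UNIV (bump e)"
      unfolding bump_def by (cases e) (auto intro!: continuous_intros continuous_cutoff)
    ultimately show ?case using insert.IH by (auto intro!: continuous_intros)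
  qed
  have approx: "\<exists>d\<in>D. (\<forall>x. d x \<le> f x) \<and> a < (LINT x|\<eta>. d x)"
    if f: "f \<in> cont_compact_support" and \<eta>: "\<eta> \<in> radon_measures" and a: "a < (LINT x|\<eta>. f x)"
    for f \<eta> a
  proof -
    obtain K where K: "compact K" "continuous_on UNIV f" "\<And>x. x \<notin> K \<Longrightarrow> f x = 0"
      using cont_compact_supportD[OF f] by blast
    obtain b where b: "0 < b" "\<And>x. \<bar>f x\<bar> \<le> b" using cont_compact_support_bounded[OF f] by blast
    obtain N :: nat where N: "b \<le> real N" using real_arch_simple by blast
    obtain k where k: "K \<subseteq> U k" using ex(1)[OF K(1)] by blast
    \<comment> \<open>The bump equals \<open>1\<close> on the support of \<open>f\<close> and \<open>N\<close> exceeds the bound of \<open>f\<close>, so \<open>h\<close> is nonnegative.\<close>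
    define h where "h x = f x + real N * \<psi> k x" for x
    have h: "h \<in> cont_compact_support"
      unfolding h_def by (rule cont_compact_support_linear[OF f ex(2)])
    have h0: "0 \<le> h x" for x
    proof (cases "x \<in> K")
      case True
      then show ?thesis using k ex(4)[of x k] b(2)[of x] N by (auto simp: h_def abs_le_iff)
    qed (use K(3)[of x] ex(3)[of k x] in \<open>auto simp: h_def\<close>)
    obtain L where L: "compact L" "continuous_on UNIV h" "\<And>x. x \<notin> L \<Longrightarrow> h x = 0"
      using cont_compact_supportD[OF h] by blast
    define Eh where "Eh = {e\<in>E. \<forall>x. bump e x \<le> h x}"
    \<comment> \<open>The zero function keeps the maxima nonnegative, hence supported in the support of \<open>h\<close>.\<close>
    have e0: "(0, 0, UNIV) \<in> Eh" using h0 by (auto simp: Eh_def E_def bump_def)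
    have cEh: "countable Eh" using cE by (rule countable_subset[rotated]) (auto simp: Eh_def)
    define F where "F n = insert (0, 0, UNIV) (from_nat_into Eh ` {..n})" for n
    have F: "finite (F n)" "F n \<subseteq> Eh" "F n \<noteq> {}" for n
      using e0 from_nat_into[of Eh, OF ex_in_conv[THEN iffD1, OF exI, OF e0]]
      by (simp_all add: F_def image_subset_iff)
    have mxle: "mx (F n) x \<le> h x" for n x
      using F[of n] by (auto simp: mx_def Eh_def)
    have mx0: "0 \<le> mx (F n) x" for n x
      unfolding mx_def by (rule Max_ge_iff[THEN iffD2]) (auto simp: F_def bump_def)
    have lim: "(\<lambda>n. mx (F n) x) \<longlonglongrightarrow> h x" for x
    proof (rule order_tendstoI)
      fix u assume "h x < u"
      then show "\<forall>\<^sub>F n in sequentially. mx (F n) x < u" using mxle by (intro always_eventually allI) (rule le_less_trans)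
    next
      fix u assume u: "u < h x"
      show "\<forall>\<^sub>F n in sequentially. u < mx (F n) x"
      proof (cases "u < 0")
        case True
        then show ?thesis using mx0 by (intro always_eventually allI) (rule less_le_trans)
      next
        case False
        obtain q where q: "u < real_of_rat q" "real_of_rat q < h x" using of_rat_dense[OF u] by blast
        let ?V = "{y. real_of_rat q < h y}"
        have "open ?V" using L(2) by (intro open_Collect_less continuous_intros)
        then obtain V where V: "V \<in> B" "x \<in> V" "V \<subseteq> ?V"
          using topological_basisE[OF B(2), of ?V x] q(2) by auto
        have "open V" using V(1) B(2) by (auto intro: topological_basis_open)
        from eventually_happens[OF cutoff_eventually_1[OF this V(2)]]
        obtain k where k: "cutoff k V x = 1" by auto
        have q0: "0 \<le> real_of_rat q" using q False by linarith
        let ?e = "(q, k, V)"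
        have "bump ?e y \<le> h y" for y
        proof (cases "y \<in> V")
          case True
          have "bump ?e y \<le> real_of_rat q * 1"
            unfolding bump_def using q0 cutoff_bounds by (auto intro!: mult_left_mono simp del: mult_1_right)
          then show ?thesis using True V(3) by auto
        qed (auto simp: bump_def cutoff_outside h0)
        then have "?e \<in> Eh" using V(1) q0 by (auto simp: Eh_def E_def)
        then obtain n0 where n0: "from_nat_into Eh n0 = ?e"
          using cEh from_nat_into_surj by metis
        have "u < mx (F n) x" if "n0 \<le> n" for n
        proof -
          have "?e \<in> F n" using that n0 by (force simp: F_def)
          then have "bump ?e x \<le> mx (F n) x" unfolding mx_def using F(1) by (intro Max_ge) auto
          then show ?thesis using q(1) k by (simp add: bump_def)
        qed
        then show ?thesis by (auto simp: eventually_sequentially)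
      qed
    qed
    have mxC: "mx (F n) \<in> cont_compact_support" for n
      by (rule cont_compact_supportI[OF cont_mx[OF F(1,3)] L(1)]) (metis L(3) mxle mx0 antisym)
    note [measurable_cong] = sets_radon[OF \<eta>]
    have "(\<lambda>n. LINT x|\<eta>. mx (F n) x) \<longlonglongrightarrow> (LINT x|\<eta>. h x)"
      using mxC[THEN cont_compact_support_measurable] h[THEN cont_compact_support_measurable]
      by (intro integral_dominated_convergence[where w=h] integrable_radon[OF \<eta> h])
         (auto simp: lim mxle mx0 cong: measurable_cong_sets)
    moreover have "a + (LINT x|\<eta>. real N * \<psi> k x) < (LINT x|\<eta>. h x)"
      using a integrable_radon[OF \<eta> f] integrable_radon[OF \<eta> ex(2)] by (simp add: h_def)
    ultimately have "\<forall>\<^sub>F n in sequentially. a + (LINT x|\<eta>. real N * \<psi> k x) < (LINT x|\<eta>. mx (F n) x)"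
      by (rule order_tendstoD)
    from eventually_happens[OF this] obtain n where
      n: "a + (LINT x|\<eta>. real N * \<psi> k x) < (LINT x|\<eta>. mx (F n) x)" by auto
    let ?d = "\<lambda>x. mx (F n) x - real N * \<psi> k x"
    have "?d \<in> cont_compact_support"
      using cont_compact_support_linear[OF mxC[of n] ex(2)[of k], of "- real N"] by simp
    then have "?d \<in> D" unfolding D_def using F(1,2)[of n]
      by (intro IntI image_eqI[where x="(F n, N, k)"]) (auto simp: Eh_def)
    moreover have "?d x \<le> f x" for x using mxle[of n x] by (simp add: h_def)
    moreover have "a < (LINT x|\<eta>. ?d x)"
      using n integrable_radon[OF \<eta> mxC] integrable_radon[OF \<eta> ex(2)] by simp
    ultimately show ?thesis by (intro bexI[of _ ?d] conjI allI)
  qed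
  show thesis by (rule that[OF cD _ approx]) (auto simp: D_def)
qed

text \<open>
  With a countable subbase every open set is a countable union of finite intersections of subbasic sets.
\<close>

lemma openin_generated_by_countable:
  assumes S: "countable S" and T: "openin (topology_generated_by S) T"
  shows "T \<in> sigma_sets (\<Union>S) S"
proof -
  have *: "\<forall>x\<in>T. \<exists>F. finite F \<and> F \<noteq> {} \<and> F \<subseteq> S \<and> x \<in> \<Inter>F \<and> \<Inter>F \<subseteq> T"
    using openin_topology_generated_by[OF T]
  proof (induction rule: generate_topology_on.induct)
    case (Int a b)
    show ?case
    proof
      fix x assume "x \<in> a \<inter> b"
      then obtain F where F: "finite F" "F \<noteq> {}" "F \<subseteq> S" "x \<in> \<Inter>F" "\<Inter>F \<subseteq> a"
        using bspec[OF Int.IH(1), of x] by blast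
      obtain G where G: "finite G" "G \<noteq> {}" "G \<subseteq> S" "x \<in> \<Inter>G" "\<Inter>G \<subseteq> b"
        using bspec[OF Int.IH(2), of x] \<open>x \<in> a \<inter> b\<close> by blast
      from F G show "\<exists>F. finite F \<and> F \<noteq> {} \<and> F \<subseteq> S \<and> x \<in> \<Inter>F \<and> \<Inter>F \<subseteq> a \<inter> b"
        by (intro exI[of _ "F \<union> G"]) auto
    qed
  next
    case (UN K)
    show ?case
    proof
      fix x assume "x \<in> \<Union>K"
      then obtain k where k: "k \<in> K" "x \<in> k" by blast
      then obtain F where "finite F" "F \<noteq> {}" "F \<subseteq> S" "x \<in> \<Inter>F" "\<Inter>F \<subseteq> k"
        using bspec[OF UN.IH[OF k(1)] k(2)] by blast
      then show "\<exists>F. finite F \<and> F \<noteq> {} \<and> F \<subseteq> S \<and> x \<in> \<Inter>F \<and> \<Inter>F \<subseteq> \<Union>K"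
        using k(1) by (intro exI[of _ F]) auto
    qed
  next
    case (Basis s)
    then show ?case by (auto intro!: exI[of _ "{s}"])
  qed simp
  define \<B> where "\<B> = {F. (finite F \<and> F \<subseteq> S) \<and> F \<noteq> {} \<and> \<Inter>F \<subseteq> T}"
  have "countable {F. finite F \<and> F \<subseteq> S}" using S by (rule countable_Collect_finite_subset)
  then have c: "countable \<B>" by (rule countable_subset[rotated]) (auto simp: \<B>_def)
  interpret sigma_algebra "\<Union>S" "sigma_sets (\<Union>S) S"
    by (rule sigma_algebra_sigma_sets) auto
  have "\<Inter>F \<in> sigma_sets (\<Union>S) S" if "F \<in> \<B>" for F
  proof -
    have "finite F" "F \<noteq> {}" "F \<subseteq> sigma_sets (\<Union>S) S" using that by (auto simp: \<B>_def)
    then show ?thesis using finite_INT[of F "\<lambda>x. x"] by auto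
  qed
  then have "(\<Union>F\<in>\<B>. \<Inter>F) \<in> sigma_sets (\<Union>S) S" using c by (intro countable_UN'') auto
  also have "(\<Union>F\<in>\<B>. \<Inter>F) = T"
  proof
    show "(\<Union>F\<in>\<B>. \<Inter>F) \<subseteq> T" by (auto simp: \<B>_def)
    show "T \<subseteq> (\<Union>F\<in>\<B>. \<Inter>F)"
    proof
      fix x assume "x \<in> T"
      from bspec[OF * this] obtain F where "finite F" "F \<noteq> {}" "F \<subseteq> S" "x \<in> \<Inter>F" "\<Inter>F \<subseteq> T"
        by blast
      then show "x \<in> (\<Union>F\<in>\<B>. \<Inter>F)" by (intro UN_I[of F]) (simp_all add: \<B>_def)
    qed
  qed
  finally show ?thesis .
qed

lemma openin_vague_integral_vimage:
  assumes "f \<in> cont_compact_support" "open U"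
  shows "openin vague_topology {\<eta> \<in> radon_measures. (LINT x|\<eta>. f x) \<in> U}"
  unfolding vague_topology_def using assms by (intro topology_generated_by_Basis) blast

text \<open>
  The vague topology is defined by uncountably many functions, so an open set is a priori an
  uncountable union of basic sets. One-sided approximation supplies a countable subbase: \<open>\<integral> f d\<eta> > a\<close> holds
  if and only if \<open>\<integral> d d\<eta> > a\<close> for some \<open>d \<le> f\<close> from the countable family.
\<close>

lemma vague_open_in_sigma_halfspaces:
  fixes T :: "'a::polish_space measure set"
  assumes lc: "locally_compact_space (euclidean :: 'a topology)" and T: "openin vague_topology T"
  shows "T \<in> sigma_sets radon_measures
      {{\<eta> \<in> radon_measures. real_of_rat q < (LINT x|\<eta>. f x)} | f q. f \<in> cont_compact_support}"
    (is "_ \<in> sigma_sets _ ?G")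
proof -
  obtain D :: "('a \<Rightarrow> real) set" where D: "countable D" "D \<subseteq> cont_compact_support"
    "\<And>f \<eta> a. f \<in> cont_compact_support \<Longrightarrow> \<eta> \<in> radon_measures \<Longrightarrow> a < (LINT x|\<eta>. f x) \<Longrightarrow>
       \<exists>d\<in>D. (\<forall>x. d x \<le> f x) \<and> a < (LINT x|\<eta>. d x)"
    using countable_lower_approximation[OF lc] by metis
  define H where "H f a = {\<eta> \<in> radon_measures. a < (LINT x|\<eta>. f x)}" for f :: "'a \<Rightarrow> real" and a :: real
  define S where "S = insert radon_measures ((\<lambda>(d, q). H d (real_of_rat q)) ` (D \<times> UNIV))"
  have cS: "countable S" unfolding S_def using D(1) by (intro countable_insert countable_image countable_SIGMA) auto
  have US: "\<Union>S = radon_measures" by (auto simp: S_def H_def)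
  let ?\<tau> = "topology_generated_by S"
  have Sopen: "openin ?\<tau> s" if "s \<in> S" for s using that by (rule topology_generated_by_Basis)
  have Hopen: "openin ?\<tau> (H f a)" if f: "f \<in> cont_compact_support" for f a
  proof (subst openin_subopen, intro ballI)
    fix \<eta> assume "\<eta> \<in> H f a"
    then have \<eta>: "\<eta> \<in> radon_measures" "a < (LINT x|\<eta>. f x)" by (auto simp: H_def)
    obtain d where d: "d \<in> D" "\<And>x. d x \<le> f x" "a < (LINT x|\<eta>. d x)" using D(3)[OF f \<eta>] by blast
    obtain q where q: "a < real_of_rat q" "real_of_rat q < (LINT x|\<eta>. d x)" using of_rat_dense[OF d(3)] by blast
    have "H d (real_of_rat q) \<subseteq> H f a"
    proof
      fix \<xi> assume x: "\<xi> \<in> H d (real_of_rat q)"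
      then have \<xi>: "\<xi> \<in> radon_measures" by (simp add: H_def)
      have "(LINT x|\<xi>. d x) \<le> (LINT x|\<xi>. f x)"
        using \<xi> d(1,2) D(2) f by (intro integral_mono integrable_radon) auto
      then show "\<xi> \<in> H f a" using x q(1) by (auto simp: H_def)
    qed
    moreover have "openin ?\<tau> (H d (real_of_rat q))"
      by (rule Sopen) (use d(1) in \<open>auto simp: S_def\<close>)
    moreover have "\<eta> \<in> H d (real_of_rat q)" using \<eta>(1) q(2) by (simp add: H_def)
    ultimately show "\<exists>T. openin ?\<tau> T \<and> \<eta> \<in> T \<and> T \<subseteq> H f a" by blast
  qed
  have sub: "openin ?\<tau> s" if s: "s \<in> {{\<eta> \<in> radon_measures. (LINT x|\<eta>. f x) \<in> U} | f U.
        f \<in> cont_compact_support \<and> open (U :: real set)}" for s :: "'a measure set"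
  proof (subst openin_subopen, intro ballI)
    fix \<eta> assume \<eta>: "\<eta> \<in> s"
    obtain f and U :: "real set" where f: "s = {\<eta> \<in> radon_measures. (LINT x|\<eta>. f x) \<in> U}" "f \<in> cont_compact_support" "open U"
      using s by blast
    then have \<eta>': "\<eta> \<in> radon_measures" "(LINT x|\<eta>. f x) \<in> U" using \<eta> by auto
    obtain e where e: "0 < e" "ball (LINT x|\<eta>. f x) e \<subseteq> U" using f(3) \<eta>'(2) openE by blast
    let ?y = "LINT x|\<eta>. f x"
    have mf: "(\<lambda>x. - f x) \<in> cont_compact_support"
      using cont_compact_support_linear[OF f(2) f(2), of "-2"] by simp
    have "H f (?y - e) \<inter> H (\<lambda>x. - f x) (- (?y + e)) \<subseteq> s"
      using e(2) by (auto simp: f(1) H_def subset_iff dist_real_def abs_less_iff)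
    moreover have "\<eta> \<in> H f (?y - e) \<inter> H (\<lambda>x. - f x) (- (?y + e))"
      using e(1) \<eta>' by (auto simp: H_def)
    moreover have "openin ?\<tau> (H f (?y - e) \<inter> H (\<lambda>x. - f x) (- (?y + e)))"
      using Hopen[OF f(2)] Hopen[OF mf] by (intro openin_Int)
    ultimately show "\<exists>T. openin ?\<tau> T \<and> \<eta> \<in> T \<and> T \<subseteq> s" by blast
  qed
  have "openin ?\<tau> T"
    by (rule generate_topology_on_coarsest[OF _ _ openin_topology_generated_by[OF T[unfolded vague_topology_def]]])
       (use sub in \<open>auto simp: istopology_openin\<close>)
  from openin_generated_by_countable[OF cS this] have "T \<in> sigma_sets radon_measures S" by (simp add: US)
  also have "sigma_sets radon_measures S \<subseteq> sigma_sets radon_measures ?G"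
  proof (rule sigma_sets_mono)
    have "H d (real_of_rat q) \<in> ?G" if "d \<in> D" for d q
      using that D(2) unfolding H_def by blast
    then show "S \<subseteq> sigma_sets radon_measures ?G"
      unfolding S_def by (auto intro!: sigma_sets_top intro: sigma_sets.Basic)
  qed
  finally show ?thesis .
qed

lemma integral_measurable_vague:
  assumes "f \<in> cont_compact_support"
  shows "(\<lambda>\<eta>. LINT x|\<eta>. f x) \<in> borel_measurable vague_borel"
proof (rule borel_measurableI)
  fix U :: "real set" assume U: "open U"
  have "{U. openin vague_topology U} \<subseteq> Pow (radon_measures :: 'a measure set)"
    using openin_subset topspace_vague_topology by blast
  then have sp: "space vague_borel = (radon_measures :: 'a measure set)"
    and st: "sets vague_borel = sigma_sets (radon_measures :: 'a measure set) {U. openin vague_topology U}"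
    by (simp_all add: vague_borel_def)
  have "(\<lambda>\<eta>. LINT x|\<eta>. f x) -` U \<inter> radon_measures = {\<eta> \<in> radon_measures. (LINT x|\<eta>. f x) \<in> U}"
    by auto
  then show "(\<lambda>\<eta>. LINT x|\<eta>. f x) -` U \<inter> space vague_borel \<in> sets vague_borel"
    unfolding sp st using openin_vague_integral_vimage[OF assms U]
    by (auto intro: sigma_sets.Basic)
qed

lemma integral_measurable_discrete[measurable]:
  assumes "f \<in> cont_compact_support"
  shows "(\<lambda>\<eta>. LINT x|\<eta>. f x) \<in> borel_measurable discrete_radon_space"
  unfolding discrete_radon_space_def
  by (intro measurable_restrict_space1 integral_measurable_vague assms)

lemma sets_discrete_radon_space:
  assumes lc: "locally_compact_space (euclidean :: 'a::polish_space topology)"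
  shows "sets (discrete_radon_space :: 'a measure measure) =
    sigma_sets discrete_radon_measures
      {(\<lambda>\<eta>. LINT x|\<eta>. f x) -` B \<inter> discrete_radon_measures | f B. f \<in> cont_compact_support \<and> B \<in> sets borel}"
    (is "_ = sigma_sets ?K ?G")
proof
  have sp: "space discrete_radon_space = ?K" by (rule space_discrete_radon_space)
  show "sigma_sets ?K ?G \<subseteq> sets discrete_radon_space"
    unfolding sp[symmetric]
  proof (rule sets.sigma_sets_subset, safe)
    fix f :: "'a \<Rightarrow> real" and B :: "real set" assume "f \<in> cont_compact_support" "B \<in> sets borel"
    then show "(\<lambda>\<eta>. LINT x|\<eta>. f x) -` B \<inter> space discrete_radon_space \<in> sets discrete_radon_space"
      by (intro measurable_sets[OF integral_measurable_discrete])
  qed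
  let ?D = "{{\<eta> \<in> radon_measures. real_of_rat q < (LINT x|\<eta>. f x)} | f q. f \<in> (cont_compact_support :: ('a \<Rightarrow> real) set)}"
  have KR: "?K \<subseteq> radon_measures" by (auto simp: discrete_radon_measures_def)
  have spG: "space (sigma ?K ?G) = ?K" and stG: "sets (sigma ?K ?G) = sigma_sets ?K ?G"
    by (auto simp: sets_measure_of_conv space_measure_of_conv)
  have "(\<lambda>\<eta>. \<eta>) \<in> measurable (sigma ?K ?G) (sigma radon_measures ?D)"
  proof (rule measurable_measure_of)
    show "?D \<subseteq> Pow radon_measures" by auto
    show "(\<lambda>\<eta>. \<eta>) \<in> space (sigma ?K ?G) \<rightarrow> radon_measures" using KR by (auto simp: spG)
    fix A assume "A \<in> ?D"
    then obtain d q where d: "d \<in> cont_compact_support" "A = {\<eta> \<in> radon_measures. real_of_rat q < (LINT x|\<eta>. d x)}" by blast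
    have "A \<inter> ?K = (\<lambda>\<eta>. LINT x|\<eta>. d x) -` {real_of_rat q<..} \<inter> ?K" using KR d(2) by auto
    moreover have "\<dots> \<in> ?G" using d(1)
      by (intro CollectI exI[of _ d] exI[of _ "{real_of_rat q<..}"] conjI refl borel_open open_greaterThan)
    ultimately show "(\<lambda>\<eta>. \<eta>) -` A \<inter> space (sigma ?K ?G) \<in> sets (sigma ?K ?G)"
      by (simp add: spG stG sigma_sets.Basic)
  qed
  then have "(\<lambda>\<eta>. \<eta>) \<in> measurable (sigma ?K ?G) vague_borel"
  proof -
    assume id: "(\<lambda>\<eta>. \<eta>) \<in> measurable (sigma ?K ?G) (sigma radon_measures ?D)"
    show ?thesis
      unfolding vague_borel_def
    proof (rule measurable_measure_of)
      show "{U. openin vague_topology U} \<subseteq> Pow (radon_measures :: 'a measure set)"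
        using openin_subset topspace_vague_topology by blast
      show "(\<lambda>\<eta>. \<eta>) \<in> space (sigma ?K ?G) \<rightarrow> radon_measures" using KR by (auto simp: spG)
      fix T :: "'a measure set" assume "T \<in> {U. openin vague_topology U}"
      then have "T \<in> sigma_sets radon_measures ?D" by (intro vague_open_in_sigma_halfspaces[OF lc]) simp
      moreover have "?D \<subseteq> Pow radon_measures" by auto
      ultimately have "T \<in> sets (sigma radon_measures ?D)" by (simp add: sets_measure_of)
      from measurable_sets[OF id this]
      show "(\<lambda>\<eta>. \<eta>) -` T \<inter> space (sigma ?K ?G) \<in> sets (sigma ?K ?G)" .
    qed
  qed
  then have "A \<inter> ?K \<in> sigma_sets ?K ?G" if "A \<in> sets vague_borel" for A
    using measurable_sets[OF _ that, of "\<lambda>\<eta>. \<eta>" "sigma ?K ?G"] by (simp add: spG stG)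
  then show "sets discrete_radon_space \<subseteq> sigma_sets ?K ?G"
    unfolding discrete_radon_space_def sets_restrict_space by (auto simp: Int_commute)
qed

text \<open>
  The uniqueness theorem applied to the linear functionals of a discrete Radon measure.
\<close>

lemma discrete_law_eqI:
  fixes \<mu> \<nu> :: "'a::polish_space measure measure"
  assumes lc: "locally_compact_space (euclidean :: 'a topology)"
    and "prob_space \<mu>" "prob_space \<nu>"
    and "sets \<mu> = sets discrete_radon_space" "sets \<nu> = sets discrete_radon_space"
    and eq: "\<And>f. f \<in> cont_compact_support \<Longrightarrow>
      (CLINT \<eta>|\<mu>. iexp (LINT x|\<eta>. f x)) = (CLINT \<eta>|\<nu>. iexp (LINT x|\<eta>. f x))"
  shows "\<mu> = \<nu>"
proof (rule prob_measure_eq_if_char_agree[where I=cont_compact_support and e="\<lambda>f \<eta>. LINT x|\<eta>. f x"])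
  have sp: "space \<mu> = discrete_radon_measures"
    using sets_eq_imp_space_eq[OF assms(4)] by (simp add: space_discrete_radon_space)
  show "sets \<mu> = sigma_sets (space \<mu>) {(\<lambda>\<eta>. LINT x|\<eta>. i x) -` B \<inter> space \<mu> | i B. i \<in> cont_compact_support \<and> B \<in> sets borel}"
    unfolding sp assms(4) by (rule sets_discrete_radon_space[OF lc])
  show "\<exists>k\<in>cont_compact_support. \<forall>\<eta>\<in>space \<mu>. (LINT x|\<eta>. k x) = (LINT x|\<eta>. i x) + a * (LINT x|\<eta>. j x)"
    if "i \<in> cont_compact_support" "j \<in> cont_compact_support" for i j a
  proof (rule bexI[of _ "\<lambda>x. i x + a * j x"], rule ballI)
    fix \<eta> assume "\<eta> \<in> space \<mu>"
    then have "\<eta> \<in> radon_measures" by (simp add: sp discrete_radon_measures_def)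
    then show "(LINT x|\<eta>. i x + a * j x) = (LINT x|\<eta>. i x) + a * (LINT x|\<eta>. j x)"
      using that by (simp add: integrable_radon)
  qed (rule cont_compact_support_linear[OF that])
  show "\<exists>k\<in>cont_compact_support. \<forall>\<eta>\<in>space \<mu>. (LINT x|\<eta>. k x) = 0"
    by (rule bexI[of _ "\<lambda>x. 0"]) (simp_all add: cont_compact_support_def)
qed (use assms in simp_all)

lemma measurable_into_discrete_radon_space:
  fixes f :: "'b \<Rightarrow> 'a::polish_space measure"
  assumes lc: "locally_compact_space (euclidean :: 'a topology)"
    and f: "\<And>\<omega>. \<omega> \<in> space M \<Longrightarrow> f \<omega> \<in> discrete_radon_measures"
    and meas: "\<And>g. g \<in> cont_compact_support \<Longrightarrow> (\<lambda>\<omega>. LINT x|f \<omega>. g x) \<in> borel_measurable M"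
  shows "f \<in> measurable M discrete_radon_space"
proof (rule measurable_sigma_sets[OF sets_discrete_radon_space[OF lc]])
  show "f \<in> space M \<rightarrow> discrete_radon_measures" using f by auto
  fix A :: "'a measure set"
  assume "A \<in> {(\<lambda>\<eta>. LINT x|\<eta>. f x) -` B \<inter> discrete_radon_measures | f B. f \<in> cont_compact_support \<and> B \<in> sets borel}"
  then obtain g B where A: "A = (\<lambda>\<eta>. LINT x|\<eta>. g x) -` B \<inter> discrete_radon_measures"
    "g \<in> cont_compact_support" "B \<in> sets borel" by blast
  have "f -` A \<inter> space M = (\<lambda>\<omega>. LINT x|f \<omega>. g x) -` B \<inter> space M" using f by (auto simp: A(1))
  then show "f -` A \<inter> space M \<in> sets M" using measurable_sets[OF meas[OF A(2)] A(3)] by simp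
qed auto

section \<open>Measurable dependence of integrals on the measure\<close>

lemma nn_integral_eq_integral_radon:
  fixes f :: "'a::t2_space \<Rightarrow> real"
  assumes "\<eta> \<in> radon_measures" "f \<in> cont_compact_support" "\<And>x. 0 \<le> f x"
  shows "(\<integral>\<^sup>+x. ennreal (f x) \<partial>\<eta>) = ennreal (LINT x|\<eta>. f x)"
  using assms integrable_radon[OF assms(1,2)] by (intro nn_integral_eq_integral) auto

lemma cutoff_SUP:
  assumes "open A"
  shows "(SUP n. ennreal (c * cutoff n A x)) = ennreal c * indicator A x"
proof (cases "x \<in> A")
  case True
  show ?thesis
  proof (rule antisym)
    show "(SUP n. ennreal (c * cutoff n A x)) \<le> ennreal c * indicator A x"
    proof (rule SUP_least)
      fix n
      show "ennreal (c * cutoff n A x) \<le> ennreal c * indicator A x"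
      proof (cases "0 \<le> c")
        case True
        then show ?thesis using \<open>x \<in> A\<close> cutoff_bounds[of n A x] by (simp add: ennreal_leI mult_left_le)
      next
        case False
        then have "c * cutoff n A x \<le> 0" using cutoff_bounds[of n A x] by (simp add: mult_nonpos_nonneg)
        then show ?thesis by (simp add: ennreal_neg)
      qed
    qed
    obtain n where "cutoff n A x = 1"
      using eventually_happens[OF cutoff_eventually_1[OF assms True]] by auto
    then show "ennreal c * indicator A x \<le> (SUP n. ennreal (c * cutoff n A x))"
      using True by (intro SUP_upper2[of n]) auto
  qed
qed (simp add: cutoff_outside)

lemma borel_measurable_cutoff[measurable]: "cutoff n A \<in> borel_measurable borel"
  by (intro borel_measurable_continuous_onI continuous_cutoff)

text \<open>
  The measure \<open>\<kappa> \<omega>\<close> may be infinite, so it is first reduced to subprobability kernels.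
  Multiplying \<open>\<kappa> \<omega>\<close> by \<open>\<psi>\<^sub>k / (1 + \<integral> \<psi>\<^sub>k d\<kappa> \<omega>)\<close> produces a subprobability kernel. Its values on open sets
  are limits of integrals of compactly supported functions, hence measurable. Integrals over
  \<open>U\<^sub>k\<close>, where \<open>\<psi>\<^sub>k = 1\<close>, are recovered by multiplying back, and \<open>k \<rightarrow> \<infinity>\<close> gives the claim.
\<close>

lemma measurable_nn_integral_discrete_radon:
  fixes \<kappa> :: "'b \<Rightarrow> 'a::polish_space measure" and F :: "'b \<Rightarrow> 'a \<Rightarrow> ennreal"
  assumes lc: "locally_compact_space (euclidean :: 'a topology)"
    and \<kappa>[measurable]: "\<kappa> \<in> measurable N discrete_radon_space"
    and F[measurable]: "(\<lambda>(\<omega>, x). F \<omega> x) \<in> borel_measurable (N \<Otimes>\<^sub>M borel)"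
  shows "(\<lambda>\<omega>. \<integral>\<^sup>+x. F \<omega> x \<partial>\<kappa> \<omega>) \<in> borel_measurable N"
proof -
  obtain U :: "nat \<Rightarrow> 'a set" and \<psi> where ex: "\<And>k. open (U k)" "incseq U" "(\<Union>k. U k) = UNIV"
    "\<And>k. \<psi> k \<in> cont_compact_support" "\<And>k x. 0 \<le> \<psi> k x" "\<And>k x. x \<in> U k \<Longrightarrow> \<psi> k x = 1"
    using compact_exhaustion[OF lc] by metis
  have K: "\<kappa> \<omega> \<in> radon_measures" if "\<omega> \<in> space N" for \<omega>
    using measurable_space[OF \<kappa> that]
    by (auto simp: space_discrete_radon_space discrete_radon_measures_def)
  have mI[measurable]: "(\<lambda>\<omega>. LINT x|\<kappa> \<omega>. g x) \<in> borel_measurable N" if "g \<in> cont_compact_support" for g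
    using measurable_compose[OF \<kappa> integral_measurable_discrete[OF that]] by simp
  define I where "I k \<omega> = (LINT x|\<kappa> \<omega>. \<psi> k x)" for k \<omega>
  have [measurable]: "I k \<in> borel_measurable N" for k
    unfolding I_def by (intro mI ex)
  have I0: "0 \<le> I k \<omega>" for k \<omega>
    unfolding I_def by (intro Bochner_Integration.integral_nonneg ex)
  have [measurable]: "\<psi> k \<in> borel_measurable borel" for k
    by (intro cont_compact_support_measurable ex)
  define L where "L k \<omega> = density (\<kappa> \<omega>) (\<lambda>x. ennreal (\<psi> k x / (1 + I k \<omega>)))" for k \<omega>
  have emL: "emeasure (L k \<omega>) A = ennreal (1 / (1 + I k \<omega>)) * (\<integral>\<^sup>+x. ennreal (\<psi> k x) * indicator A x \<partial>\<kappa> \<omega>)"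
    if \<omega>: "\<omega> \<in> space N" and [measurable]: "A \<in> sets borel" for k \<omega> A
  proof -
    note [measurable_cong] = sets_radon[OF K[OF \<omega>]]
    have "emeasure (L k \<omega>) A = (\<integral>\<^sup>+x. ennreal (1 / (1 + I k \<omega>)) * (ennreal (\<psi> k x) * indicator A x) \<partial>\<kappa> \<omega>)"
      unfolding L_def using I0[of k \<omega>] ex(5)
      by (subst emeasure_density)
         (auto simp: sets_radon[OF K[OF \<omega>]] ennreal_mult[symmetric] mult.assoc[symmetric] intro!: nn_integral_cong)
    also have "\<dots> = ennreal (1 / (1 + I k \<omega>)) * (\<integral>\<^sup>+x. ennreal (\<psi> k x) * indicator A x \<partial>\<kappa> \<omega>)"
      by (rule nn_integral_cmult) measurable
    finally show ?thesis .
  qed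
  have emLo: "emeasure (L k \<omega>) A = ennreal (1 / (1 + I k \<omega>)) * (SUP n. ennreal (LINT x|\<kappa> \<omega>. \<psi> k x * cutoff n A x))"
    if \<omega>: "\<omega> \<in> space N" and A: "open A" for k \<omega> A
  proof -
    note [measurable_cong] = sets_radon[OF K[OF \<omega>]]
    have inc: "incseq (\<lambda>n x. ennreal (\<psi> k x * cutoff n A x))"
      using ex(5) by (auto simp: incseq_def le_fun_def intro!: ennreal_leI mult_left_mono cutoff_mono)
    have "(\<integral>\<^sup>+x. ennreal (\<psi> k x) * indicator A x \<partial>\<kappa> \<omega>) = (SUP n. \<integral>\<^sup>+x. ennreal (\<psi> k x * cutoff n A x) \<partial>\<kappa> \<omega>)"
      unfolding cutoff_SUP[OF A, symmetric] by (rule nn_integral_monotone_convergence_SUP[OF inc]) measurable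
    also have "\<dots> = (SUP n. ennreal (LINT x|\<kappa> \<omega>. \<psi> k x * cutoff n A x))"
      using ex(5) cutoff_bounds(1)
      by (subst nn_integral_eq_integral_radon[OF K[OF \<omega>]])
         (auto intro!: cont_compact_support_mult ex continuous_cutoff mult_nonneg_nonneg)
    finally show ?thesis using emL[OF \<omega> borel_open[OF A]] by simp
  qed
  have Lker: "L k \<in> measurable N (subprob_algebra borel)" for k
  proof (rule measurable_subprob_algebra_generated)
    show "sets borel = sigma_sets UNIV {S :: 'a set. open S}"
      by (simp add: borel_def)
    show "Int_stable {S :: 'a set. open S}" by (auto simp: Int_stable_def)
    fix \<omega> assume \<omega>: "\<omega> \<in> space N"
    show "sets (L k \<omega>) = sets borel" using sets_radon[OF K[OF \<omega>]] by (simp add: L_def)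
    have "emeasure (L k \<omega>) (space (L k \<omega>)) = emeasure (L k \<omega>) UNIV"
      using space_radon[OF K[OF \<omega>]] by (simp add: L_def)
    also have "\<dots> = ennreal (1 / (1 + I k \<omega>)) * ennreal (I k \<omega>)"
      using nn_integral_eq_integral_radon[OF K[OF \<omega>] ex(4,5)] by (subst emL[OF \<omega>]) (auto simp: I_def)
    also have "\<dots> \<le> 1" using I0[of k \<omega>] by (simp add: ennreal_mult[symmetric] field_simps)
    finally show "subprob_space (L k \<omega>)"
      using space_radon[OF K[OF \<omega>]] by (intro subprob_spaceI) (auto simp: L_def)
  next
    fix A :: "'a set" assume "A \<in> {S. open S}"
    then have A: "open A" by simp
    have [measurable]: "(\<lambda>\<omega>. LINT x|\<kappa> \<omega>. \<psi> k x * cutoff n A x) \<in> borel_measurable N" for n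
      by (intro mI cont_compact_support_mult ex continuous_cutoff)
    have "(\<lambda>\<omega>. ennreal (1 / (1 + I k \<omega>)) * (SUP n. ennreal (LINT x|\<kappa> \<omega>. \<psi> k x * cutoff n A x))) \<in> borel_measurable N"
      by measurable
    then show "(\<lambda>\<omega>. emeasure (L k \<omega>) A) \<in> borel_measurable N"
      by (subst measurable_cong[OF emLo]) (auto simp: A)
  next
    have [measurable]: "(\<lambda>\<omega>. LINT x|\<kappa> \<omega>. \<psi> k x * cutoff n UNIV x) \<in> borel_measurable N" for n
      by (intro mI cont_compact_support_mult ex continuous_cutoff)
    have "(\<lambda>\<omega>. ennreal (1 / (1 + I k \<omega>)) * (SUP n. ennreal (LINT x|\<kappa> \<omega>. \<psi> k x * cutoff n UNIV x))) \<in> borel_measurable N"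
      by measurable
    then show "(\<lambda>\<omega>. emeasure (L k \<omega>) UNIV) \<in> borel_measurable N"
      by (subst measurable_cong[OF emLo]) auto
  qed auto
  have part: "(\<lambda>\<omega>. \<integral>\<^sup>+x. F \<omega> x * indicator (U k) x \<partial>\<kappa> \<omega>) \<in> borel_measurable N" for k
  proof -
    have [measurable]: "U k \<in> sets borel" using ex(1) by auto
    have eq: "(\<integral>\<^sup>+x. F \<omega> x * indicator (U k) x \<partial>\<kappa> \<omega>) =
       ennreal (1 + I k \<omega>) * (\<integral>\<^sup>+x. F \<omega> x * indicator (U k) x \<partial>L k \<omega>)" if \<omega>: "\<omega> \<in> space N" for \<omega>
    proof -
      note [measurable_cong] = sets_radon[OF K[OF \<omega>]]
      have [measurable]: "F \<omega> \<in> borel_measurable borel"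
        using measurable_compose[OF measurable_Pair1'[OF \<omega>] F] by simp
      have c: "ennreal (1 + I k \<omega>) * ennreal (1 / (1 + I k \<omega>)) = 1"
        using I0[of k \<omega>] by (subst ennreal_mult[symmetric]) auto
      have "(\<integral>\<^sup>+x. F \<omega> x * indicator (U k) x \<partial>L k \<omega>) =
         (\<integral>\<^sup>+x. ennreal (\<psi> k x / (1 + I k \<omega>)) * (F \<omega> x * indicator (U k) x) \<partial>\<kappa> \<omega>)"
        unfolding L_def by (subst nn_integral_density) auto
      also have "\<dots> = (\<integral>\<^sup>+x. ennreal (1 / (1 + I k \<omega>)) * (F \<omega> x * indicator (U k) x) \<partial>\<kappa> \<omega>)"
        by (intro nn_integral_cong) (auto simp: indicator_def ex(6))
      also have "\<dots> = ennreal (1 / (1 + I k \<omega>)) * (\<integral>\<^sup>+x. F \<omega> x * indicator (U k) x \<partial>\<kappa> \<omega>)"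
        by (rule nn_integral_cmult) measurable
      finally show ?thesis by (simp add: mult.assoc[symmetric] c)
    qed
    have "(\<lambda>\<omega>. \<integral>\<^sup>+x. F \<omega> x * indicator (U k) x \<partial>L k \<omega>) \<in> borel_measurable N"
      by (rule nn_integral_measurable_subprob_algebra2[OF _ Lker]) measurable
    then have "(\<lambda>\<omega>. ennreal (1 + I k \<omega>) * (\<integral>\<^sup>+x. F \<omega> x * indicator (U k) x \<partial>L k \<omega>)) \<in> borel_measurable N"
      by measurable
    then show ?thesis by (subst measurable_cong[OF eq])
  qed
  have "(\<integral>\<^sup>+x. F \<omega> x \<partial>\<kappa> \<omega>) = (SUP k. \<integral>\<^sup>+x. F \<omega> x * indicator (U k) x \<partial>\<kappa> \<omega>)" if \<omega>: "\<omega> \<in> space N" for \<omega>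
  proof -
    note [measurable_cong] = sets_radon[OF K[OF \<omega>]]
    have [measurable]: "F \<omega> \<in> borel_measurable borel"
      using measurable_compose[OF measurable_Pair1'[OF \<omega>] F] by simp
    have [measurable]: "U k \<in> sets borel" for k using ex(1) by auto
    have "F \<omega> x = (SUP k. F \<omega> x * indicator (U k) x)" for x
    proof (rule antisym)
      obtain k where "x \<in> U k" using ex(3) by blast
      then show "F \<omega> x \<le> (SUP k. F \<omega> x * indicator (U k) x)" by (intro SUP_upper2[of k]) auto
      show "(SUP k. F \<omega> x * indicator (U k) x) \<le> F \<omega> x" by (intro SUP_least) (auto simp: indicator_def)
    qed
    then have "(\<integral>\<^sup>+x. F \<omega> x \<partial>\<kappa> \<omega>) = (\<integral>\<^sup>+x. (SUP k. F \<omega> x * indicator (U k) x) \<partial>\<kappa> \<omega>)" by simp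
    also have "\<dots> = (SUP k. \<integral>\<^sup>+x. F \<omega> x * indicator (U k) x \<partial>\<kappa> \<omega>)"
      using ex(2)
      by (intro nn_integral_monotone_convergence_SUP)
         (auto simp: incseq_def le_fun_def indicator_def subset_iff)
    finally show ?thesis .
  qed
  then show ?thesis using part by (subst measurable_cong) auto
qed

text \<open>
  The mass at \<open>x\<close> is the integral of the indicator of the diagonal, a closed set.
\<close>

lemma measurable_atom_mass:
  assumes lc: "locally_compact_space (euclidean :: 'a::polish_space topology)"
  shows "(\<lambda>(\<eta>, x). emeasure \<eta> {x}) \<in> borel_measurable (discrete_radon_space \<Otimes>\<^sub>M (borel :: 'a measure))"
proof -
  let ?N = "discrete_radon_space \<Otimes>\<^sub>M (borel :: 'a measure)"
  have diag: "{z :: 'a \<times> 'a. fst z = snd z} \<in> sets (borel \<Otimes>\<^sub>M borel)"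
    unfolding borel_prod by (intro borel_closed closed_Collect_eq continuous_intros)
  have "(\<lambda>(w, y). indicator {z. fst z = snd z} (snd w, y) :: ennreal) \<in> borel_measurable (?N \<Otimes>\<^sub>M borel)"
  proof -
    have "(\<lambda>z. indicator {z. fst z = snd z} (snd (fst z), snd z) :: ennreal) \<in> borel_measurable (?N \<Otimes>\<^sub>M borel)"
      by (rule measurable_compose[where N="borel \<Otimes>\<^sub>M borel" and f="\<lambda>z. (snd (fst z), snd z)"])
         (use diag in measurable)
    then show ?thesis by (simp add: case_prod_beta')
  qed
  from measurable_nn_integral_discrete_radon[OF lc measurable_fst this]
  have "(\<lambda>w. \<integral>\<^sup>+y. indicator {z. fst z = snd z} (snd w, y) \<partial>fst w) \<in> borel_measurable ?N" .
  moreover have "(\<integral>\<^sup>+y. indicator {z. fst z = snd z} (snd w, y) \<partial>fst w) = emeasure (fst w) {snd w}"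
    if "w \<in> space ?N" for w
  proof -
    have "fst w \<in> discrete_radon_measures"
      using that by (auto simp: space_pair_measure space_discrete_radon_space)
    then have "sets (fst w) = sets borel" by (auto simp: discrete_radon_measures_def radon_measures_def)
    then have "emeasure (fst w) {snd w} = (\<integral>\<^sup>+y. indicator {snd w} y \<partial>fst w)" by simp
    also have "\<dots> = (\<integral>\<^sup>+y. indicator {z. fst z = snd z} (snd w, y) \<partial>fst w)"
      by (intro nn_integral_cong) (auto simp: indicator_def)
    finally show ?thesis by simp
  qed
  ultimately show ?thesis by (simp add: case_prod_beta' cong: measurable_cong)
qed

section \<open>Discrete Radon measures and multiplication by a function\<close>

lemma countable_in_borel: "countable T \<Longrightarrow> T \<in> sets borel" for T :: "'a::t1_space set"
  by (rule sets.countable) (rule borel_closed[OF closed_singleton])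

text \<open>
  A Radon measure carried by a countable set is discrete: the weights are the masses of its points, and
  points of mass zero are left out because the weights have to be positive.
\<close>

lemma discrete_radonI:
  fixes \<eta> :: "'a::t2_space measure"
  assumes \<eta>: "\<eta> \<in> radon_measures" and T: "countable T" and null: "emeasure \<eta> (- T) = 0"
  shows "\<eta> \<in> discrete_radon_measures"
proof -
  note sets = sets_radon[OF \<eta>]
  have Tb: "T' \<in> sets borel" if "T' \<subseteq> T" for T'
    by (rule countable_in_borel[OF countable_subset[OF that T]])
  define T0 where "T0 = {x\<in>T. 0 < measure \<eta> {x}}"
  have fin: "emeasure \<eta> {x} = ennreal (measure \<eta> {x})" for x
    using \<eta> by (intro emeasure_eq_ennreal_measure) (auto simp: radon_measures_def dest!: spec[of _ "{x}"])
  have "emeasure \<eta> A = (\<integral>\<^sup>+x. ennreal (measure \<eta> {x}) * indicator A x \<partial>count_space T0)" if A: "A \<in> sets borel" for A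
  proof -
    have "emeasure \<eta> A = emeasure \<eta> (A \<inter> T)"
    proof -
      have "emeasure \<eta> A \<le> emeasure \<eta> (A \<inter> T) + emeasure \<eta> (- T)"
        using A Tb[of T] sets
        by (intro order_trans[OF emeasure_mono emeasure_subadditive]) auto
      moreover have "emeasure \<eta> (A \<inter> T) \<le> emeasure \<eta> A" using A Tb[of T] sets by (intro emeasure_mono) auto
      ultimately show ?thesis using null by simp
    qed
    also have "\<dots> = (\<integral>\<^sup>+x. emeasure \<eta> {x} \<partial>count_space (A \<inter> T))"
      using T sets by (intro emeasure_countable_singleton) auto
    also have "\<dots> = (\<integral>\<^sup>+x. emeasure \<eta> {x} * indicator A x \<partial>count_space T0)"
      unfolding nn_integral_count_space_indicator
      by (subst (1 2) nn_integral_count_space_indicator)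
         (auto intro!: nn_integral_cong simp: T0_def fin indicator_def zero_less_measure_iff split: if_splits)
    finally show ?thesis by (simp add: fin)
  qed
  moreover have "countable T0" by (rule countable_subset[OF _ T]) (auto simp: T0_def)
  ultimately show ?thesis using \<eta> unfolding discrete_radon_measures_def
    by (intro CollectI conjI exI[of _ T0] exI[of _ "\<lambda>x. measure \<eta> {x}"]) (auto simp: T0_def)
qed

lemma discrete_radonE:
  fixes \<eta> :: "'a::t2_space measure"
  assumes "\<eta> \<in> discrete_radon_measures"
  obtains T where "\<eta> \<in> radon_measures" "countable T" "emeasure \<eta> (- T) = 0"
proof -
  obtain T s where T: "\<eta> \<in> radon_measures" "countable T"
    "\<And>A. A \<in> sets borel \<Longrightarrow> emeasure \<eta> A = (\<integral>\<^sup>+x. ennreal (s x) * indicator A x \<partial>count_space T)"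
    using assms unfolding discrete_radon_measures_def by blast
  have "T \<in> sets borel" by (rule countable_in_borel[OF T(2)])
  then have "emeasure \<eta> (- T) = (\<integral>\<^sup>+x. 0 \<partial>count_space T)"
    by (subst T(3)[OF borel_comp]) (auto intro!: nn_integral_zero' AE_I2)
  with T show thesis by (intro that[of T]) auto
qed

lemma pos_multipliers_pos: "\<theta> \<in> pos_multipliers \<Longrightarrow> 0 < \<theta> x"
  by (simp add: pos_multipliers_def)

lemma pos_multipliers_continuous: "\<theta> \<in> pos_multipliers \<Longrightarrow> continuous_on UNIV \<theta>"
  by (simp add: pos_multipliers_def)

lemma pos_multipliers_measurable: "\<theta> \<in> pos_multipliers \<Longrightarrow> \<theta> \<in> borel_measurable borel"
  by (intro borel_measurable_continuous_onI pos_multipliers_continuous)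

lemma pos_multipliers_bounds:
  fixes \<theta> :: "'a::t2_space \<Rightarrow> real"
  assumes "\<theta> \<in> pos_multipliers"
  shows "\<exists>n\<ge>1::nat. \<forall>x. 1 / real n \<le> \<theta> x \<and> \<theta> x \<le> real n"
proof -
  obtain K where K: "continuous_on UNIV \<theta>" "\<And>x. 0 < \<theta> x" "compact K" "\<And>x. x \<notin> K \<Longrightarrow> \<theta> x = 1"
    using assms by (auto simp: pos_multipliers_def)
  have "compact ((\<lambda>x. max (\<theta> x) (inverse (\<theta> x))) ` K)"
    using K(2) by (intro compact_continuous_image K(3) continuous_intros continuous_on_subset[OF K(1)])
       (auto simp: less_imp_neq[symmetric])
  then have "bounded ((\<lambda>x. max (\<theta> x) (inverse (\<theta> x))) ` K)" by (rule compact_imp_bounded)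
  then obtain B where B: "\<And>x. x \<in> K \<Longrightarrow> norm (max (\<theta> x) (inverse (\<theta> x))) \<le> B"
    unfolding bounded_iff by blast
  obtain n :: nat where n: "max B 1 \<le> real n" using real_arch_simple by blast
  have "1 / real n \<le> \<theta> x \<and> \<theta> x \<le> real n" for x
  proof (cases "x \<in> K")
    case True
    have "\<theta> x \<le> real n" "inverse (\<theta> x) \<le> real n" using B[OF True] n K(2)[of x] by (auto simp: max_def split: if_splits)
    then show ?thesis using K(2)[of x] n by (auto simp: field_simps)
  qed (use n K(4) in auto)
  then show ?thesis using n by (intro exI[of _ n]) auto
qed

lemma rescale_discrete:
  fixes \<theta> :: "'a::t2_space \<Rightarrow> real"
  assumes \<theta>: "\<theta> \<in> pos_multipliers" and \<eta>: "\<eta> \<in> discrete_radon_measures"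
  shows "rescale \<theta> \<eta> \<in> discrete_radon_measures"
proof -
  obtain T where T: "\<eta> \<in> radon_measures" "countable T" "emeasure \<eta> (- T) = 0"
    using discrete_radonE[OF \<eta>] by blast
  obtain n :: nat where n: "\<And>x. \<theta> x \<le> real n" using pos_multipliers_bounds[OF \<theta>] by blast
  note [measurable_cong] = sets_radon[OF T(1)]
  note [measurable] = pos_multipliers_measurable[OF \<theta>]
  have le: "emeasure (rescale \<theta> \<eta>) A \<le> ennreal (real n) * emeasure \<eta> A" if [measurable]: "A \<in> sets borel" for A
  proof -
    have "emeasure (rescale \<theta> \<eta>) A = (\<integral>\<^sup>+x. ennreal (\<theta> x) * indicator A x \<partial>\<eta>)"
      unfolding rescale_def by (subst emeasure_density) (auto simp: sets_radon[OF T(1)])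
    also have "\<dots> \<le> (\<integral>\<^sup>+x. ennreal (real n) * indicator A x \<partial>\<eta>)"
      using n by (intro nn_integral_mono mult_right_mono ennreal_leI) auto
    also have "\<dots> = ennreal (real n) * emeasure \<eta> A"
      by (subst nn_integral_cmult_indicator) (auto simp: sets_radon[OF T(1)])
    finally show ?thesis .
  qed
  have "rescale \<theta> \<eta> \<in> radon_measures"
    unfolding radon_measures_def
  proof (intro CollectI conjI allI impI)
    show "sets (rescale \<theta> \<eta>) = sets borel" using sets_radon[OF T(1)] by (simp add: rescale_def)
    fix K :: "'a set" assume K: "compact K"
    have "emeasure (rescale \<theta> \<eta>) K \<le> ennreal (real n) * emeasure \<eta> K"
      using K by (intro le borel_closed compact_imp_closed)
    also have "\<dots> < \<infinity>" using T(1) K by (auto simp: radon_measures_def ennreal_mult_less_top)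
    finally show "emeasure (rescale \<theta> \<eta>) K < \<infinity>" .
  qed
  moreover have "- T \<in> sets borel" using T(2) by (intro borel_comp countable_in_borel)
  then have "emeasure (rescale \<theta> \<eta>) (- T) = 0" using le[of "- T"] T(3) by simp
  ultimately show ?thesis using T(2) by (intro discrete_radonI)
qed

lemma integral_rescale:
  assumes \<theta>: "\<theta> \<in> pos_multipliers" and \<eta>: "\<eta> \<in> radon_measures" and f: "f \<in> borel_measurable borel"
  shows "(LINT x|rescale \<theta> \<eta>. f x) = (LINT x|\<eta>. f x * \<theta> x)"
proof -
  note [measurable_cong] = sets_radon[OF \<eta>]
  note [measurable] = pos_multipliers_measurable[OF \<theta>]
  show ?thesis
    unfolding rescale_def using f \<theta>
    by (subst integral_density) (auto simp: pos_multipliers_def less_imp_le mult.commute)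
qed

lemma measurable_rescale:
  fixes \<theta> :: "'a::polish_space \<Rightarrow> real"
  assumes lc: "locally_compact_space (euclidean :: 'a topology)" and \<theta>: "\<theta> \<in> pos_multipliers"
  shows "rescale \<theta> \<in> measurable discrete_radon_space discrete_radon_space"
proof (rule measurable_into_discrete_radon_space[OF lc])
  show "rescale \<theta> \<omega> \<in> discrete_radon_measures" if "\<omega> \<in> space discrete_radon_space" for \<omega>
    using that rescale_discrete[OF \<theta>] by (simp add: space_discrete_radon_space)
  fix g :: "'a \<Rightarrow> real" assume g: "g \<in> cont_compact_support"
  have "(\<lambda>x. g x * \<theta> x) \<in> cont_compact_support"
    by (intro cont_compact_support_mult g pos_multipliers_continuous \<theta>)
  from integral_measurable_discrete[OF this]
  show "(\<lambda>\<omega>. LINT x|rescale \<theta> \<omega>. g x) \<in> borel_measurable discrete_radon_space"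
    by (rule measurable_cong[THEN iffD1, rotated])
       (auto simp: space_discrete_radon_space discrete_radon_measures_def
         integral_rescale[OF \<theta> _ cont_compact_support_measurable[OF g]])
qed

section \<open>The Levy measure and its dilations\<close>

lemma emeasure_radon_bounded:
  assumes "\<eta> \<in> radon_measures" "A \<in> sets borel" "compact (closure A)"
  shows "emeasure \<eta> A < \<infinity>"
proof -
  have "emeasure \<eta> A \<le> emeasure \<eta> (closure A)"
    using closure_subset assms by (intro emeasure_mono) (auto simp: sets_radon)
  also have "\<dots> < \<infinity>" using assms by (simp add: radon_measures_def)
  finally show ?thesis .
qed

lemma sigma_finite_radon:
  fixes \<eta> :: "'a::polish_space measure"
  assumes lc: "locally_compact_space (euclidean :: 'a topology)" and \<eta>: "\<eta> \<in> radon_measures"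
  shows "sigma_finite_measure \<eta>"
proof -
  obtain U :: "nat \<Rightarrow> 'a set" where ex: "\<And>k. open (U k)" "(\<Union>k. U k) = UNIV"
    "\<And>k. compact (closure (U k))"
  proof (rule compact_exhaustion[OF lc])
    fix U :: "nat \<Rightarrow> 'a set" assume "\<And>k. open (U k)" "(\<Union>k. U k) = UNIV" "\<And>k. compact (closure (U k))"
    then show thesis by (rule that)
  qed
  have "emeasure \<eta> (U k) \<noteq> \<infinity>" for k
    using emeasure_radon_bounded[OF \<eta> borel_open[OF ex(1)] ex(3)] by (simp add: less_top[symmetric])
  then show ?thesis
    using ex(1,2) by (intro sigma_finite_measure.intro exI[of _ "range U"])
      (auto simp: sets_radon[OF \<eta>] space_radon[OF \<eta>])
qed

locale levy_density =
  fixes \<sigma> :: "'a::polish_space measure" and l :: "'a \<Rightarrow> real \<Rightarrow> real"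
  assumes loc_compact: "locally_compact_space (euclidean :: 'a topology)"
    and radon: "\<sigma> \<in> radon_measures"
    and non_atomic: "\<And>x. emeasure \<sigma> {x} = 0"
    and l_meas: "(\<lambda>(x, s). l x s) \<in> borel_measurable (borel \<Otimes>\<^sub>M restrict_space borel {0<..})"
    and l_nonneg: "\<And>x s. 0 < s \<Longrightarrow> 0 \<le> l x s"
    and l_dichotomy: "\<And>x. (\<forall>s>0. 0 < l x s) \<or> (\<forall>s>0. l x s = 0)"
begin

definition Y :: "'a set" where "Y = {x. \<forall>s>0. 0 < l x s}"

text \<open>
  The function \<open>l\<close> is measurable on \<open>X \<times> (0, \<infinity>)\<close>; its extension by zero is measurable on
  \<open>X \<times> \<real>\<close>.
\<close>

definition L :: "'a \<Rightarrow> real \<Rightarrow> real" where "L x s = (if 0 < s then l x s else 0)"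

text \<open>
  The Levy measure transported from \<open>X \<times> (0, \<infinity>)\<close> to \<open>X \<times> \<real>\<close>, where it gives no mass to marks
  \<open>s \<le> 0\<close>.
\<close>

definition m :: "('a \<times> real) measure" where
  "m = distr (levy_measure \<sigma> l) (borel \<Otimes>\<^sub>M borel) (\<lambda>z. z)"

text \<open>
  The density of the dilated Levy measure with respect to the original one.
\<close>

definition \<rho> :: "('a \<Rightarrow> real) \<Rightarrow> 'a \<times> real \<Rightarrow> real" where
  "\<rho> \<theta> z = L (fst z) (inverse (\<theta> (fst z)) * snd z) / L (fst z) (snd z)"

lemma sets_\<sigma>[simp, measurable_cong]: "sets \<sigma> = sets borel"
  by (rule sets_radon[OF radon])

lemma space_\<sigma>[simp]: "space \<sigma> = UNIV"
  by (rule space_radon[OF radon])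

lemma sets_m[simp, measurable_cong]: "sets m = sets (borel \<Otimes>\<^sub>M borel)"
  by (simp add: m_def)

lemma space_m[simp]: "space m = UNIV"
  by (simp add: m_def space_pair_measure)

lemma L_measurable: "(\<lambda>z. L (fst z) (snd z)) \<in> borel_measurable (borel \<Otimes>\<^sub>M borel)"
proof -
  have [measurable]: "(\<lambda>z::'a\<times>real. (fst z, if 0 < snd z then snd z else 1)) \<in>
      measurable (borel \<Otimes>\<^sub>M borel) (borel \<Otimes>\<^sub>M restrict_space borel {0<..})"
    by (intro measurable_Pair measurable_restrict_space2) (auto simp: measurable_fst)
  have "(\<lambda>z. L (fst z) (snd z)) =
      (\<lambda>z. if 0 < snd z then (\<lambda>(x, s). l x s) (fst z, if 0 < snd z then snd z else 1) else 0)"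
    by (auto simp: L_def)
  also have "\<dots> \<in> borel_measurable (borel \<Otimes>\<^sub>M borel)"
    by (intro measurable_If measurable_compose[OF _ l_meas]) measurable
  finally show ?thesis .
qed

lemma L_measurable'[measurable (raw)]:
  assumes "f \<in> borel_measurable N" "g \<in> borel_measurable N"
  shows "(\<lambda>x. L (f x) (g x)) \<in> borel_measurable N"
  using measurable_compose[OF measurable_Pair[OF assms] L_measurable] by simp

lemma L_nonneg[simp]: "0 \<le> L x s"
  by (simp add: L_def l_nonneg)

lemma L_pos: "x \<in> Y \<Longrightarrow> 0 < s \<Longrightarrow> 0 < L x s"
  by (simp add: L_def Y_def)

lemma L_zero: "x \<notin> Y \<or> s \<le> 0 \<Longrightarrow> L x s = 0"
proof -
  assume "x \<notin> Y \<or> s \<le> 0"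
  moreover have "\<forall>s>0. l x s = 0" if "x \<notin> Y" using l_dichotomy[of x] that unfolding Y_def by blast
  ultimately show ?thesis unfolding L_def by auto
qed

lemma Y_measurable[measurable]: "Y \<in> sets borel"
proof -
  have "Y = {x. 0 < L x 1}" 
  proof (intro set_eqI)
    show "x \<in> Y \<longleftrightarrow> x \<in> {x. 0 < L x 1}" for x
      using L_pos[of x 1] L_zero[of x 1] by (cases "x \<in> Y") simp_all
  qed
  also have "\<dots> = (\<lambda>x. L x 1) -` {0<..} \<inter> space borel" by auto
  also have "\<dots> \<in> sets borel" by measurable
  finally show ?thesis .
qed

lemma sets_lborel_pos[simp, measurable_cong]: "sets lborel_pos = sets (restrict_space borel {0<..})"
  unfolding lborel_pos_def by (rule sets_restrict_space_cong) simp

lemma space_lborel_pos[simp]: "space lborel_pos = {0<..}"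
  by (simp add: lborel_pos_def space_restrict_space)

lemma sigma_finite_lborel_pos: "sigma_finite_measure lborel_pos"
  unfolding lborel_pos_def by (intro sigma_finite_measure_restrict_space sigma_finite_lborel) auto

lemma id_measurable: "(\<lambda>z. z) \<in> measurable (\<sigma> \<Otimes>\<^sub>M lborel_pos) (borel \<Otimes>\<^sub>M borel)"
proof -
  have "snd \<in> measurable (\<sigma> \<Otimes>\<^sub>M lborel_pos) (restrict_space borel {0<..})"
    using measurable_snd[of \<sigma> lborel_pos] by (simp cong: measurable_cong_sets)
  then have 2: "snd \<in> borel_measurable (\<sigma> \<Otimes>\<^sub>M lborel_pos)"
    by (simp add: measurable_restrict_space2_iff)
  have "fst \<in> borel_measurable (\<sigma> \<Otimes>\<^sub>M lborel_pos)"
    using measurable_fst[of \<sigma> lborel_pos] by (simp cong: measurable_cong_sets)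
  from this 2 have "(\<lambda>z. (fst z, snd z)) \<in> measurable (\<sigma> \<Otimes>\<^sub>M lborel_pos) (borel \<Otimes>\<^sub>M borel)"
    by (rule measurable_Pair)
  then show ?thesis by simp
qed

lemma levy_density_cong:
  "levy_measure \<sigma> l = density (\<sigma> \<Otimes>\<^sub>M lborel_pos) (\<lambda>z. ennreal (L (fst z) (snd z) / snd z))"
proof -
  have eq: "(\<lambda>(x, s). ennreal (l x s / s)) z = ennreal (L (fst z) (snd z) / snd z)"
    if "z \<in> space (\<sigma> \<Otimes>\<^sub>M lborel_pos)" for z
    using that by (auto simp: space_pair_measure L_def)
  have "(\<lambda>z. ennreal (L (fst z) (snd z) / snd z)) \<in> borel_measurable (borel \<Otimes>\<^sub>M borel)"
    by measurable
  from measurable_compose[OF id_measurable this]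
  have 1: "(\<lambda>z. ennreal (L (fst z) (snd z) / snd z)) \<in> borel_measurable (\<sigma> \<Otimes>\<^sub>M lborel_pos)" .
  have 2: "(\<lambda>(x, s). ennreal (l x s / s)) \<in> borel_measurable (\<sigma> \<Otimes>\<^sub>M lborel_pos)"
    using 1 by (subst measurable_cong[OF eq])
  show ?thesis
    unfolding levy_measure_def using eq by (intro density_cong 1 2 AE_I2)
qed

lemma id_measurable_levy: "(\<lambda>z. z) \<in> measurable (levy_measure \<sigma> l) (borel \<Otimes>\<^sub>M borel)"
  unfolding levy_density_cong using id_measurable by simp

lemma nn_integral_m:
  assumes F: "F \<in> borel_measurable (borel \<Otimes>\<^sub>M borel)"
  shows "(\<integral>\<^sup>+z. F z \<partial>m) = (\<integral>\<^sup>+x. \<integral>\<^sup>+s. ennreal (L x s / s) * F (x, s) \<partial>lborel \<partial>\<sigma>)"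
proof -
  interpret lp: sigma_finite_measure lborel_pos by (rule sigma_finite_lborel_pos)
  have F'[measurable]: "F \<in> borel_measurable (\<sigma> \<Otimes>\<^sub>M lborel_pos)"
    using measurable_compose[OF id_measurable F] .
  have "(\<lambda>z. ennreal (L (fst z) (snd z) / snd z)) \<in> borel_measurable (borel \<Otimes>\<^sub>M borel)"
    by measurable
  from measurable_compose[OF id_measurable this]
  have d[measurable]: "(\<lambda>z. ennreal (L (fst z) (snd z) / snd z)) \<in> borel_measurable (\<sigma> \<Otimes>\<^sub>M lborel_pos)" .
  have "(\<integral>\<^sup>+z. F z \<partial>m) = (\<integral>\<^sup>+z. F z \<partial>levy_measure \<sigma> l)"
    unfolding m_def using F by (subst nn_integral_distr[OF id_measurable_levy]) auto
  also have "\<dots> = (\<integral>\<^sup>+z. ennreal (L (fst z) (snd z) / snd z) * F z \<partial>(\<sigma> \<Otimes>\<^sub>M lborel_pos))"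
    unfolding levy_density_cong by (rule nn_integral_density[OF d F'])
  also have "\<dots> = (\<integral>\<^sup>+x. \<integral>\<^sup>+s. ennreal (L x s / s) * F (x, s) \<partial>lborel_pos \<partial>\<sigma>)"
    by (subst lp.nn_integral_fst[symmetric]) auto
  also have "\<dots> = (\<integral>\<^sup>+x. \<integral>\<^sup>+s. ennreal (L x s / s) * F (x, s) \<partial>lborel \<partial>\<sigma>)"
  proof (intro nn_integral_cong)
    fix x
    have "{0<..} \<inter> space lborel \<in> sets (lborel :: real measure)" by simp
    then have "(\<integral>\<^sup>+s. ennreal (L x s / s) * F (x, s) \<partial>lborel_pos) =
        (\<integral>\<^sup>+s. ennreal (L x s / s) * F (x, s) * indicator {0<..} s \<partial>lborel)"
      unfolding lborel_pos_def by (rule nn_integral_restrict_space)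
    also have "\<dots> = (\<integral>\<^sup>+s. ennreal (L x s / s) * F (x, s) \<partial>lborel)"
      by (intro nn_integral_cong) (simp add: indicator_def L_zero)
    finally show "(\<integral>\<^sup>+s. ennreal (L x s / s) * F (x, s) \<partial>lborel_pos) =
        (\<integral>\<^sup>+s. ennreal (L x s / s) * F (x, s) \<partial>lborel)" .
  qed
  finally show ?thesis .
qed

lemma \<rho>_measurable[measurable]:
  assumes [measurable]: "\<theta> \<in> borel_measurable borel"
  shows "\<rho> \<theta> \<in> borel_measurable (borel \<Otimes>\<^sub>M borel)"
  unfolding \<rho>_def by measurable

lemma \<rho>_nonneg[simp]: "0 \<le> \<rho> \<theta> z"
  by (simp add: \<rho>_def)

lemma \<rho>_pos: "fst z \<in> Y \<Longrightarrow> 0 < snd z \<Longrightarrow> 0 < \<theta> (fst z) \<Longrightarrow> 0 < \<rho> \<theta> z"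
  by (simp add: \<rho>_def L_pos)

text \<open>
  By the dichotomy, numerator and denominator of \<open>\<rho>\<close> vanish together, so division by zero does no harm.
\<close>

lemma \<rho>_mult_L:
  assumes "0 < \<theta> x"
  shows "\<rho> \<theta> (x, s) * L x s = L x (inverse (\<theta> x) * s)"
proof (cases "x \<in> Y \<and> 0 < s")
  case True
  then show ?thesis using L_pos[of x s] by (simp add: \<rho>_def)
next
  case False
  then show ?thesis using assms by (auto simp: L_zero mult_nonneg_nonpos)
qed

lemma AE_m: "AE z in m. fst z \<in> Y \<and> 0 < snd z"
proof (rule AE_I'[where N="{z. \<not> (fst z \<in> Y \<and> 0 < snd z)}"])
  have N[measurable]: "{z::'a\<times>real. \<not> (fst z \<in> Y \<and> 0 < snd z)} \<in> sets (borel \<Otimes>\<^sub>M borel)"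
  proof -
    have "{z::'a\<times>real \<in> space (borel \<Otimes>\<^sub>M borel). \<not> (fst z \<in> Y \<and> 0 < snd z)} \<in> sets (borel \<Otimes>\<^sub>M borel)"
      by measurable
    then show ?thesis by (simp add: space_pair_measure)
  qed
  have "emeasure m {z. \<not> (fst z \<in> Y \<and> 0 < snd z)} = (\<integral>\<^sup>+z. indicator {z. \<not> (fst z \<in> Y \<and> 0 < snd z)} z \<partial>m)"
    using N by (intro nn_integral_indicator[symmetric]) (simp only: sets_m)
  also have "\<dots> = (\<integral>\<^sup>+x. \<integral>\<^sup>+s. ennreal (L x s / s) * indicator {z. \<not> (fst z \<in> Y \<and> 0 < snd z)} (x, s) \<partial>lborel \<partial>\<sigma>)"
    by (rule nn_integral_m) measurable
  also have "\<dots> = 0"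
  proof -
    have *: "ennreal (L x s / s) * indicator {z. \<not> (fst z \<in> Y \<and> 0 < snd z)} (x, s) = 0" for x s
      by (cases "x \<in> Y \<and> 0 < s") (auto simp: indicator_def L_zero)
    show ?thesis unfolding * by simp
  qed
  finally show "{z. \<not> (fst z \<in> Y \<and> 0 < snd z)} \<in> null_sets m"
    by (rule null_setsI) (simp only: sets_m N)
qed auto

lemma AE_m_fibre: "AE z in m. fst z \<noteq> x"
proof (rule AE_I'[where N="{z. fst z = x}"])
  have [measurable]: "{z::'a\<times>real. fst z = x} \<in> sets (borel \<Otimes>\<^sub>M borel)"
  proof -
    have "fst -` {x} \<inter> space (borel \<Otimes>\<^sub>M borel) \<in> sets (borel \<Otimes>\<^sub>M (borel :: real measure))"
      by (rule measurable_sets[OF measurable_fst]) simp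
    then show ?thesis by (simp add: space_pair_measure vimage_def)
  qed
  have "emeasure m {z. fst z = x} = (\<integral>\<^sup>+z. indicator {z. fst z = x} z \<partial>m)"
    by simp
  also have "\<dots> = (\<integral>\<^sup>+y. \<integral>\<^sup>+s. ennreal (L y s / s) * indicator {z. fst z = x} (y, s) \<partial>lborel \<partial>\<sigma>)"
    by (rule nn_integral_m) measurable
  also have "\<dots> = 0"
  proof (rule nn_integral_zero')
    have "AE y in \<sigma>. y \<noteq> x" using non_atomic[of x] by (intro AE_I'[where N="{x}"] null_setsI) auto
    then show "AE y in \<sigma>. (\<integral>\<^sup>+s. ennreal (L y s / s) * indicator {z. fst z = x} (y, s) \<partial>lborel) = 0"
      by eventually_elim simp
  qed
  finally show "{z. fst z = x} \<in> null_sets m" by (intro null_setsI) auto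
qed auto

text \<open>
  Substitution \<open>s = t / \<theta>(x)\<close> in the inner integral; the factor \<open>ds / s\<close> is unchanged.
\<close>

lemma nn_integral_rescaled:
  assumes \<theta>[measurable]: "\<theta> \<in> borel_measurable borel" and pos: "\<And>x. 0 < \<theta> x"
    and F[measurable]: "F \<in> borel_measurable (borel \<Otimes>\<^sub>M borel)"
  shows "(\<integral>\<^sup>+z. F (fst z, snd z * \<theta> (fst z)) \<partial>m) = (\<integral>\<^sup>+z. ennreal (\<rho> \<theta> z) * F z \<partial>m)"
proof -
  have "(\<integral>\<^sup>+s. ennreal (L x s / s) * F (x, s * \<theta> x) \<partial>lborel) =
        (\<integral>\<^sup>+s. ennreal (L x s / s) * (ennreal (\<rho> \<theta> (x, s)) * F (x, s)) \<partial>lborel)" for x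
  proof -
    have [measurable]: "(\<lambda>s. L x s) \<in> borel_measurable borel" "(\<lambda>s. F (x, s)) \<in> borel_measurable borel"
      by measurable
    have "(\<integral>\<^sup>+s. ennreal (L x s / s) * F (x, s * \<theta> x) \<partial>lborel) =
       ennreal \<bar>inverse (\<theta> x)\<bar> * (\<integral>\<^sup>+t. ennreal (L x (0 + inverse (\<theta> x) * t) / (0 + inverse (\<theta> x) * t)) *
          F (x, (0 + inverse (\<theta> x) * t) * \<theta> x) \<partial>lborel)"
      using pos[of x] by (intro nn_integral_real_affine) auto
    also have "\<dots> = (\<integral>\<^sup>+t. ennreal \<bar>inverse (\<theta> x)\<bar> * (ennreal (L x (inverse (\<theta> x) * t) / (inverse (\<theta> x) * t)) *
          F (x, (inverse (\<theta> x) * t) * \<theta> x)) \<partial>lborel)"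
      by (subst nn_integral_cmult) auto
    also have "\<dots> = (\<integral>\<^sup>+t. ennreal (L x t / t) * (ennreal (\<rho> \<theta> (x, t)) * F (x, t)) \<partial>lborel)"
    proof (intro nn_integral_cong)
      fix t
      have 1: "ennreal \<bar>inverse (\<theta> x)\<bar> * ennreal (L x (inverse (\<theta> x) * t) / (inverse (\<theta> x) * t)) =
          ennreal (L x t / t) * ennreal (\<rho> \<theta> (x, t))"
      proof (cases "0 < t")
        case True
        have "ennreal \<bar>inverse (\<theta> x)\<bar> * ennreal (L x (inverse (\<theta> x) * t) / (inverse (\<theta> x) * t)) =
           ennreal (\<bar>inverse (\<theta> x)\<bar> * (L x (inverse (\<theta> x) * t) / (inverse (\<theta> x) * t)))"
          using True pos[of x] by (intro ennreal_mult[symmetric]) auto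
        also have "\<bar>inverse (\<theta> x)\<bar> * (L x (inverse (\<theta> x) * t) / (inverse (\<theta> x) * t)) =
            L x (inverse (\<theta> x) * t) / t"
          using True pos[of x] by (simp add: field_simps)
        also have "\<dots> = L x t / t * \<rho> \<theta> (x, t)"
          unfolding \<rho>_mult_L[of \<theta> x t, OF pos, symmetric] by simp
        also have "ennreal \<dots> = ennreal (L x t / t) * ennreal (\<rho> \<theta> (x, t))"
          using True by (intro ennreal_mult) auto
        finally show ?thesis .
      next
        case False
        then have "inverse (\<theta> x) * t \<le> 0" using pos[of x] by (simp add: mult_nonneg_nonpos)
        then show ?thesis using False by (simp add: L_zero)
      qed
      have "inverse (\<theta> x) * t * \<theta> x = t" using pos[of x] by simp
      then show "ennreal \<bar>inverse (\<theta> x)\<bar> * (ennreal (L x (inverse (\<theta> x) * t) / (inverse (\<theta> x) * t)) *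
          F (x, (inverse (\<theta> x) * t) * \<theta> x)) = ennreal (L x t / t) * (ennreal (\<rho> \<theta> (x, t)) * F (x, t))"
        by (simp only: mult.assoc[symmetric] 1)
    qed
    finally show ?thesis .
  qed
  then show ?thesis by (simp add: nn_integral_m)
qed

lemma distr_rescaled:
  assumes \<theta>[measurable]: "\<theta> \<in> borel_measurable borel" and pos: "\<And>x. 0 < \<theta> x"
  shows "distr m (borel \<Otimes>\<^sub>M borel) (\<lambda>z. (fst z, snd z * \<theta> (fst z))) = density m (\<lambda>z. ennreal (\<rho> \<theta> z))"
proof (rule measure_eqI)
  fix A assume "A \<in> sets (distr m (borel \<Otimes>\<^sub>M borel) (\<lambda>z. (fst z, snd z * \<theta> (fst z))))"
  then have [measurable]: "A \<in> sets (borel \<Otimes>\<^sub>M borel)" by simp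
  have "emeasure (distr m (borel \<Otimes>\<^sub>M borel) (\<lambda>z. (fst z, snd z * \<theta> (fst z)))) A =
      (\<integral>\<^sup>+z. indicator A z \<partial>distr m (borel \<Otimes>\<^sub>M borel) (\<lambda>z. (fst z, snd z * \<theta> (fst z))))" by simp
  also have "\<dots> = (\<integral>\<^sup>+z. indicator A (fst z, snd z * \<theta> (fst z)) \<partial>m)"
    by (rule nn_integral_distr) measurable
  also have "\<dots> = (\<integral>\<^sup>+z. ennreal (\<rho> \<theta> z) * indicator A z \<partial>m)"
    by (rule nn_integral_rescaled) (use pos in measurable)
  also have "\<dots> = emeasure (density m (\<lambda>z. ennreal (\<rho> \<theta> z))) A"
    by (rule emeasure_density[symmetric]) measurable
  finally show "emeasure (distr m (borel \<Otimes>\<^sub>M borel) (\<lambda>z. (fst z, snd z * \<theta> (fst z)))) A =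
    emeasure (density m (\<lambda>z. ennreal (\<rho> \<theta> z))) A" .
qed simp

lemma set_times_measurable:
  "A \<in> sets borel \<Longrightarrow> B \<in> sets borel \<Longrightarrow> A \<times> B \<in> sets (borel \<Otimes>\<^sub>M borel)" for A :: "'a set" and B :: "real set"
  by auto

end

text \<open>
  Summability passes from \<open>a\<close> to \<open>b\<close> if \<open>b\<close> is dominated by \<open>a\<close> wherever \<open>a\<close> is small, because a summable
  \<open>a\<close> is at least \<open>c\<close> at finitely many indices only.
\<close>

lemma nn_integral_count_space_finite_transfer:
  assumes a: "(\<integral>\<^sup>+p. a p \<partial>count_space I) < \<infinity>"
    and c: "0 < c" and le: "\<And>p. p \<in> I \<Longrightarrow> a p < c \<Longrightarrow> b p \<le> C * a p"
    and C: "C < \<infinity>" and b: "\<And>p. p \<in> I \<Longrightarrow> b p < (\<infinity> :: ennreal)"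
  shows "(\<integral>\<^sup>+p. b p \<partial>count_space I) < \<infinity>"
proof -
  define J where "J = {p\<in>I. c \<le> a p}"
  have "c * emeasure (count_space I) J = (\<integral>\<^sup>+p. c * indicator J p \<partial>count_space I)"
    by (rule nn_integral_cmult_indicator[symmetric]) (auto simp: J_def)
  also have "\<dots> \<le> (\<integral>\<^sup>+p. a p \<partial>count_space I)"
    by (intro nn_integral_mono) (auto simp: J_def indicator_def)
  also note a
  finally have "emeasure (count_space I) J < \<infinity>"
    using c by (auto simp: ennreal_mult_less_top)
  then have J: "finite J"
    by (cases "finite J") (auto simp: emeasure_count_space J_def split: if_splits)
  have "(\<integral>\<^sup>+p. b p \<partial>count_space I) \<le> (\<integral>\<^sup>+p. C * a p + b p * indicator J p \<partial>count_space I)"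
    using le by (intro nn_integral_mono) (auto simp: J_def indicator_def not_le)
  also have "\<dots> = C * (\<integral>\<^sup>+p. a p \<partial>count_space I) + (\<integral>\<^sup>+p. b p * indicator J p \<partial>count_space I)"
    by (simp add: nn_integral_add nn_integral_cmult)
  also have "(\<integral>\<^sup>+p. b p * indicator J p \<partial>count_space I) = (\<Sum>p\<in>J. b p)"
  proof -
    have "(\<integral>\<^sup>+p. b p * indicator J p \<partial>count_space I) = (\<Sum>p\<in>J. b p * emeasure (count_space I) {p})"
      using J by (intro nn_integral_indicator_finite) (auto simp: J_def)
    also have "\<dots> = (\<Sum>p\<in>J. b p)" by (intro sum.cong) (auto simp: J_def)
    finally show ?thesis .
  qed
  also have "C * (\<integral>\<^sup>+p. a p \<partial>count_space I) + (\<Sum>p\<in>J. b p) < \<infinity>"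
    using a C b J by (auto simp: ennreal_mult_less_top J_def)
  finally show ?thesis .
qed

lemma abs_ln_le_of_near_1:
  fixes r :: real
  assumes "\<bar>r - 1\<bar> < 1 / 2"
  shows "\<bar>ln r\<bar> \<le> 2 * \<bar>r - 1\<bar>"
proof -
  have r: "1 / 2 < r" "r < 3 / 2" using assms by linarith+
  have 1: "ln r \<le> r - 1" using r by (intro ln_le_minus_one) auto
  have "ln (inverse r) \<le> inverse r - 1" using r by (intro ln_le_minus_one) auto
  moreover have "ln (inverse r) = - ln r" by (rule ln_inverse)
  moreover have "inverse r - 1 = (1 - r) / r" using r by (simp add: field_simps)
  ultimately have "- ln r \<le> (1 - r) / r" by simp
  also have "(1 - r) / r \<le> 2 * \<bar>r - 1\<bar>"
  proof (cases "r \<le> 1")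
    case True
    then have "(1 - r) * 1 \<le> (1 - r) * (2 * r)" using r by (intro mult_left_mono) auto
    then show ?thesis using r True by (simp add: field_simps)
  next
    case False
    then have "(1 - r) / r \<le> 0" using r by (intro divide_nonpos_pos) auto
    also have "0 \<le> 2 * \<bar>r - 1\<bar>" by simp
    finally show ?thesis .
  qed
  moreover have "r - 1 \<le> 2 * \<bar>r - 1\<bar>" by (cases "1 \<le> r") simp_all
  ultimately show ?thesis using 1 by (simp only: abs_le_iff) simp
qed

locale levy_regular = levy_density +
  assumes l_integrable: "\<And>A. A \<in> bounded_borel Y \<Longrightarrow>
      (\<integral>\<^sup>+(x, s)\<in>A \<times> {0<..}. ennreal (l x s * min (inverse s) 1) \<partial>(\<sigma> \<Otimes>\<^sub>M lborel_pos)) < \<infinity>"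
    and l_regular: "\<And>n::nat. n \<ge> 1 \<Longrightarrow> \<exists>\<epsilon>>0. \<forall>A\<in>bounded_borel Y.
      (\<integral>\<^sup>+x\<in>A. (SUP r\<in>{1 / real n..real n}.
         \<integral>\<^sup>+s\<in>{0<..<\<epsilon>}. ennreal (\<bar>l x (r * s) - l x s\<bar> / s) \<partial>lborel) \<partial>\<sigma>) < \<infinity>"
begin

lemma min_integrable:
  assumes A[measurable]: "A \<in> sets borel" and c: "compact (closure A)"
  shows "(\<integral>\<^sup>+z. indicator A (fst z) * ennreal (min (snd z) 1) \<partial>m) < \<infinity>"
proof -
  interpret lp: sigma_finite_measure lborel_pos by (rule sigma_finite_lborel_pos)
  have "closure (A \<inter> Y) \<subseteq> closure A" by (intro closure_mono) auto
  then have "compact (closure (A \<inter> Y))" using c by (metis closed_Int_compact closed_closure inf.absorb1)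
  then have AY: "A \<inter> Y \<in> bounded_borel Y" by (auto simp: bounded_borel_def)
  have eq: "ennreal (L x s / s) * (indicator A x * ennreal (min s 1)) =
     indicator ((A \<inter> Y) \<times> {0<..}) (x, s) * ennreal (l x s * min (inverse s) 1)" for x s
  proof (cases "x \<in> A \<inter> Y \<and> 0 < s")
    case True
    have "L x s / s * min s 1 = l x s * min (inverse s) 1"
      using True by (auto simp: L_def min_def field_simps)
    then show ?thesis using True by (simp add: ennreal_mult[symmetric])
  next
    case False
    then have "x \<notin> A \<or> L x s = 0" by (auto simp: L_zero)
    then show ?thesis using False by auto
  qed
  let ?G = "\<lambda>z. ennreal (L (fst z) (snd z) / snd z) * (indicator A (fst z) * ennreal (min (snd z) 1))"
  have G: "?G \<in> borel_measurable (\<sigma> \<Otimes>\<^sub>M lborel_pos)"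
    by (rule measurable_compose[OF id_measurable]) measurable
  have "(\<integral>\<^sup>+z. indicator A (fst z) * ennreal (min (snd z) 1) \<partial>m) =
     (\<integral>\<^sup>+z. indicator A (fst z) * ennreal (min (snd z) 1) \<partial>levy_measure \<sigma> l)"
    unfolding m_def by (subst nn_integral_distr[OF id_measurable_levy]) measurable
  also have "\<dots> = (\<integral>\<^sup>+z. ?G z \<partial>(\<sigma> \<Otimes>\<^sub>M lborel_pos))"
    unfolding levy_density_cong
    by (rule nn_integral_density; rule measurable_compose[OF id_measurable]) measurable
  also have "\<dots> = (\<integral>\<^sup>+(x, s)\<in>(A \<inter> Y) \<times> {0<..}. ennreal (l x s * min (inverse s) 1) \<partial>(\<sigma> \<Otimes>\<^sub>M lborel_pos))"
    by (intro nn_integral_cong) (auto simp: eq mult.commute split: prod.split)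
  also have "\<dots> < \<infinity>" by (rule l_integrable[OF AY])
  finally show ?thesis .
qed

lemma large_finite:
  assumes A[measurable]: "A \<in> sets borel" and c: "compact (closure A)" and d: "0 < d"
  shows "emeasure m (A \<times> {d..}) < \<infinity>"
proof -
  have "ennreal (min d 1) * emeasure m (A \<times> {d..}) = (\<integral>\<^sup>+z. ennreal (min d 1) * indicator (A \<times> {d..}) z \<partial>m)"
    by (rule nn_integral_cmult_indicator[symmetric]) auto
  also have "\<dots> \<le> (\<integral>\<^sup>+z. indicator A (fst z) * ennreal (min (snd z) 1) \<partial>m)"
    by (intro nn_integral_mono) (auto simp: indicator_def intro!: ennreal_leI split: if_splits)
  also have "\<dots> < \<infinity>" by (rule min_integrable[OF A c])
  finally show ?thesis using d by (auto simp: ennreal_mult_less_top)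
qed

lemma sigma_finite_m: "sigma_finite_measure m"
proof -
  obtain U :: "nat \<Rightarrow> 'a set" where U: "\<And>k. open (U k)" "incseq U" "(\<Union>k. U k) = UNIV"
    "\<And>k. compact (closure (U k))"
  proof (rule compact_exhaustion[OF loc_compact])
    fix U :: "nat \<Rightarrow> 'a set" assume "\<And>k. open (U k)" "incseq U" "(\<Union>k. U k) = UNIV" "\<And>k. compact (closure (U k))"
    then show thesis by (rule that)
  qed
  have [measurable]: "U k \<in> sets borel" for k using U(1) by auto
  define B where "B k = U k \<times> {1 / real (Suc k)..} \<union> UNIV \<times> {..0}" for k
  have Bm: "B k \<in> sets m" for k unfolding B_def by (auto intro!: sets.Un set_times_measurable)
  have null: "emeasure m (UNIV \<times> {..0}) = 0"
  proof -
    have "AE z in m. z \<notin> UNIV \<times> {..0}" using AE_m by eventually_elim auto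
    then show ?thesis by (subst (asm) AE_iff_null_sets[symmetric]) auto
  qed
  have "emeasure m (B k) \<noteq> \<infinity>" for k
  proof -
    have "emeasure m (B k) \<le> emeasure m (U k \<times> {1 / real (Suc k)..}) + emeasure m (UNIV \<times> {..0})"
      unfolding B_def by (intro emeasure_subadditive) auto
    also have "\<dots> < \<infinity>" using large_finite[of "U k" "1 / real (Suc k)"] U(4) null by simp
    finally show ?thesis by simp
  qed
  moreover have "(x, s) \<in> (\<Union>k. B k)" for x s
  proof (cases "0 < s")
    case True
    obtain i where i: "x \<in> U i" using U(3) by blast
    obtain j where j: "inverse (real (Suc j)) < s" using reals_Archimedean[OF True] by blast
    have "x \<in> U (max i j)" using i incseqD[OF U(2), of i "max i j"] by auto
    moreover have "1 / real (Suc (max i j)) \<le> 1 / real (Suc j)" by (intro divide_left_mono) auto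
    ultimately show ?thesis using j by (intro UN_I[of "max i j"]) (auto simp: B_def inverse_eq_divide)
  qed (auto simp: B_def)
  then have "(\<Union>k. B k) = UNIV" by auto
  ultimately show ?thesis
    using Bm by (intro sigma_finite_measure.intro exI[of _ "range B"]) auto
qed

text \<open>
  Off the compact set where \<open>\<theta> \<noteq> 1\<close> the integrand vanishes. On it, marks \<open>s < \<epsilon>\<close> are covered by the
  regularity of \<open>l\<close> with \<open>r = 1 / \<theta>(x)\<close>. For \<open>s \<ge> \<epsilon>\<close> the bound \<open>\<bar>\<rho> - 1\<bar> \<le> \<rho> + 1\<close> suffices: \<open>m\<close> is finite there,
  and so is its dilation \<open>\<rho> m\<close>, because dilation moves marks by a bounded factor only.
\<close>

lemma \<rho>_integrable:
  assumes \<theta>: "\<theta> \<in> pos_multipliers"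
  shows "(\<integral>\<^sup>+z. ennreal \<bar>\<rho> \<theta> z - 1\<bar> \<partial>m) < \<infinity>"
proof -
  note \<theta>m[measurable] = pos_multipliers_measurable[OF \<theta>] and pos = pos_multipliers_pos[OF \<theta>]
  obtain K where K: "compact K" "\<And>x. x \<notin> K \<Longrightarrow> \<theta> x = 1" using \<theta> by (auto simp: pos_multipliers_def)
  obtain n :: nat where n: "n \<ge> 1" "\<And>x. 1 / real n \<le> \<theta> x" "\<And>x. \<theta> x \<le> real n"
    using pos_multipliers_bounds[OF \<theta>] by blast
  obtain \<epsilon> where \<epsilon>: "0 < \<epsilon>" "\<And>A. A\<in>bounded_borel Y \<Longrightarrow>
      (\<integral>\<^sup>+x\<in>A. (SUP r\<in>{1 / real n..real n}.
         \<integral>\<^sup>+s\<in>{0<..<\<epsilon>}. ennreal (\<bar>l x (r * s) - l x s\<bar> / s) \<partial>lborel) \<partial>\<sigma>) < \<infinity>"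
    using l_regular[OF n(1)] by blast
  have Kb[measurable]: "K \<in> sets borel" using K(1) by (intro borel_closed compact_imp_closed)
  have cK: "closure K = K" using K(1) by (intro closure_closed compact_imp_closed)
  have "closure (K \<inter> Y) \<subseteq> K" using K(1) by (intro closure_minimal compact_imp_closed) auto
  then have "compact (closure (K \<inter> Y))" using K(1) by (metis closed_Int_compact closed_closure inf.absorb1)
  then have KY: "K \<inter> Y \<in> bounded_borel Y" by (auto simp: bounded_borel_def)
  have r: "inverse (\<theta> x) \<in> {1 / real n..real n}" for x
    using n(1) n(2,3)[of x] pos[of x] by (auto simp: field_simps)
  let ?F1 = "\<lambda>z. ennreal \<bar>\<rho> \<theta> z - 1\<bar> * indicator (K \<times> {0<..<\<epsilon>}) z"
  let ?F2 = "\<lambda>z. indicator (K \<times> {\<epsilon>..}) z :: ennreal"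
  have [measurable]: "K \<times> {0<..<\<epsilon>} \<in> sets (borel \<Otimes>\<^sub>M borel)" "K \<times> {\<epsilon>..} \<in> sets (borel \<Otimes>\<^sub>M borel)"
    by (auto intro!: set_times_measurable)
  \<comment> \<open>Small marks go to \<open>?F1\<close>, large marks to \<open>?F2\<close>.\<close>
  have "(\<integral>\<^sup>+z. ennreal \<bar>\<rho> \<theta> z - 1\<bar> \<partial>m) \<le> (\<integral>\<^sup>+z. ?F1 z + (ennreal (\<rho> \<theta> z) * ?F2 z + ?F2 z) \<partial>m)"
  proof (rule nn_integral_mono_AE)
    show "AE z in m. ennreal \<bar>\<rho> \<theta> z - 1\<bar> \<le> ?F1 z + (ennreal (\<rho> \<theta> z) * ?F2 z + ?F2 z)"
      using AE_m
    proof eventually_elim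
      case (elim z)
      show ?case
      proof (cases "fst z \<in> K")
        case True
        show ?thesis
        proof (cases "snd z < \<epsilon>")
          case True
          then show ?thesis using elim \<open>fst z \<in> K\<close> by (auto simp: indicator_def mem_Times_iff)
        next
          case False
          have "ennreal \<bar>\<rho> \<theta> z - 1\<bar> \<le> ennreal (\<rho> \<theta> z + 1)"
            using \<rho>_nonneg[of \<theta> z] by (intro ennreal_leI) linarith
          then show ?thesis using False \<open>fst z \<in> K\<close> by (auto simp: indicator_def mem_Times_iff)
        qed
      next
        case False
        then have "\<rho> \<theta> z = 1"
          using elim L_pos[of "fst z" "snd z"] K(2)[OF False] by (simp add: \<rho>_def)
        then show ?thesis by simp
      qed
    qed
  qed
  also have "\<dots> = (\<integral>\<^sup>+z. ?F1 z \<partial>m) + ((\<integral>\<^sup>+z. ennreal (\<rho> \<theta> z) * ?F2 z \<partial>m) + (\<integral>\<^sup>+z. ?F2 z \<partial>m))"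
    by (simp add: nn_integral_add)
  also have "\<dots> < \<infinity>"
  proof -
    have 2: "(\<integral>\<^sup>+z. ?F2 z \<partial>m) < \<infinity>"
      using large_finite[OF Kb _ \<epsilon>(1)] K(1) cK by simp
    have "(\<integral>\<^sup>+z. ennreal (\<rho> \<theta> z) * ?F2 z \<partial>m) = (\<integral>\<^sup>+z. ?F2 (fst z, snd z * \<theta> (fst z)) \<partial>m)"
      by (rule nn_integral_rescaled[symmetric]) (use pos in measurable)
    also have "\<dots> \<le> (\<integral>\<^sup>+z. indicator (K \<times> {\<epsilon> / real n..}) z \<partial>m)"
    proof (rule nn_integral_mono_AE)
      show "AE z in m. ?F2 (fst z, snd z * \<theta> (fst z)) \<le> indicator (K \<times> {\<epsilon> / real n..}) z"
        using AE_m
      proof eventually_elim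
        case (elim z)
        have "\<epsilon> / real n \<le> snd z" if "\<epsilon> \<le> snd z * \<theta> (fst z)"
        proof -
          have "\<epsilon> \<le> snd z * real n" using that elim n(3)[of "fst z"]
            by (intro order_trans[OF that] mult_left_mono) auto
          then show ?thesis using n(1) by (simp add: field_simps)
        qed
        then show ?case by (auto simp: indicator_def mem_Times_iff)
      qed
    qed
    also have "\<dots> = emeasure m (K \<times> {\<epsilon> / real n..})"
      by (rule nn_integral_indicator) (auto intro!: set_times_measurable)
    also have "\<dots> < \<infinity>"
      using large_finite[OF Kb _, of "\<epsilon> / real n"] \<epsilon>(1) n(1) K(1) cK by simp
    finally have 3: "(\<integral>\<^sup>+z. ennreal (\<rho> \<theta> z) * ?F2 z \<partial>m) < \<infinity>" .
    have "(\<integral>\<^sup>+z. ?F1 z \<partial>m) = (\<integral>\<^sup>+x. \<integral>\<^sup>+s. ennreal (L x s / s) * ?F1 (x, s) \<partial>lborel \<partial>\<sigma>)"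
      by (rule nn_integral_m) measurable
    also have "\<dots> \<le> (\<integral>\<^sup>+x\<in>K \<inter> Y. (SUP r\<in>{1 / real n..real n}.
         \<integral>\<^sup>+s\<in>{0<..<\<epsilon>}. ennreal (\<bar>l x (r * s) - l x s\<bar> / s) \<partial>lborel) \<partial>\<sigma>)"
    proof (rule nn_integral_mono)
      fix x
      show "(\<integral>\<^sup>+s. ennreal (L x s / s) * ?F1 (x, s) \<partial>lborel) \<le> (SUP r\<in>{1 / real n..real n}.
         \<integral>\<^sup>+s\<in>{0<..<\<epsilon>}. ennreal (\<bar>l x (r * s) - l x s\<bar> / s) \<partial>lborel) * indicator (K \<inter> Y) x"
      proof (cases "x \<in> K \<inter> Y")
        case False
        have "(\<integral>\<^sup>+s. ennreal (L x s / s) * ?F1 (x, s) \<partial>lborel) = 0"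
          by (intro nn_integral_zero' AE_I2) (use False in \<open>auto simp: L_zero\<close>)
        then show ?thesis by simp
      next
        case True
        have "(\<integral>\<^sup>+s. ennreal (L x s / s) * ?F1 (x, s) \<partial>lborel) =
           (\<integral>\<^sup>+s\<in>{0<..<\<epsilon>}. ennreal (\<bar>l x (inverse (\<theta> x) * s) - l x s\<bar> / s) \<partial>lborel)"
        proof (intro nn_integral_cong)
          fix s :: real
          show "ennreal (L x s / s) * ?F1 (x, s) =
            ennreal (\<bar>l x (inverse (\<theta> x) * s) - l x s\<bar> / s) * indicator {0<..<\<epsilon>} s"
          proof (cases "s \<in> {0<..<\<epsilon>}")
            case s: True
            then have s0: "0 < s" by simp
            have i: "0 < inverse (\<theta> x) * s" using s0 pos[of x] by simp
            have "L x s / s * \<bar>\<rho> \<theta> (x, s) - 1\<bar> = \<bar>L x s * (\<rho> \<theta> (x, s) - 1)\<bar> / s"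
              by (simp add: abs_mult)
            also have "L x s * (\<rho> \<theta> (x, s) - 1) = \<rho> \<theta> (x, s) * L x s - L x s"
              by (simp add: algebra_simps)
            also have "\<dots> = L x (inverse (\<theta> x) * s) - L x s"
              by (simp only: \<rho>_mult_L[of \<theta> x s, OF pos])
            also have "\<dots> = l x (inverse (\<theta> x) * s) - l x s" using s0 i by (simp add: L_def)
            finally show ?thesis using s True s0 by (simp add: ennreal_mult[symmetric])
          qed auto
        qed
        also have "\<dots> \<le> (SUP r\<in>{1 / real n..real n}.
           \<integral>\<^sup>+s\<in>{0<..<\<epsilon>}. ennreal (\<bar>l x (r * s) - l x s\<bar> / s) \<partial>lborel)"
          by (rule SUP_upper[OF r])
        finally show ?thesis using True by simp
      qed
    qed
    also have "\<dots> < \<infinity>" by (rule \<epsilon>(2)[OF KY])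
    finally show ?thesis using 2 3 by simp
  qed
  finally show ?thesis .
qed

end

context levy_regular
begin

lemma integral_m_cong_levy:
  fixes F :: "'a \<times> real \<Rightarrow> complex"
  assumes "F \<in> borel_measurable (borel \<Otimes>\<^sub>M borel)"
  shows "(\<integral>z. F z \<partial>m) = (\<integral>z. F z \<partial>levy_measure \<sigma> l)"
  unfolding m_def using assms by (intro integral_distr id_measurable_levy)

text \<open>
  Because \<open>\<bar>exp (i t) - 1\<bar> \<le> min \<bar>t\<bar> 2\<close> and \<open>min s 1\<close> is integrable over the support of \<open>f\<close>.
\<close>

lemma iexp_minus_1_integrable:
  assumes f: "f \<in> cont_compact_support"
  shows "integrable m (\<lambda>z. iexp (snd z * f (fst z)) - 1)"
proof -
  have [measurable]: "f \<in> borel_measurable borel" by (rule cont_compact_support_measurable[OF f])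
  obtain K where K: "compact K" "continuous_on UNIV f" "\<And>x. x \<notin> K \<Longrightarrow> f x = 0"
    using cont_compact_supportD[OF f] by blast
  obtain B where B: "0 < B" "\<And>x. \<bar>f x\<bar> \<le> B" using cont_compact_support_bounded[OF f] by blast
  have Kb[measurable]: "K \<in> sets borel" using K(1) by (intro borel_closed compact_imp_closed)
  have cK: "closure K = K" using K(1) by (intro closure_closed compact_imp_closed)
  have bd: "ennreal (norm (iexp (snd z * f (fst z)) - 1)) \<le>
      ennreal (max B 2) * (indicator K (fst z) * ennreal (min (snd z) 1))" if "0 < snd z" for z
  proof (cases "fst z \<in> K")
    case True
    have 1: "norm (iexp (snd z * f (fst z)) - 1) \<le> \<bar>snd z * f (fst z)\<bar>"
      using iexp_approx1[of "snd z * f (fst z)" 0] by simp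
    have 2: "norm (iexp (snd z * f (fst z)) - 1) \<le> 2"
      using norm_triangle_ineq4[of "iexp (snd z * f (fst z))" 1] by (simp add: norm_exp_i_times)
    have "norm (iexp (snd z * f (fst z)) - 1) \<le> max B 2 * min (snd z) 1"
    proof (cases "snd z \<le> 1")
      case True
      have "\<bar>snd z * f (fst z)\<bar> \<le> snd z * B"
        using B(2)[of "fst z"] that by (simp add: abs_mult mult_left_mono)
      also have "\<dots> \<le> snd z * max B 2" using that by (intro mult_left_mono) auto
      finally show ?thesis using 1 True by (simp add: mult.commute)
    next
      case False
      then show ?thesis using 2 by simp
    qed
    then have "ennreal (norm (iexp (snd z * f (fst z)) - 1)) \<le> ennreal (max B 2 * min (snd z) 1)"
      by (rule ennreal_leI)
    also have "\<dots> = ennreal (max B 2) * ennreal (min (snd z) 1)"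
      using that B(1) by (intro ennreal_mult) auto
    finally show ?thesis using True by simp
  next
    case False
    then show ?thesis using K(3)[of "fst z"] by simp
  qed
  show ?thesis
  proof (rule integrableI_bounded)
    have "(\<integral>\<^sup>+z. ennreal (norm (iexp (snd z * f (fst z)) - 1)) \<partial>m) \<le>
      (\<integral>\<^sup>+z. ennreal (max B 2) * (indicator K (fst z) * ennreal (min (snd z) 1)) \<partial>m)"
    proof (rule nn_integral_mono_AE)
      show "AE z in m. ennreal (norm (iexp (snd z * f (fst z)) - 1)) \<le>
          ennreal (max B 2) * (indicator K (fst z) * ennreal (min (snd z) 1))"
        using AE_m
      proof eventually_elim
        case (elim z)
        from bd[of z] elim show ?case by simp
      qed
    qed
    also have "\<dots> = ennreal (max B 2) * (\<integral>\<^sup>+z. indicator K (fst z) * ennreal (min (snd z) 1) \<partial>m)"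
      by (rule nn_integral_cmult) measurable
    also have "\<dots> < \<infinity>"
      using min_integrable[OF Kb] K(1) cK by (simp add: ennreal_mult_less_top)
    finally show "(\<integral>\<^sup>+z. ennreal (norm (iexp (snd z * f (fst z)) - 1)) \<partial>m) < \<infinity>" .
  qed measurable
qed

lemma integral_rescaled:
  assumes \<theta>: "\<theta> \<in> pos_multipliers" and [measurable]: "F \<in> borel_measurable (borel \<Otimes>\<^sub>M borel)"
  shows "(\<integral>z. F (fst z, snd z * \<theta> (fst z)) \<partial>m) = (\<integral>z. \<rho> \<theta> z *\<^sub>R (F z :: complex) \<partial>m)"
proof -
  note [measurable] = pos_multipliers_measurable[OF \<theta>] and pos = pos_multipliers_pos[OF \<theta>]
  have "(\<integral>z. F (fst z, snd z * \<theta> (fst z)) \<partial>m) =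
      (\<integral>z. F z \<partial>distr m (borel \<Otimes>\<^sub>M borel) (\<lambda>z. (fst z, snd z * \<theta> (fst z))))"
    by (rule integral_distr[symmetric]) measurable
  also have "\<dots> = (\<integral>z. F z \<partial>density m (\<lambda>z. ennreal (\<rho> \<theta> z)))"
    using pos by (subst distr_rescaled) auto
  also have "\<dots> = (\<integral>z. \<rho> \<theta> z *\<^sub>R F z \<partial>m)"
    by (rule integral_density) auto
  finally show ?thesis .
qed

lemma \<rho>_minus_1_integrable:
  assumes \<theta>: "\<theta> \<in> pos_multipliers"
  shows "integrable m (\<lambda>z. \<rho> \<theta> z - 1)"
proof -
  note [measurable] = pos_multipliers_measurable[OF \<theta>]
  show ?thesis
    using \<rho>_integrable[OF \<theta>] by (intro integrableI_bounded) auto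
qed

text \<open>
  Fubini for the product that defines the Levy measure; it applies because \<open>\<rho> - 1\<close> is integrable.
\<close>

lemma compensator_eq:
  assumes \<theta>: "\<theta> \<in> pos_multipliers"
  shows "(LINT x:Y|\<sigma>. LINT s:{0<..}|lborel. (l x s - l x (inverse (\<theta> x) * s)) / s) = - (\<integral>z. \<rho> \<theta> z - 1 \<partial>m)"
proof -
  note \<theta>m[measurable] = pos_multipliers_measurable[OF \<theta>] and pos = pos_multipliers_pos[OF \<theta>]
  interpret lp: sigma_finite_measure lborel_pos by (rule sigma_finite_lborel_pos)
  interpret sg: sigma_finite_measure \<sigma> by (rule sigma_finite_radon[OF loc_compact radon])
  interpret pair_sigma_finite \<sigma> lborel_pos ..
  have d[measurable]: "(\<lambda>z. L (fst z) (snd z) / snd z) \<in> borel_measurable (\<sigma> \<Otimes>\<^sub>M lborel_pos)"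
    by (rule measurable_compose[OF id_measurable]) measurable
  have r[measurable]: "(\<lambda>z. \<rho> \<theta> z - 1) \<in> borel_measurable (\<sigma> \<Otimes>\<^sub>M lborel_pos)"
    by (rule measurable_compose[OF id_measurable]) measurable
  have d0: "AE z in \<sigma> \<Otimes>\<^sub>M lborel_pos. 0 \<le> L (fst z) (snd z) / snd z"
    by (rule AE_I2) (auto simp: space_pair_measure)
  have "integrable (levy_measure \<sigma> l) (\<lambda>z. \<rho> \<theta> z - 1)"
    using \<rho>_minus_1_integrable[OF \<theta>] unfolding m_def
    by (subst (asm) integrable_distr_eq[OF id_measurable_levy]) auto
  then have int: "integrable (\<sigma> \<Otimes>\<^sub>M lborel_pos) (\<lambda>z. (L (fst z) (snd z) / snd z) *\<^sub>R (\<rho> \<theta> z - 1))"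
    unfolding levy_density_cong by (subst (asm) integrable_density[OF r d d0])
  have "(\<integral>z. \<rho> \<theta> z - 1 \<partial>m) = (\<integral>z. \<rho> \<theta> z - 1 \<partial>levy_measure \<sigma> l)"
    unfolding m_def by (intro integral_distr id_measurable_levy) measurable
  also have "\<dots> = (\<integral>z. (L (fst z) (snd z) / snd z) *\<^sub>R (\<rho> \<theta> z - 1) \<partial>(\<sigma> \<Otimes>\<^sub>M lborel_pos))"
    unfolding levy_density_cong by (rule integral_density[OF r d d0])
  also have "\<dots> = (\<integral>x. \<integral>s. (L x s / s) *\<^sub>R (\<rho> \<theta> (x, s) - 1) \<partial>lborel_pos \<partial>\<sigma>)"
    using integral_fst'[OF int] by simp
  also have "\<dots> = - (LINT x:Y|\<sigma>. LINT s:{0<..}|lborel. (l x s - l x (inverse (\<theta> x) * s)) / s)"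
    unfolding set_lebesgue_integral_def integral_minus[symmetric]
  proof (intro Bochner_Integration.integral_cong refl)
    fix x
    have ps: "{0<..} \<inter> space lborel \<in> sets (lborel :: real measure)" by simp
    have "(\<integral>s. (L x s / s) *\<^sub>R (\<rho> \<theta> (x, s) - 1) \<partial>lborel_pos) =
        (\<integral>s. indicator {0<..} s *\<^sub>R ((L x s / s) *\<^sub>R (\<rho> \<theta> (x, s) - 1)) \<partial>lborel)"
      unfolding lborel_pos_def by (rule integral_restrict_space[OF ps])
    also have "\<dots> = (\<integral>s. - (indicator Y x *\<^sub>R indicator {0<..} s *\<^sub>R ((l x s - l x (inverse (\<theta> x) * s)) / s)) \<partial>lborel)"
    proof (intro Bochner_Integration.integral_cong refl)
      fix s :: real
      show "indicator {0<..} s *\<^sub>R ((L x s / s) *\<^sub>R (\<rho> \<theta> (x, s) - 1)) =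
        - (indicator Y x *\<^sub>R indicator {0<..} s *\<^sub>R ((l x s - l x (inverse (\<theta> x) * s)) / s))"
      proof (cases "0 < s \<and> x \<in> Y")
        case True
        then have s0: "0 < s" by simp
        have i: "0 < inverse (\<theta> x) * s" using s0 pos[of x] by simp
        have "L x s / s * (\<rho> \<theta> (x, s) - 1) = (\<rho> \<theta> (x, s) * L x s - L x s) / s"
          by (simp add: algebra_simps diff_divide_distrib)
        also have "\<dots> = - ((l x s - l x (inverse (\<theta> x) * s)) / s)"
          using s0 i by (simp only: \<rho>_mult_L[of \<theta> x s, OF pos]) (simp add: L_def diff_divide_distrib)
        finally show ?thesis using True by simp
      qed (auto simp: L_zero)
    qed
    also have "\<dots> = - (indicator Y x *\<^sub>R (\<integral>s. indicator {0<..} s *\<^sub>R ((l x s - l x (inverse (\<theta> x) * s)) / s) \<partial>lborel))"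
      by (simp only: integral_minus integral_scaleR_right)
    finally show "(\<integral>s. (L x s / s) *\<^sub>R (\<rho> \<theta> (x, s) - 1) \<partial>lborel_pos) =
       - (indicator Y x *\<^sub>R (\<integral>s. indicator {0<..} s *\<^sub>R ((l x s - l x (inverse (\<theta> x) * s)) / s) \<partial>lborel))" .
  qed
  finally show ?thesis by simp
qed

end

lemma (in poisson_construction) nn_integral_config_points:
  assumes [measurable]: "F \<in> borel_measurable m"
  shows "(\<integral>\<^sup>+z. F z \<partial>config \<omega>) = (\<integral>\<^sup>+p. F (snd \<omega> p) \<partial>count_space (active \<omega>))"
  unfolding config_def by (subst nn_integral_distr) auto

lemma (in poisson_construction) integral_config_points:
  fixes F :: "'b \<Rightarrow> 'c :: {banach, second_countable_topology}"
  assumes [measurable]: "F \<in> borel_measurable m"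
  shows "(\<integral>z. F z \<partial>config \<omega>) = (\<integral>p. F (snd \<omega> p) \<partial>count_space (active \<omega>))"
    and "integrable (config \<omega>) F \<longleftrightarrow> integrable (count_space (active \<omega>)) (\<lambda>p. F (snd \<omega> p))"
  unfolding config_def by (simp_all add: integral_distr integrable_distr_eq)

lemma (in levy_regular) poisson_construction_exists:
  obtains S where "poisson_construction m S"
proof -
  interpret sigma_finite_measure m by (rule sigma_finite_m)
  show thesis
  proof (rule sigma_finite_disjoint)
    fix S :: "nat \<Rightarrow> ('a \<times> real) set"
    assume "range S \<subseteq> sets m" "(\<Union>i. S i) = space m" "\<And>i. emeasure m (S i) \<noteq> \<infinity>" "disjoint_family S"
    then have "poisson_construction m S" by unfold_locales auto
    then show thesis by (rule that)
  qed
qed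

section \<open>The logarithm of the density as a measurable functional\<close>

text \<open>
  Division by the mass makes the integral against \<open>\<eta>\<close> a plain sum of log-ratios over the atoms. Where
  \<open>\<eta>\<close> has no atom the value is \<open>0\<close>, since \<open>inverse 0 = 0\<close>.
\<close>

definition log_ratio_integrand :: "('a \<Rightarrow> real \<Rightarrow> real) \<Rightarrow> ('a \<Rightarrow> real) \<Rightarrow> 'a measure \<Rightarrow> 'a \<Rightarrow> real" where
  "log_ratio_integrand l \<theta> \<eta> x =
    ln (l x (inverse (\<theta> x) * measure \<eta> {x}) / l x (measure \<eta> {x})) * inverse (measure \<eta> {x})"

context levy_density
begin

lemma log_ratio_integrand_eq:
  assumes "0 < \<theta> x"
  shows "log_ratio_integrand l \<theta> \<eta> x = ln (\<rho> \<theta> (x, measure \<eta> {x})) * inverse (measure \<eta> {x})"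
proof (cases "measure \<eta> {x} = 0")
  case False
  then have "0 < measure \<eta> {x}" by (simp add: zero_less_measure_iff)
  then show ?thesis using assms by (simp add: log_ratio_integrand_def \<rho>_def L_def)
qed (simp add: log_ratio_integrand_def)

lemma log_ratio_integrand_measurable:
  assumes \<theta>[measurable]: "\<theta> \<in> borel_measurable borel" and pos: "\<And>x. 0 < \<theta> x"
  shows "(\<lambda>(\<eta>, x). indicator Y x *\<^sub>R log_ratio_integrand l \<theta> \<eta> x) \<in> borel_measurable (discrete_radon_space \<Otimes>\<^sub>M borel)"
proof -
  have e: "(\<lambda>w. emeasure (fst w) {snd w}) \<in> borel_measurable (discrete_radon_space \<Otimes>\<^sub>M (borel :: 'a measure))"
    using measurable_atom_mass[OF loc_compact] by (simp add: case_prod_beta')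
  then have [measurable]: "(\<lambda>w. measure (fst w) {snd w}) \<in> borel_measurable (discrete_radon_space \<Otimes>\<^sub>M (borel :: 'a measure))"
    unfolding measure_def by measurable
  have "(\<lambda>w. indicator Y (snd w) *\<^sub>R (ln (\<rho> \<theta> (snd w, measure (fst w) {snd w})) * inverse (measure (fst w) {snd w})))
     \<in> borel_measurable (discrete_radon_space \<Otimes>\<^sub>M (borel :: 'a measure))"
    by measurable
  then show ?thesis using pos by (simp add: log_ratio_integrand_eq case_prod_beta')
qed

lemma log_ratio_integrand_section:
  assumes "\<theta> \<in> borel_measurable borel" "\<And>x. 0 < \<theta> x" "\<eta> \<in> discrete_radon_measures"
  shows "(\<lambda>x. indicator Y x *\<^sub>R log_ratio_integrand l \<theta> \<eta> x) \<in> borel_measurable borel"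
  using measurable_compose[OF measurable_Pair1' log_ratio_integrand_measurable[OF assms(1,2)], of \<eta>] assms(3)
  by (simp add: space_discrete_radon_space)

lemma set_integrable_log_ratio_iff:
  assumes "\<theta> \<in> borel_measurable borel" "\<And>x. 0 < \<theta> x" "\<eta> \<in> discrete_radon_measures"
  shows "set_integrable \<eta> Y (log_ratio_integrand l \<theta> \<eta>) \<longleftrightarrow>
    (\<integral>\<^sup>+x. ennreal \<bar>indicator Y x *\<^sub>R log_ratio_integrand l \<theta> \<eta> x\<bar> \<partial>\<eta>) < \<infinity>"
proof -
  have "sets \<eta> = sets borel" using assms(3) by (auto simp: discrete_radon_measures_def radon_measures_def)
  then show ?thesis using log_ratio_integrand_section[OF assms]
    unfolding set_integrable_def integrable_iff_bounded by (simp cong: measurable_cong_sets)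
qed

lemma measurable_abs_log_ratio_integral:
  assumes "\<theta> \<in> borel_measurable borel" "\<And>x. 0 < \<theta> x"
  shows "(\<lambda>\<eta>. \<integral>\<^sup>+x. ennreal \<bar>indicator Y x *\<^sub>R log_ratio_integrand l \<theta> \<eta> x\<bar> \<partial>\<eta>) \<in> borel_measurable discrete_radon_space"
proof (rule measurable_nn_integral_discrete_radon[OF loc_compact measurable_ident_sets[OF refl]])
  show "(\<lambda>(\<eta>, x). ennreal \<bar>indicator Y x *\<^sub>R log_ratio_integrand l \<theta> \<eta> x\<bar>) \<in> borel_measurable (discrete_radon_space \<Otimes>\<^sub>M borel)"
    using measurable_compose[OF log_ratio_integrand_measurable[OF assms], of "\<lambda>x. ennreal \<bar>x\<bar>" borel]
    by (simp add: case_prod_beta')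
qed

text \<open>
  The integral has the default value \<open>0\<close> where the integrand is not integrable, so the set of
  integrability has to be shown measurable as well.
\<close>

lemma measurable_log_ratio_integral:
  assumes "\<theta> \<in> borel_measurable borel" "\<And>x. 0 < \<theta> x"
  shows "(\<lambda>\<eta>. LINT x:Y|\<eta>. log_ratio_integrand l \<theta> \<eta> x) \<in> borel_measurable discrete_radon_space"
proof -
  let ?J = "\<lambda>\<eta> x. indicator Y x *\<^sub>R log_ratio_integrand l \<theta> \<eta> x"
  have pm: "(\<lambda>\<eta>. \<integral>\<^sup>+x. ennreal (c * ?J \<eta> x) \<partial>\<eta>) \<in> borel_measurable discrete_radon_space" for c :: real
  proof (rule measurable_nn_integral_discrete_radon[OF loc_compact measurable_ident_sets[OF refl]])
    show "(\<lambda>(\<eta>, x). ennreal (c * ?J \<eta> x)) \<in> borel_measurable (discrete_radon_space \<Otimes>\<^sub>M borel)"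
      using measurable_compose[OF log_ratio_integrand_measurable[OF assms], of "\<lambda>x. ennreal (c * x)" borel]
      by (simp add: case_prod_beta')
  qed
  note [measurable] = pm[of 1] pm[of "-1"] measurable_abs_log_ratio_integral[OF assms]
  have "(\<lambda>\<eta>. if (\<integral>\<^sup>+x. ennreal \<bar>?J \<eta> x\<bar> \<partial>\<eta>) < \<infinity> then
     enn2real (\<integral>\<^sup>+x. ennreal (1 * ?J \<eta> x) \<partial>\<eta>) - enn2real (\<integral>\<^sup>+x. ennreal (-1 * ?J \<eta> x) \<partial>\<eta>) else 0)
     \<in> borel_measurable discrete_radon_space"
    by measurable
  moreover have "(LINT x:Y|\<eta>. log_ratio_integrand l \<theta> \<eta> x) =
     (if (\<integral>\<^sup>+x. ennreal \<bar>?J \<eta> x\<bar> \<partial>\<eta>) < \<infinity> then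
     enn2real (\<integral>\<^sup>+x. ennreal (1 * ?J \<eta> x) \<partial>\<eta>) - enn2real (\<integral>\<^sup>+x. ennreal (-1 * ?J \<eta> x) \<partial>\<eta>) else 0)"
    if "\<eta> \<in> space discrete_radon_space" for \<eta>
  proof -
    have \<eta>: "\<eta> \<in> discrete_radon_measures" using that by (simp add: space_discrete_radon_space)
    note iff = set_integrable_log_ratio_iff[OF assms \<eta>]
    show ?thesis
    proof (cases "set_integrable \<eta> Y (log_ratio_integrand l \<theta> \<eta>)")
      case True
      then show ?thesis using iff
        by (simp add: set_integrable_def set_lebesgue_integral_def real_lebesgue_integral_def)
    next
      case False
      then show ?thesis using iff
        by (simp add: set_integrable_def set_lebesgue_integral_def not_integrable_integral_eq)
    qed
  qed
  ultimately show ?thesis by (subst measurable_cong)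
qed

end

section \<open>The completely random measure as a sum over Poisson points\<close>

locale crm_construction = levy_regular \<sigma> l + P: poisson_construction "levy_density.m \<sigma> l" S
  for \<sigma> :: "'a::polish_space measure" and l S
begin

text \<open>
  The random measure \<open>\<Sum> s \<delta>\<^sub>x\<close> over the points \<open>(x, s)\<close> of the configuration.
\<close>

definition sum_measure :: "(nat \<Rightarrow> nat) \<times> (nat \<times> nat \<Rightarrow> 'a \<times> real) \<Rightarrow> 'a measure" where
  "sum_measure \<omega> = distr (density (P.config \<omega>) (\<lambda>z. ennreal (snd z))) borel fst"

text \<open>
  The almost sure properties under which the configuration can be recovered from its sum measure.
\<close>

definition good :: "(nat \<Rightarrow> nat) \<times> (nat \<times> nat \<Rightarrow> 'a \<times> real) \<Rightarrow> bool" where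
  "good \<omega> \<longleftrightarrow> (\<forall>p\<in>P.active \<omega>. fst (snd \<omega> p) \<in> Y \<and> 0 < snd (snd \<omega> p)) \<and>
     inj_on (\<lambda>p. fst (snd \<omega> p)) (P.active \<omega>) \<and> sum_measure \<omega> \<in> radon_measures"

lemma goodD:
  assumes "good \<omega>"
  shows "p \<in> P.active \<omega> \<Longrightarrow> fst (snd \<omega> p) \<in> Y"
    and "p \<in> P.active \<omega> \<Longrightarrow> 0 < snd (snd \<omega> p)"
    and "inj_on (\<lambda>p. fst (snd \<omega> p)) (P.active \<omega>)"
    and "sum_measure \<omega> \<in> radon_measures"
  using assms by (auto simp: good_def)

lemma sets_sum_measure: "sets (sum_measure \<omega>) = sets borel"
  by (simp add: sum_measure_def)

lemma fst_measurable_config: "fst \<in> measurable (density (P.config \<omega>) g) borel"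
proof -
  have "fst \<in> measurable m borel" by (simp cong: measurable_cong_sets)
  then show ?thesis by (simp cong: measurable_cong_sets)
qed

lemma nn_integral_sum_measure:
  assumes [measurable]: "f \<in> borel_measurable borel"
  shows "(\<integral>\<^sup>+x. f x \<partial>sum_measure \<omega>) =
    (\<integral>\<^sup>+p. ennreal (snd (snd \<omega> p)) * f (fst (snd \<omega> p)) \<partial>count_space (P.active \<omega>))"
proof -
  have "(\<integral>\<^sup>+x. f x \<partial>sum_measure \<omega>) = (\<integral>\<^sup>+z. f (fst z) \<partial>density (P.config \<omega>) (\<lambda>z. ennreal (snd z)))"
    unfolding sum_measure_def by (rule nn_integral_distr[OF fst_measurable_config]) measurable
  also have "\<dots> = (\<integral>\<^sup>+z. ennreal (snd z) * f (fst z) \<partial>P.config \<omega>)"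
    by (rule nn_integral_density) (simp_all cong: measurable_cong_sets)
  also have "\<dots> = (\<integral>\<^sup>+p. ennreal (snd (snd \<omega> p)) * f (fst (snd \<omega> p)) \<partial>count_space (P.active \<omega>))"
    by (rule P.nn_integral_config_points) measurable
  finally show ?thesis .
qed

lemma integral_sum_measure:
  fixes f :: "'a \<Rightarrow> real"
  assumes [measurable]: "f \<in> borel_measurable borel" and good: "good \<omega>"
  shows "(LINT x|sum_measure \<omega>. f x) = (LINT p|count_space (P.active \<omega>). snd (snd \<omega> p) * f (fst (snd \<omega> p)))"
    and "integrable (sum_measure \<omega>) f \<longleftrightarrow> integrable (count_space (P.active \<omega>)) (\<lambda>p. snd (snd \<omega> p) * f (fst (snd \<omega> p)))"
proof -
  have m1: "(\<lambda>z. f (fst z)) \<in> borel_measurable (P.config \<omega>)"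
    and m2: "snd \<in> borel_measurable (P.config \<omega>)"
    and m3: "(\<lambda>z. snd z *\<^sub>R f (fst z)) \<in> borel_measurable m"
    by (simp_all cong: measurable_cong_sets)
  have "AE z in P.config \<omega>. 0 \<le> snd z"
  proof -
    have "{z \<in> space m. 0 \<le> snd z} \<in> sets m"
    proof -
      have "{z \<in> space (borel \<Otimes>\<^sub>M borel). 0 \<le> snd (z :: 'a \<times> real)} \<in> sets (borel \<Otimes>\<^sub>M borel)"
        by measurable
      then show ?thesis by (simp add: space_pair_measure)
    qed
    then show ?thesis unfolding P.config_def
      using goodD(2)[OF good] by (subst AE_distr_iff) (auto simp: AE_count_space less_imp_le)
  qed
  note d = m1 m2 this
  have "(LINT x|sum_measure \<omega>. f x) = (LINT z|density (P.config \<omega>) (\<lambda>z. ennreal (snd z)). f (fst z))"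
    unfolding sum_measure_def by (rule integral_distr[OF fst_measurable_config]) measurable
  also have "\<dots> = (LINT z|P.config \<omega>. snd z *\<^sub>R f (fst z))" by (rule integral_density[OF d])
  also have "\<dots> = (LINT p|count_space (P.active \<omega>). snd (snd \<omega> p) *\<^sub>R f (fst (snd \<omega> p)))"
    by (rule P.integral_config_points(1)[OF m3])
  finally show "(LINT x|sum_measure \<omega>. f x) = (LINT p|count_space (P.active \<omega>). snd (snd \<omega> p) * f (fst (snd \<omega> p)))"
    by simp
  have "integrable (sum_measure \<omega>) f \<longleftrightarrow> integrable (density (P.config \<omega>) (\<lambda>z. ennreal (snd z))) (\<lambda>z. f (fst z))"
    unfolding sum_measure_def by (rule integrable_distr_eq[OF fst_measurable_config]) measurable
  also have "\<dots> \<longleftrightarrow> integrable (P.config \<omega>) (\<lambda>z. snd z *\<^sub>R f (fst z))" by (rule integrable_density[OF d])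
  also have "\<dots> \<longleftrightarrow> integrable (count_space (P.active \<omega>)) (\<lambda>p. snd (snd \<omega> p) *\<^sub>R f (fst (snd \<omega> p)))"
    by (rule P.integral_config_points(2)[OF m3])
  finally show "integrable (sum_measure \<omega>) f \<longleftrightarrow> integrable (count_space (P.active \<omega>)) (\<lambda>p. snd (snd \<omega> p) * f (fst (snd \<omega> p)))"
    by simp
qed

text \<open>
  Distinct points have distinct positions, so exactly one point contributes to the mass at \<open>x\<close>.
\<close>

lemma measure_sum_measure_atom:
  assumes good: "good \<omega>" and p: "p \<in> P.active \<omega>"
  shows "measure (sum_measure \<omega>) {fst (snd \<omega> p)} = snd (snd \<omega> p)"
proof -
  have "emeasure (sum_measure \<omega>) {fst (snd \<omega> p)} = (\<integral>\<^sup>+x. indicator {fst (snd \<omega> p)} x \<partial>sum_measure \<omega>)"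
    by (simp add: sets_sum_measure)
  also have "\<dots> = (\<integral>\<^sup>+q. ennreal (snd (snd \<omega> q)) * indicator {fst (snd \<omega> p)} (fst (snd \<omega> q)) \<partial>count_space (P.active \<omega>))"
    by (rule nn_integral_sum_measure) simp
  also have "\<dots> = (\<integral>\<^sup>+q. ennreal (snd (snd \<omega> p)) * indicator {p} q \<partial>count_space (P.active \<omega>))"
  proof (intro nn_integral_cong)
    fix q assume "q \<in> space (count_space (P.active \<omega>))"
    then have "fst (snd \<omega> q) = fst (snd \<omega> p) \<longleftrightarrow> q = p"
      using inj_on_eq_iff[OF goodD(3)[OF good], of q p] p by simp
    then show "ennreal (snd (snd \<omega> q)) * indicator {fst (snd \<omega> p)} (fst (snd \<omega> q)) =
      ennreal (snd (snd \<omega> p)) * indicator {p} q"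
      by (auto simp: indicator_def)
  qed
  also have "\<dots> = ennreal (snd (snd \<omega> p)) * emeasure (count_space (P.active \<omega>)) {p}"
    using p by (intro nn_integral_cmult_indicator) auto
  also have "\<dots> = ennreal (snd (snd \<omega> p))" using p by simp
  finally show ?thesis using goodD(2)[OF good p] by (simp add: measure_def)
qed

lemma sum_measure_discrete:
  assumes good: "good \<omega>"
  shows "sum_measure \<omega> \<in> discrete_radon_measures"
proof (rule discrete_radonI[OF goodD(4)[OF good]])
  let ?A = "(\<lambda>p. fst (snd \<omega> p)) ` P.active \<omega>"
  show c: "countable ?A" by auto
  have "- ?A \<in> sets borel" by (intro borel_comp countable_in_borel c)
  then have "emeasure (sum_measure \<omega>) (- ?A) = (\<integral>\<^sup>+x. indicator (- ?A) x \<partial>sum_measure \<omega>)" by (simp add: sets_sum_measure)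
  also have "\<dots> = (\<integral>\<^sup>+q. ennreal (snd (snd \<omega> q)) * indicator (- ?A) (fst (snd \<omega> q)) \<partial>count_space (P.active \<omega>))"
    using \<open>- ?A \<in> sets borel\<close> by (intro nn_integral_sum_measure) simp
  also have "\<dots> = 0" by (intro nn_integral_zero' AE_I2) auto
  finally show "emeasure (sum_measure \<omega>) (- ?A) = 0" .
qed

text \<open>
  Over a relatively compact set the sum of \<open>min s 1\<close> is almost surely finite, and then only finitely many
  marks exceed \<open>1\<close>. It suffices to treat the countably many sets of an exhaustion.
\<close>

lemma AE_radon_sum_measure: "AE \<omega> in P.\<Omega>. sum_measure \<omega> \<in> radon_measures"
proof -
  obtain U :: "nat \<Rightarrow> 'a set" where U: "\<And>k. open (U k)" "\<And>k. compact (closure (U k))"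
    "\<And>K. compact K \<Longrightarrow> \<exists>k. K \<subseteq> U k"
  proof (rule compact_exhaustion[OF loc_compact])
    fix U :: "nat \<Rightarrow> 'a set" assume "\<And>k. open (U k)" "\<And>k. compact (closure (U k))"
      "\<And>K. compact K \<Longrightarrow> \<exists>k. K \<subseteq> U k"
    then show thesis by (rule that)
  qed
  have Ub[measurable]: "U k \<in> sets borel" for k using U(1) by auto
  define a where "a k z = (indicator (U k) (fst z) * min (snd z) 1 :: real)" for k and z :: "'a \<times> real"
  have a: "ennreal (a k z) = indicator (U k) (fst z) * ennreal (min (snd z) 1)" for k z
    by (simp add: a_def indicator_def)
  have am[measurable]: "a k \<in> borel_measurable m" for k
    unfolding a_def by (simp cong: measurable_cong_sets)
  have "AE \<omega> in P.\<Omega>. (\<integral>\<^sup>+z. ennreal (a k z) \<partial>P.config \<omega>) < \<infinity>" for k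
    using min_integrable[OF Ub U(2)] by (intro P.AE_nn_integral_config_finite am) (simp add: a)
  then have "AE \<omega> in P.\<Omega>. \<forall>k. (\<integral>\<^sup>+z. ennreal (a k z) \<partial>P.config \<omega>) < \<infinity>"
    by (simp add: AE_all_countable)
  then show ?thesis
  proof eventually_elim
    case (elim \<omega>)
    have fin: "emeasure (sum_measure \<omega>) (U k) < \<infinity>" for k
    proof -
      have 1: "(\<integral>\<^sup>+p. ennreal (a k (snd \<omega> p)) \<partial>count_space (P.active \<omega>)) < \<infinity>"
        using elim[rule_format, of k] by (subst (asm) P.nn_integral_config_points) auto
      have "emeasure (sum_measure \<omega>) (U k) = (\<integral>\<^sup>+x. indicator (U k) x \<partial>sum_measure \<omega>)" by (simp add: sets_sum_measure)
      also have "\<dots> = (\<integral>\<^sup>+p. ennreal (snd (snd \<omega> p)) * indicator (U k) (fst (snd \<omega> p)) \<partial>count_space (P.active \<omega>))"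
        by (rule nn_integral_sum_measure) measurable
      also have "\<dots> < \<infinity>"
      proof (rule nn_integral_count_space_finite_transfer[OF 1, where c=1 and C=1])
        fix p assume "ennreal (a k (snd \<omega> p)) < 1"
        then have "a k (snd \<omega> p) < 1" by (simp add: ennreal_less_one_iff)
        then show "ennreal (snd (snd \<omega> p)) * indicator (U k) (fst (snd \<omega> p)) \<le> 1 * ennreal (a k (snd \<omega> p))"
          by (auto simp: a_def indicator_def min_def split: if_splits)
      qed (auto simp: ennreal_mult_less_top indicator_def)
      finally show ?thesis .
    qed
    show ?case
      unfolding radon_measures_def
    proof (intro CollectI conjI allI impI)
      fix K :: "'a set" assume "compact K"
      then obtain k where "K \<subseteq> U k" using U(3) by blast
      then have "emeasure (sum_measure \<omega>) K \<le> emeasure (sum_measure \<omega>) (U k)" by (intro emeasure_mono) (auto simp: sets_sum_measure)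
      then show "emeasure (sum_measure \<omega>) K < \<infinity>" using fin[of k] by (rule le_less_trans)
    qed (rule sets_sum_measure)
  qed
qed

lemma AE_good: "AE \<omega> in P.\<Omega>. good \<omega>"
proof -
  have diag: "{z \<in> space (m \<Otimes>\<^sub>M m). fst (fst z) = fst (snd z)} \<in> sets (m \<Otimes>\<^sub>M m)"
  proof -
    have "{z :: 'a \<times> 'a. fst z = snd z} \<in> sets (borel \<Otimes>\<^sub>M borel)"
      unfolding borel_prod by (intro borel_closed closed_Collect_eq continuous_intros)
    moreover have "(\<lambda>z. (fst (fst z), fst (snd z))) \<in> measurable (m \<Otimes>\<^sub>M m) (borel \<Otimes>\<^sub>M borel)"
    proof -
      have "fst \<in> measurable m borel" by (simp cong: measurable_cong_sets)
      then show ?thesis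
        by (intro measurable_Pair measurable_compose[OF measurable_fst] measurable_compose[OF measurable_snd])
    qed
    ultimately have "(\<lambda>z. (fst (fst z), fst (snd z))) -` {z. fst z = snd z} \<inter> space (m \<Otimes>\<^sub>M m) \<in> sets (m \<Otimes>\<^sub>M m)"
      by (intro measurable_sets)
    moreover have "(\<lambda>z. (fst (fst z), fst (snd z))) -` {z. fst z = snd z} \<inter> space (m \<Otimes>\<^sub>M m) =
        {z \<in> space (m \<Otimes>\<^sub>M m). fst (fst z) = fst (snd z)}" by auto
    ultimately show ?thesis by simp
  qed
  have "AE \<omega> in P.\<Omega>. inj_on (\<lambda>p. fst (snd \<omega> p)) (P.active \<omega>)"
    by (rule P.AE_inj_on_active[OF diag AE_m_fibre])
  moreover have "AE \<omega> in P.\<Omega>. \<forall>p\<in>P.active \<omega>. fst (snd \<omega> p) \<in> Y \<and> 0 < snd (snd \<omega> p)"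
    by (rule P.AE_active_points[OF AE_m])
  ultimately show ?thesis using AE_radon_sum_measure by eventually_elim (simp add: good_def)
qed

definition bad_event :: "((nat \<Rightarrow> nat) \<times> (nat \<times> nat \<Rightarrow> 'a \<times> real)) set" where
  "bad_event = (SOME N. N \<in> null_sets P.\<Omega> \<and> {\<omega> \<in> space P.\<Omega>. \<not> good \<omega>} \<subseteq> N)"

lemma bad_event: "bad_event \<in> null_sets P.\<Omega>" "\<omega> \<in> space P.\<Omega> \<Longrightarrow> \<omega> \<notin> bad_event \<Longrightarrow> good \<omega>"
proof -
  have "\<exists>N. N \<in> null_sets P.\<Omega> \<and> {\<omega> \<in> space P.\<Omega>. \<not> good \<omega>} \<subseteq> N"
    using AE_good by (elim AE_E) (auto intro: null_setsI)
  from someI_ex[OF this] show "bad_event \<in> null_sets P.\<Omega>"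
    "\<omega> \<in> space P.\<Omega> \<Longrightarrow> \<omega> \<notin> bad_event \<Longrightarrow> good \<omega>"
    unfolding bad_event_def[symmetric] by auto
qed

text \<open>
  The sum measure, changed to the zero measure on a null event so that all values are discrete Radon
  measures.
\<close>

definition crm_sample :: "(nat \<Rightarrow> nat) \<times> (nat \<times> nat \<Rightarrow> 'a \<times> real) \<Rightarrow> 'a measure" where
  "crm_sample \<omega> = (if \<omega> \<in> bad_event then null_measure borel else sum_measure \<omega>)"

lemma AE_crm_sample: "AE \<omega> in P.\<Omega>. good \<omega> \<and> crm_sample \<omega> = sum_measure \<omega>"
  using AE_not_in[OF bad_event(1)] AE_good by eventually_elim (simp add: crm_sample_def)

lemma crm_sample_measurable[measurable]: "crm_sample \<in> measurable P.\<Omega> discrete_radon_space"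
proof (rule measurable_into_discrete_radon_space[OF loc_compact])
  fix \<omega> assume \<omega>: "\<omega> \<in> space P.\<Omega>"
  have "null_measure borel \<in> (discrete_radon_measures :: 'a measure set)"
    by (rule discrete_radonI[where T="{}"]) (auto simp: radon_measures_def)
  then show "crm_sample \<omega> \<in> discrete_radon_measures"
    using sum_measure_discrete bad_event(2)[OF \<omega>] by (auto simp: crm_sample_def)
next
  fix g :: "'a \<Rightarrow> real" assume g: "g \<in> cont_compact_support"
  have gm[measurable]: "g \<in> borel_measurable borel" by (rule cont_compact_support_measurable[OF g])
  have hm: "(\<lambda>z. complex_of_real (snd z * g (fst z))) \<in> borel_measurable m"
    by (simp cong: measurable_cong_sets)
  have [measurable]: "bad_event \<in> sets P.\<Omega>" using bad_event(1) by auto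
  have "(\<lambda>\<omega>. if \<omega> \<in> bad_event then 0 else Re (\<integral>z. complex_of_real (snd z * g (fst z)) \<partial>P.config \<omega>)) \<in> borel_measurable P.\<Omega>"
    using P.measurable_integral_config[OF hm] by measurable
  moreover have "(if \<omega> \<in> bad_event then 0 else Re (\<integral>z. complex_of_real (snd z * g (fst z)) \<partial>P.config \<omega>)) = (LINT x|crm_sample \<omega>. g x)"
    if "\<omega> \<in> space P.\<Omega>" for \<omega>
  proof (cases "\<omega> \<in> bad_event")
    case True
    then show ?thesis by (simp add: crm_sample_def)
  next
    case False
    then have "good \<omega>" using bad_event(2)[OF that] by simp
    have "(\<integral>z. complex_of_real (snd z * g (fst z)) \<partial>P.config \<omega>) =
        (\<integral>p. complex_of_real (snd (snd \<omega> p) * g (fst (snd \<omega> p))) \<partial>count_space (P.active \<omega>))"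
      by (rule P.integral_config_points(1)[OF hm])
    also have "\<dots> = complex_of_real (LINT x|sum_measure \<omega>. g x)"
      unfolding integral_sum_measure(1)[OF gm \<open>good \<omega>\<close>] by (rule integral_complex_of_real)
    finally show ?thesis using False by (simp add: crm_sample_def)
  qed
  ultimately show "(\<lambda>\<omega>. LINT x|crm_sample \<omega>. g x) \<in> borel_measurable P.\<Omega>"
    by (subst measurable_cong[symmetric])
qed

text \<open>
  The sum of \<open>\<bar>\<rho> - 1\<bar>\<close> over the points is almost surely finite, and \<open>\<bar>log \<rho>\<bar> \<le> 2 \<bar>\<rho> - 1\<bar>\<close> wherever
  \<open>\<bar>\<rho> - 1\<bar> < 1 / 2\<close>. The finitely many other terms are finite because \<open>\<rho> > 0\<close>.
\<close>

lemma AE_log_ratio_summable: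
  assumes \<theta>: "\<theta> \<in> pos_multipliers"
  shows "AE \<omega> in P.\<Omega>. integrable (count_space (P.active \<omega>)) (\<lambda>p. ln (\<rho> \<theta> (snd \<omega> p)))"
proof -
  note [measurable] = pos_multipliers_measurable[OF \<theta>] and pos = pos_multipliers_pos[OF \<theta>]
  have am[measurable]: "(\<lambda>z. \<bar>\<rho> \<theta> z - 1\<bar>) \<in> borel_measurable m"
    by (simp cong: measurable_cong_sets)
  have "AE \<omega> in P.\<Omega>. (\<integral>\<^sup>+z. ennreal \<bar>\<rho> \<theta> z - 1\<bar> \<partial>P.config \<omega>) < \<infinity>"
    by (rule P.AE_nn_integral_config_finite[OF am \<rho>_integrable[OF \<theta>]])
  with AE_good show ?thesis
  proof eventually_elim
    case (elim \<omega>)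
    have 1: "(\<integral>\<^sup>+p. ennreal \<bar>\<rho> \<theta> (snd \<omega> p) - 1\<bar> \<partial>count_space (P.active \<omega>)) < \<infinity>"
      using elim(2) by (subst (asm) P.nn_integral_config_points) auto
    have "(\<integral>\<^sup>+p. ennreal \<bar>ln (\<rho> \<theta> (snd \<omega> p))\<bar> \<partial>count_space (P.active \<omega>)) < \<infinity>"
    proof (rule nn_integral_count_space_finite_transfer[OF 1, where c="ennreal (1/2)" and C="ennreal 2"])
      fix p assume "p \<in> P.active \<omega>" "ennreal \<bar>\<rho> \<theta> (snd \<omega> p) - 1\<bar> < ennreal (1/2)"
      then have "\<bar>\<rho> \<theta> (snd \<omega> p) - 1\<bar> < 1/2"
        by (simp only: ennreal_less_iff[OF abs_ge_zero])
      then have "\<bar>ln (\<rho> \<theta> (snd \<omega> p))\<bar> \<le> 2 * \<bar>\<rho> \<theta> (snd \<omega> p) - 1\<bar>" by (rule abs_ln_le_of_near_1)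
      then have "ennreal \<bar>ln (\<rho> \<theta> (snd \<omega> p))\<bar> \<le> ennreal (2 * \<bar>\<rho> \<theta> (snd \<omega> p) - 1\<bar>)" by (rule ennreal_leI)
      then show "ennreal \<bar>ln (\<rho> \<theta> (snd \<omega> p))\<bar> \<le> ennreal 2 * ennreal \<bar>\<rho> \<theta> (snd \<omega> p) - 1\<bar>"
        by (simp add: ennreal_mult)
    next
      show "0 < ennreal (1 / 2)" by (subst ennreal_less_zero_iff) simp
    qed auto
    then show ?case by (intro integrableI_bounded) auto
  qed
qed

lemma log_ratio_sum_measure:
  assumes \<theta>: "\<theta> \<in> pos_multipliers" and good: "good \<omega>"
    and sm: "integrable (count_space (P.active \<omega>)) (\<lambda>p. ln (\<rho> \<theta> (snd \<omega> p)))"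
  shows "set_integrable (sum_measure \<omega>) Y (log_ratio_integrand l \<theta> (sum_measure \<omega>))"
    and "(LINT x:Y|sum_measure \<omega>. log_ratio_integrand l \<theta> (sum_measure \<omega>) x) = (LINT p|count_space (P.active \<omega>). ln (\<rho> \<theta> (snd \<omega> p)))"
proof -
  note \<theta>m = pos_multipliers_measurable[OF \<theta>] and pos = pos_multipliers_pos[OF \<theta>]
  let ?J = "\<lambda>x. indicator Y x *\<^sub>R log_ratio_integrand l \<theta> (sum_measure \<omega>) x"
  have Jm: "?J \<in> borel_measurable borel"
    by (rule log_ratio_integrand_section[OF \<theta>m pos sum_measure_discrete[OF good]])
  have eq: "snd (snd \<omega> p) * ?J (fst (snd \<omega> p)) = ln (\<rho> \<theta> (snd \<omega> p))"
    if "p \<in> P.active \<omega>" for p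
    using goodD(1,2)[OF good that] by (simp add: log_ratio_integrand_eq[of \<theta>, OF pos] measure_sum_measure_atom[OF good that])
  show "set_integrable (sum_measure \<omega>) Y (log_ratio_integrand l \<theta> (sum_measure \<omega>))"
    unfolding set_integrable_def integral_sum_measure(2)[OF Jm good]
    by (rule Bochner_Integration.integrable_cong[THEN iffD2, OF refl _ sm]) (simp only: space_count_space eq)
  show "(LINT x:Y|sum_measure \<omega>. log_ratio_integrand l \<theta> (sum_measure \<omega>) x) = (LINT p|count_space (P.active \<omega>). ln (\<rho> \<theta> (snd \<omega> p)))"
    unfolding set_lebesgue_integral_def integral_sum_measure(1)[OF Jm good]
    by (intro Bochner_Integration.integral_cong) (simp_all only: space_count_space eq)
qed

text \<open>
  The exponential formula for \<open>h = log \<rho> + i s f(x)\<close>. Integrability of \<open>exp h - 1\<close> follows from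
  \<open>exp h - 1 = (\<rho> - 1) exp (i s f(x)) + (exp (i s f(x)) - 1)\<close>.
\<close>

lemma exponential_crm_sample:
  assumes \<theta>: "\<theta> \<in> pos_multipliers" and f: "f \<in> cont_compact_support"
  defines "E \<equiv> \<lambda>\<eta>. exp (complex_of_real (LINT x:Y|\<eta>. log_ratio_integrand l \<theta> \<eta> x) + \<i> * complex_of_real (LINT x|\<eta>. f x))"
  shows "integrable P.\<Omega> (\<lambda>\<omega>. E (crm_sample \<omega>))"
    and "(\<integral>\<omega>. E (crm_sample \<omega>) \<partial>P.\<Omega>) = exp (\<integral>z. \<rho> \<theta> z *\<^sub>R iexp (snd z * f (fst z)) - 1 \<partial>m)"
    and "integrable m (\<lambda>z. \<rho> \<theta> z *\<^sub>R (iexp (snd z * f (fst z)) - 1))"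
proof -
  note \<theta>m[measurable] = pos_multipliers_measurable[OF \<theta>] and pos = pos_multipliers_pos[OF \<theta>]
  have fm[measurable]: "f \<in> borel_measurable borel" by (rule cont_compact_support_measurable[OF f])
  define h where "h z = complex_of_real (ln (\<rho> \<theta> z)) + \<i> * complex_of_real (snd z * f (fst z))" for z
  have hm[measurable]: "h \<in> borel_measurable (borel \<Otimes>\<^sub>M borel)" unfolding h_def by measurable
  have hm': "h \<in> borel_measurable m" by (simp cong: measurable_cong_sets)
  have exph: "AE z in m. exp (h z) - 1 = \<rho> \<theta> z *\<^sub>R iexp (snd z * f (fst z)) - 1"
    using AE_m
  proof eventually_elim
    case (elim z)
    then have "0 < \<rho> \<theta> z" using pos by (intro \<rho>_pos) auto
    then show ?case by (simp add: h_def exp_add exp_of_real scaleR_conv_of_real)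
  qed
  have im: "integrable m (\<lambda>z. (\<rho> \<theta> z - 1) *\<^sub>R iexp (snd z * f (fst z)))"
  proof (rule Bochner_Integration.integrable_bound[OF \<rho>_minus_1_integrable[OF \<theta>]])
    show "AE z in m. norm ((\<rho> \<theta> z - 1) *\<^sub>R iexp (snd z * f (fst z))) \<le> norm (\<rho> \<theta> z - 1)"
      by (intro AE_I2) (simp add: norm_exp_i_times)
  qed (simp cong: measurable_cong_sets)
  have e: "(\<rho> \<theta> z - 1) *\<^sub>R iexp (snd z * f (fst z)) + (iexp (snd z * f (fst z)) - 1) =
      \<rho> \<theta> z *\<^sub>R iexp (snd z * f (fst z)) - 1" for z
    by (simp add: algebra_simps)
  have int1: "integrable m (\<lambda>z. \<rho> \<theta> z *\<^sub>R iexp (snd z * f (fst z)) - 1)"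
    using Bochner_Integration.integrable_add[OF im iexp_minus_1_integrable[OF f]] by (simp only: e)
  have "integrable m (\<lambda>z. complex_of_real (\<rho> \<theta> z - 1))"
    by (rule integrable_of_real[OF \<rho>_minus_1_integrable[OF \<theta>]])
  from Bochner_Integration.integrable_diff[OF int1 this]
  show "integrable m (\<lambda>z. \<rho> \<theta> z *\<^sub>R (iexp (snd z * f (fst z)) - 1))"
    by (simp add: algebra_simps scaleR_conv_of_real)
  have int2: "integrable m (\<lambda>z. exp (h z) - 1)"
    using int1 exph by (subst integrable_cong_AE) (simp_all cong: measurable_cong_sets)
  have conf: "AE \<omega> in P.\<Omega>. integrable (P.config \<omega>) h \<and> exp (\<integral>z. h z \<partial>P.config \<omega>) = E (crm_sample \<omega>)"
    using AE_log_ratio_summable[OF \<theta>] AE_crm_sample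
  proof eventually_elim
    case (elim \<omega>)
    then have good: "good \<omega>" and TT: "crm_sample \<omega> = sum_measure \<omega>" by auto
    have i1: "integrable (count_space (P.active \<omega>)) (\<lambda>p. complex_of_real (ln (\<rho> \<theta> (snd \<omega> p))))"
      by (rule integrable_of_real[OF elim(1)])
    have "integrable (sum_measure \<omega>) f" by (rule integrable_radon[OF goodD(4)[OF good] f])
    then have "integrable (count_space (P.active \<omega>)) (\<lambda>p. snd (snd \<omega> p) * f (fst (snd \<omega> p)))"
      unfolding integral_sum_measure(2)[OF fm good] .
    then have i2: "integrable (count_space (P.active \<omega>)) (\<lambda>p. \<i> * complex_of_real (snd (snd \<omega> p) * f (fst (snd \<omega> p))))"
      by (intro integrable_mult_right integrable_of_real)
    have "integrable (P.config \<omega>) h"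
      unfolding P.integral_config_points(2)[OF hm'] unfolding h_def
      by (rule Bochner_Integration.integrable_add[OF i1 i2])
    moreover have "(\<integral>z. h z \<partial>P.config \<omega>) =
        complex_of_real (LINT x:Y|sum_measure \<omega>. log_ratio_integrand l \<theta> (sum_measure \<omega>) x) + \<i> * complex_of_real (LINT x|sum_measure \<omega>. f x)"
      unfolding P.integral_config_points(1)[OF hm'] log_ratio_sum_measure(2)[OF \<theta> good elim(1)] integral_sum_measure(1)[OF fm good]
      unfolding h_def by (subst Bochner_Integration.integral_add[OF i1 i2])
        (simp only: integral_mult_right_zero integral_complex_of_real)
    ultimately show ?case by (simp add: E_def TT)
  qed
  have Em: "E \<in> borel_measurable discrete_radon_space"
    unfolding E_def using measurable_log_ratio_integral[OF \<theta>m pos] integral_measurable_discrete[OF f]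
    by measurable
  have Em'[measurable]: "(\<lambda>\<omega>. E (crm_sample \<omega>)) \<in> borel_measurable P.\<Omega>"
    by (rule measurable_compose[OF crm_sample_measurable Em])
  have conf1: "AE \<omega> in P.\<Omega>. integrable (P.config \<omega>) h" using conf by eventually_elim simp
  have conf2: "AE \<omega> in P.\<Omega>. E (crm_sample \<omega>) = exp (\<integral>z. h z \<partial>P.config \<omega>)" using conf by eventually_elim simp
  have hI[measurable]: "(\<lambda>\<omega>. \<integral>z. h z \<partial>P.config \<omega>) \<in> borel_measurable P.\<Omega>"
    by (rule P.measurable_integral_config[OF hm'])
  show "integrable P.\<Omega> (\<lambda>\<omega>. E (crm_sample \<omega>))"
    using P.exponential_formula(1)[OF hm' int2 conf1] conf2
    by (subst integrable_cong_AE) simp_all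
  have "(\<integral>\<omega>. E (crm_sample \<omega>) \<partial>P.\<Omega>) = (\<integral>\<omega>. exp (\<integral>z. h z \<partial>P.config \<omega>) \<partial>P.\<Omega>)"
    using conf2 by (intro integral_cong_AE) simp_all
  also have "\<dots> = exp (\<integral>z. exp (h z) - 1 \<partial>m)"
    by (rule P.exponential_formula(2)[OF hm' int2 conf1])
  also have "(\<integral>z. exp (h z) - 1 \<partial>m) = (\<integral>z. \<rho> \<theta> z *\<^sub>R iexp (snd z * f (fst z)) - 1 \<partial>m)"
    using exph by (intro integral_cong_AE) (simp_all cong: measurable_cong_sets)
  finally show "(\<integral>\<omega>. E (crm_sample \<omega>) \<partial>P.\<Omega>) = exp (\<integral>z. \<rho> \<theta> z *\<^sub>R iexp (snd z * f (fst z)) - 1 \<partial>m)" .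
qed

text \<open>
  The exponential formula at \<open>\<theta> = 1\<close>, where the log-ratios vanish, yields the Fourier transform that
  characterises \<open>\<mu>\<close>.
\<close>

lemma law_of_completely_random_measure:
  assumes \<mu>: "completely_random_measure (levy_measure \<sigma> l) \<mu>"
  shows "\<mu> = distr P.\<Omega> discrete_radon_space crm_sample"
proof (rule discrete_law_eqI[OF loc_compact])
  show "prob_space \<mu>" "sets \<mu> = sets discrete_radon_space"
    using \<mu> by (auto simp: completely_random_measure_def)
  show "prob_space (distr P.\<Omega> discrete_radon_space crm_sample)" by (rule prob_space.prob_space_distr[OF P.prob_space_\<Omega> crm_sample_measurable])
  fix f :: "'a \<Rightarrow> real" assume f: "f \<in> cont_compact_support"
  have fm[measurable]: "f \<in> borel_measurable borel" by (rule cont_compact_support_measurable[OF f])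
  have one: "(\<lambda>_. 1) \<in> (pos_multipliers :: ('a \<Rightarrow> real) set)"
    by (auto simp: pos_multipliers_def intro!: exI[of _ "{}"])
  have z: "(LINT x:Y|\<eta>. log_ratio_integrand l (\<lambda>_. 1) \<eta> x) = 0" for \<eta>
  proof -
    have "indicator Y x *\<^sub>R log_ratio_integrand l (\<lambda>_. 1) \<eta> x = 0" for x
    proof (cases "x \<in> Y \<and> measure \<eta> {x} \<noteq> 0")
      case True
      then have "0 < measure \<eta> {x}" by (simp add: zero_less_measure_iff)
      then have "0 < l x (measure \<eta> {x})" using True by (simp add: Y_def)
      then show ?thesis by (simp add: log_ratio_integrand_def)
    qed (auto simp: log_ratio_integrand_def)
    then show ?thesis by (simp only: set_lebesgue_integral_def integral_zero)
  qed
  have \<rho>1: "AE z in m. \<rho> (\<lambda>_. 1) z *\<^sub>R iexp (snd z * f (fst z)) - 1 = iexp (snd z * f (fst z)) - 1"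
    using AE_m
  proof eventually_elim
    case (elim z)
    then have "0 < L (fst z) (snd z)" by (intro L_pos) auto
    then show ?case by (simp add: \<rho>_def)
  qed
  have "(CLINT \<eta>|distr P.\<Omega> discrete_radon_space crm_sample. iexp (LINT x|\<eta>. f x)) = (CLINT \<omega>|P.\<Omega>. iexp (LINT x|crm_sample \<omega>. f x))"
    by (rule integral_distr[OF crm_sample_measurable]) (use integral_measurable_discrete[OF f] in measurable)
  also have "\<dots> = exp (\<integral>z. \<rho> (\<lambda>_. 1) z *\<^sub>R iexp (snd z * f (fst z)) - 1 \<partial>m)"
    using exponential_crm_sample(2)[OF one f] by (simp only: z of_real_0 add_0)
  also have "(\<integral>z. \<rho> (\<lambda>_. 1) z *\<^sub>R iexp (snd z * f (fst z)) - 1 \<partial>m) = (\<integral>z. iexp (snd z * f (fst z)) - 1 \<partial>m)"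
    using \<rho>1 by (intro integral_cong_AE) (simp_all cong: measurable_cong_sets)
  also have "\<dots> = (\<integral>z. iexp (snd z * f (fst z)) - 1 \<partial>levy_measure \<sigma> l)"
    by (rule integral_m_cong_levy) measurable
  also have "exp \<dots> = (CLINT \<eta>|\<mu>. iexp (LINT x|\<eta>. f x))"
    using \<mu> f by (simp add: completely_random_measure_def)
  finally show "(CLINT \<eta>|\<mu>. iexp (LINT x|\<eta>. f x)) = (CLINT \<eta>|distr P.\<Omega> discrete_radon_space crm_sample. iexp (LINT x|\<eta>. f x))"
    by simp
qed simp

section \<open>Quasi-invariance\<close>

text \<open>
  Both sides have the transform \<open>exp \<integral> \<rho> (exp (i s f(x)) - 1) dm\<close>. For the image measure this is the transform
  of \<open>\<mu>\<close> at \<open>f \<theta>\<close>, rewritten by the dilation of the Levy measure. For the density it is the exponential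
  formula, in which the compensator \<open>\<integral> (\<rho> - 1) dm\<close> turns \<open>\<rho> exp (i s f(x)) - 1\<close> into
  \<open>\<rho> (exp (i s f(x)) - 1)\<close>. Taking \<open>f = 0\<close> shows that the density has total mass \<open>1\<close>.
\<close>

lemma quasi_invariance:
  assumes \<mu>: "completely_random_measure (levy_measure \<sigma> l) \<mu>" and \<theta>: "\<theta> \<in> pos_multipliers"
  defines "Z \<equiv> \<lambda>\<eta>. (LINT x:Y|\<eta>. log_ratio_integrand l \<theta> \<eta> x) - (\<integral>z. \<rho> \<theta> z - 1 \<partial>m)"
  shows "distr \<mu> discrete_radon_space (rescale \<theta>) = density \<mu> (\<lambda>\<eta>. ennreal (exp (Z \<eta>)))"
    and "AE \<eta> in \<mu>. set_integrable \<eta> Y (log_ratio_integrand l \<theta> \<eta>)"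
    and "(\<lambda>\<eta>. ennreal (exp (Z \<eta>))) \<in> borel_measurable \<mu>"
proof -
  note \<theta>m[measurable] = pos_multipliers_measurable[OF \<theta>] and pos = pos_multipliers_pos[OF \<theta>]
  have prob: "prob_space \<mu>" and sets[measurable_cong]: "sets \<mu> = sets discrete_radon_space"
    and char: "\<And>f. f \<in> cont_compact_support \<Longrightarrow>
      (CLINT \<eta>|\<mu>. iexp (LINT x|\<eta>. f x)) = exp (CLINT z|levy_measure \<sigma> l. iexp (snd z * f (fst z)) - 1)"
    using \<mu> by (auto simp: completely_random_measure_def)
  interpret \<mu>: prob_space \<mu> by (rule prob)
  note law = law_of_completely_random_measure[OF \<mu>]
  let ?LR = "\<lambda>\<eta>. LINT x:Y|\<eta>. log_ratio_integrand l \<theta> \<eta> x"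
  let ?c = "\<integral>z. \<rho> \<theta> z - 1 \<partial>m"
  have LRm[measurable]: "?LR \<in> borel_measurable discrete_radon_space"
    by (rule measurable_log_ratio_integral[OF \<theta>m pos])
  have Zm: "Z \<in> borel_measurable discrete_radon_space" unfolding Z_def by measurable
  then have Zm'[measurable]: "Z \<in> borel_measurable \<mu>" by (simp cong: measurable_cong_sets)
  then show Zem: "(\<lambda>\<eta>. ennreal (exp (Z \<eta>))) \<in> borel_measurable \<mu>" by measurable
  have rm: "rescale \<theta> \<in> measurable \<mu> discrete_radon_space"
    using measurable_rescale[OF loc_compact \<theta>] by (simp cong: measurable_cong_sets)
  \<comment> \<open>On the Poisson sample the exponential formula applies; it is transported along the law of the sample.\<close>
  have transfer: "integrable \<mu> (\<lambda>\<eta>. exp (Z \<eta>) *\<^sub>R iexp (LINT x|\<eta>. f x)) \<and>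
      (\<integral>\<eta>. exp (Z \<eta>) *\<^sub>R iexp (LINT x|\<eta>. f x) \<partial>\<mu>) =
      exp (\<integral>z. \<rho> \<theta> z *\<^sub>R (iexp (snd z * f (fst z)) - 1) \<partial>m)"
    if f: "f \<in> cont_compact_support" for f
  proof -
    have fm[measurable]: "f \<in> borel_measurable borel" by (rule cont_compact_support_measurable[OF f])
    let ?E = "\<lambda>\<eta>. exp (complex_of_real (?LR \<eta>) + \<i> * complex_of_real (LINT x|\<eta>. f x))"
    have Em: "?E \<in> borel_measurable discrete_radon_space"
      using integral_measurable_discrete[OF f] by measurable
    have eq: "exp (Z \<eta>) *\<^sub>R iexp (LINT x|\<eta>. f x) = complex_of_real (exp (- ?c)) * ?E \<eta>" for \<eta>
      by (simp add: Z_def exp_diff exp_add exp_minus exp_of_real scaleR_conv_of_real field_simps)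
    have i: "integrable \<mu> ?E"
      unfolding law using exponential_crm_sample(1)[OF \<theta> f]
      by (subst integrable_distr_eq[OF crm_sample_measurable Em])
    have "(\<integral>\<eta>. ?E \<eta> \<partial>\<mu>) = (\<integral>\<omega>. ?E (crm_sample \<omega>) \<partial>P.\<Omega>)"
      unfolding law by (rule integral_distr[OF crm_sample_measurable Em])
    also have "\<dots> = exp (\<integral>z. \<rho> \<theta> z *\<^sub>R iexp (snd z * f (fst z)) - 1 \<partial>m)"
      by (rule exponential_crm_sample(2)[OF \<theta> f])
    also have "(\<integral>z. \<rho> \<theta> z *\<^sub>R iexp (snd z * f (fst z)) - 1 \<partial>m) =
      (\<integral>z. \<rho> \<theta> z *\<^sub>R (iexp (snd z * f (fst z)) - 1) + complex_of_real (\<rho> \<theta> z - 1) \<partial>m)"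
      by (intro Bochner_Integration.integral_cong refl) (simp add: algebra_simps scaleR_conv_of_real)
    also have "\<dots> = (\<integral>z. \<rho> \<theta> z *\<^sub>R (iexp (snd z * f (fst z)) - 1) \<partial>m) + complex_of_real ?c"
      unfolding integral_complex_of_real[symmetric]
      by (rule Bochner_Integration.integral_add[OF exponential_crm_sample(3)[OF \<theta> f] integrable_of_real[OF \<rho>_minus_1_integrable[OF \<theta>]]])
    finally have E: "(\<integral>\<eta>. ?E \<eta> \<partial>\<mu>) =
      exp ((\<integral>z. \<rho> \<theta> z *\<^sub>R (iexp (snd z * f (fst z)) - 1) \<partial>m) + complex_of_real ?c)" .
    have "complex_of_real (exp (- ?c)) * exp (w + complex_of_real ?c) = exp w" for w
      by (simp add: exp_add exp_minus exp_of_real)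
    then show ?thesis
      unfolding eq integral_mult_right_zero E using i by (intro conjI integrable_mult_right) simp_all
  qed
  have int1: "integrable \<mu> (\<lambda>\<eta>. exp (Z \<eta>)) \<and> (\<integral>\<eta>. exp (Z \<eta>) \<partial>\<mu>) = 1"
  proof -
    have zero: "(\<lambda>x. 0) \<in> (cont_compact_support :: ('a \<Rightarrow> real) set)" by (simp add: cont_compact_support_def)
    have "integrable \<mu> (\<lambda>\<eta>. complex_of_real (exp (Z \<eta>)))" and
      e: "(\<integral>\<eta>. complex_of_real (exp (Z \<eta>)) \<partial>\<mu>) = 1"
      using transfer[OF zero] by (simp_all add: scaleR_conv_of_real)
    then have "integrable \<mu> (\<lambda>\<eta>. Re (complex_of_real (exp (Z \<eta>))))" by (intro integrable_Re)
    moreover have "(\<integral>\<eta>. exp (Z \<eta>) \<partial>\<mu>) = 1"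
      using e unfolding integral_complex_of_real by (simp only: of_real_eq_1_iff)
    ultimately show ?thesis by simp
  qed
  show "distr \<mu> discrete_radon_space (rescale \<theta>) = density \<mu> (\<lambda>\<eta>. ennreal (exp (Z \<eta>)))"
  proof (rule discrete_law_eqI[OF loc_compact])
    show "prob_space (distr \<mu> discrete_radon_space (rescale \<theta>))" by (rule \<mu>.prob_space_distr[OF rm])
    show "prob_space (density \<mu> (\<lambda>\<eta>. ennreal (exp (Z \<eta>))))"
    proof (rule prob_spaceI)
      have "emeasure (density \<mu> (\<lambda>\<eta>. ennreal (exp (Z \<eta>)))) (space (density \<mu> (\<lambda>\<eta>. ennreal (exp (Z \<eta>))))) =
        (\<integral>\<^sup>+\<eta>. ennreal (exp (Z \<eta>)) \<partial>\<mu>)"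
        by (subst emeasure_density[OF Zem]) (auto intro!: nn_integral_cong)
      also have "\<dots> = ennreal (\<integral>\<eta>. exp (Z \<eta>) \<partial>\<mu>)" using int1 by (intro nn_integral_eq_integral) auto
      finally show "emeasure (density \<mu> (\<lambda>\<eta>. ennreal (exp (Z \<eta>)))) (space (density \<mu> (\<lambda>\<eta>. ennreal (exp (Z \<eta>))))) = 1"
        using int1 by simp
    qed
    fix f :: "'a \<Rightarrow> real" assume f: "f \<in> cont_compact_support"
    have fm[measurable]: "f \<in> borel_measurable borel" by (rule cont_compact_support_measurable[OF f])
    have f\<theta>: "(\<lambda>x. f x * \<theta> x) \<in> cont_compact_support"
      by (intro cont_compact_support_mult f pos_multipliers_continuous \<theta>)
    have "(CLINT \<eta>|distr \<mu> discrete_radon_space (rescale \<theta>). iexp (LINT x|\<eta>. f x)) =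
      (CLINT \<eta>|\<mu>. iexp (LINT x|rescale \<theta> \<eta>. f x))"
      by (rule integral_distr[OF rm]) (use integral_measurable_discrete[OF f] in measurable)
    also have "\<dots> = (CLINT \<eta>|\<mu>. iexp (LINT x|\<eta>. f x * \<theta> x))"
    proof (intro Bochner_Integration.integral_cong refl)
      fix \<eta> assume "\<eta> \<in> space \<mu>"
      then have "\<eta> \<in> radon_measures"
        using sets_eq_imp_space_eq[OF sets] by (simp add: space_discrete_radon_space discrete_radon_measures_def)
      then show "iexp (LINT x|rescale \<theta> \<eta>. f x) = iexp (LINT x|\<eta>. f x * \<theta> x)"
        by (simp add: integral_rescale[OF \<theta>])
    qed
    also have "\<dots> = exp (\<integral>z. iexp (snd z * (f (fst z) * \<theta> (fst z))) - 1 \<partial>m)"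
      unfolding char[OF f\<theta>] by (subst integral_m_cong_levy) measurable
    also have "(\<integral>z. iexp (snd z * (f (fst z) * \<theta> (fst z))) - 1 \<partial>m) =
      (\<integral>z. (\<lambda>z. iexp (snd z * f (fst z)) - 1) (fst z, snd z * \<theta> (fst z)) \<partial>m)"
      by (simp add: mult_ac)
    also have "\<dots> = (\<integral>z. \<rho> \<theta> z *\<^sub>R (iexp (snd z * f (fst z)) - 1) \<partial>m)"
      by (rule integral_rescaled[OF \<theta>]) measurable
    also have "exp \<dots> = (\<integral>\<eta>. exp (Z \<eta>) *\<^sub>R iexp (LINT x|\<eta>. f x) \<partial>\<mu>)"
      using transfer[OF f] by simp
    also have "\<dots> = (CLINT \<eta>|density \<mu> (\<lambda>\<eta>. ennreal (exp (Z \<eta>))). iexp (LINT x|\<eta>. f x))"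
    proof (rule integral_density[symmetric])
      have "(\<lambda>\<eta>. LINT x|\<eta>. f x) \<in> borel_measurable \<mu>"
        using integral_measurable_discrete[OF f] by (simp cong: measurable_cong_sets)
      then show "(\<lambda>\<eta>. iexp (LINT x|\<eta>. f x)) \<in> borel_measurable \<mu>" by measurable
    qed simp_all
    finally show "(CLINT \<eta>|distr \<mu> discrete_radon_space (rescale \<theta>). iexp (LINT x|\<eta>. f x)) =
      (CLINT \<eta>|density \<mu> (\<lambda>\<eta>. ennreal (exp (Z \<eta>))). iexp (LINT x|\<eta>. f x))" .
  qed (simp_all add: sets)
  show "AE \<eta> in \<mu>. set_integrable \<eta> Y (log_ratio_integrand l \<theta> \<eta>)"
  proof -
    have "AE \<omega> in P.\<Omega>. (\<integral>\<^sup>+x. ennreal \<bar>indicator Y x *\<^sub>R log_ratio_integrand l \<theta> (crm_sample \<omega>) x\<bar> \<partial>crm_sample \<omega>) < \<infinity>"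
      using AE_log_ratio_summable[OF \<theta>] AE_crm_sample
    proof eventually_elim
      case (elim \<omega>)
      then have good: "good \<omega>" and TT: "crm_sample \<omega> = sum_measure \<omega>" by auto
      from log_ratio_sum_measure(1)[OF \<theta> good elim(1)]
      show ?case unfolding TT set_integrable_log_ratio_iff[OF \<theta>m pos sum_measure_discrete[OF good]] .
    qed
    then have "AE \<eta> in \<mu>. (\<integral>\<^sup>+x. ennreal \<bar>indicator Y x *\<^sub>R log_ratio_integrand l \<theta> \<eta> x\<bar> \<partial>\<eta>) < \<infinity>"
      unfolding law using measurable_abs_log_ratio_integral[OF \<theta>m pos]
      by (subst AE_distr_iff[OF crm_sample_measurable]) measurable
    moreover have "AE \<eta> in \<mu>. \<eta> \<in> discrete_radon_measures"
      using sets_eq_imp_space_eq[OF sets] by (intro AE_I2) (simp add: space_discrete_radon_space)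
    ultimately show ?thesis
      by eventually_elim (simp add: set_integrable_log_ratio_iff[OF \<theta>m pos])
  qed
qed

end

theorem theorem13:
  fixes \<sigma> :: "'a::polish_space measure"
    and l :: "'a \<Rightarrow> real \<Rightarrow> real"
    and \<mu> :: "'a measure measure"
    and Y :: "'a set"
  assumes loc_compact: "locally_compact_space (euclidean :: 'a topology)"
    and radon: "\<sigma> \<in> radon_measures"
    and non_atomic: "\<forall>x. emeasure \<sigma> {x} = 0"
    and l_meas: "(\<lambda>(x, s). l x s) \<in> borel_measurable (borel \<Otimes>\<^sub>M restrict_space borel {0<..})"
    and l_nonneg: "\<forall>x. \<forall>s>0. 0 \<le> l x s"
    and l_dichotomy: "\<forall>x. (\<forall>s>0. 0 < l x s) \<or> (\<forall>s>0. l x s = 0)"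
    and Y: "Y = {x. \<forall>s>0. 0 < l x s}"
    and l_integrable: "\<forall>A\<in>bounded_borel Y.
      (\<integral>\<^sup>+(x, s)\<in>A \<times> {0<..}. ennreal (l x s * min (inverse s) 1) \<partial>(\<sigma> \<Otimes>\<^sub>M lborel_pos)) < \<infinity>"
    and l_regular: "\<forall>n::nat. n \<ge> 1 \<longrightarrow> (\<exists>\<epsilon>>0. \<forall>A\<in>bounded_borel Y.
      (\<integral>\<^sup>+x\<in>A. (SUP r\<in>{1 / real n..real n}.
         \<integral>\<^sup>+s\<in>{0<..<\<epsilon>}. ennreal (\<bar>l x (r * s) - l x s\<bar> / s) \<partial>lborel) \<partial>\<sigma>) < \<infinity>)"
    and mu: "completely_random_measure (levy_measure \<sigma> l) \<mu>"
  shows "\<forall>\<theta>\<in>pos_multipliers.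
    (\<forall>\<eta>\<in>discrete_radon_measures. rescale \<theta> \<eta> \<in> discrete_radon_measures) \<and>
    absolutely_continuous \<mu> (distr \<mu> discrete_radon_space (rescale \<theta>)) \<and>
    absolutely_continuous (distr \<mu> discrete_radon_space (rescale \<theta>)) \<mu> \<and>
    (AE \<eta> in \<mu>. set_integrable \<eta> Y (\<lambda>x.
       ln (l x (inverse (\<theta> x) * measure \<eta> {x}) / l x (measure \<eta> {x})) * inverse (measure \<eta> {x}))) \<and>
    (AE \<eta> in \<mu>. RN_deriv \<mu> (distr \<mu> discrete_radon_space (rescale \<theta>)) \<eta> = ennreal (exp (
       (LINT x:Y|\<eta>.
          ln (l x (inverse (\<theta> x) * measure \<eta> {x}) / l x (measure \<eta> {x})) * inverse (measure \<eta> {x})) +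
       (LINT x:Y|\<sigma>. LINT s:{0<..}|lborel. (l x s - l x (inverse (\<theta> x) * s)) / s))))"
proof (intro ballI conjI)
  fix \<theta> :: "'a \<Rightarrow> real" assume \<theta>: "\<theta> \<in> pos_multipliers"
  interpret D: levy_density \<sigma> l
    using loc_compact radon non_atomic l_meas l_nonneg l_dichotomy by unfold_locales auto
  have YD: "Y = D.Y" by (simp add: Y D.Y_def)
  interpret R: levy_regular \<sigma> l
    using l_integrable l_regular unfolding YD by unfold_locales auto
  obtain S where "poisson_construction D.m S" by (rule R.poisson_construction_exists)
  then interpret C: crm_construction \<sigma> l S
    by (simp add: crm_construction_def R.levy_regular_axioms)
  have "prob_space \<mu>" using mu by (simp add: completely_random_measure_def)
  then interpret \<mu>: prob_space \<mu> .
  note Q = C.quasi_invariance[OF mu \<theta>]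
  show "rescale \<theta> \<eta> \<in> discrete_radon_measures" if "\<eta> \<in> discrete_radon_measures" for \<eta>
    by (rule rescale_discrete[OF \<theta> that])
  show "absolutely_continuous \<mu> (distr \<mu> discrete_radon_space (rescale \<theta>))"
    unfolding Q(1) by (rule absolutely_continuousI_density[OF Q(3)])
  show "absolutely_continuous (distr \<mu> discrete_radon_space (rescale \<theta>)) \<mu>"
    unfolding Q(1) absolutely_continuous_def
    by (auto simp: null_sets_density_iff[OF Q(3)] AE_iff_null_sets)
  show "AE \<eta> in \<mu>. set_integrable \<eta> Y (\<lambda>x.
       ln (l x (inverse (\<theta> x) * measure \<eta> {x}) / l x (measure \<eta> {x})) * inverse (measure \<eta> {x}))"
    using Q(2) unfolding log_ratio_integrand_def YD .
  show "AE \<eta> in \<mu>. RN_deriv \<mu> (distr \<mu> discrete_radon_space (rescale \<theta>)) \<eta> = ennreal (exp (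
       (LINT x:Y|\<eta>.
          ln (l x (inverse (\<theta> x) * measure \<eta> {x}) / l x (measure \<eta> {x})) * inverse (measure \<eta> {x})) +
       (LINT x:Y|\<sigma>. LINT s:{0<..}|lborel. (l x s - l x (inverse (\<theta> x) * s)) / s)))"
    using \<mu>.RN_deriv_unique[OF Q(3) Q(1)[symmetric]]
  proof eventually_elim
    case (elim \<eta>)
    then show ?case unfolding YD log_ratio_integrand_def R.compensator_eq[OF \<theta>] by simp
  qed
qed

end
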